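(* The probabilities of non-ruin $\varphi_i(u)=P\{\inf_{0\le t<\infty}\xi_t\ge0\mid\xi_0=u,\ \text{initial state of the environment}=i\}$ of the risk process in a Markovian environment described in the context satisfy, for all $u\ge0$ and $i=1,\dots,m$, the system of integral equations $$\varphi_i(u)=\int_0^\infty e^{-t(\alpha_i+\lambda_i)}\Big\{\lambda_i\sum_{j=1}^mp_{ij}\,\varphi_j(U_i(u,t))+\alpha_i\int_0^{U_i(u,t)}\varphi_i(U_i(u,t)-z)\,dF_i(z)\Big\}dt.$$
   Context: The environment is a continuous-time Markov chain with states $1,\dots,m$: the probability of remaining in state $i$ during time $\Delta$ is $e^{-\lambda_i\Delta}$ and the probability of passing from $i$ to $j\ne i$ during time $\Delta$ is $\lambda_ip_{ij}\Delta+o(\Delta)$, where $\lambda_i>0$, $p_{ij}\ge0$, $p_{ii}=0$, $\sum_{j=1}^mp_{ij}=1$. While the environment is in state $i$: claims arrive according to a Poisson flow of intensity $\alpha_i>0$; claim sizes are independent with distribution function $F_i$ ($F_i(z)=0$ for $z\le0$) and finite mean $\mu_i$; each claim instantly decreases the capital $\xi_t$ by its size; and between claims the capital grows by $d\xi_t/dt=c_i(\xi_t)$ with $c_i(\cdot)\ge0$. $U_i(u,t)$ denotes the solution of $dU_i/dt=c_i(U_i)$, $U_i(u,0)=u$, assumed uniquely defined for all $u,t\ge0$ (the capital at time $t$ when the environment stays in state $i$ and no claims arrive). Claim arrivals, claim sizes and environment transitions are independent in the usual sense. The inner integral is a Lebesgue–Stieltjes integral over $[0,U_i(u,t)]$.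 *)

theory Defs
  imports "HOL-Probability.Probability" "HOL-Library.Landau_Symbols"
begin

text \<open>
  The environment is a time-homogeneous Markov family: under \<open>P i\<close> the chain starts in state \<open>i\<close>,
  so \<open>P i\<close> plays the role of the conditional law given the initial state \<open>i\<close>.  Paths are
  right-continuous step functions (at most finitely many jumps in bounded time).
\<close>

locale markov_environment =
  fixes P :: "'s::finite \<Rightarrow> 'w measure"
    and J :: "real \<Rightarrow> 'w \<Rightarrow> 's"
    and lam :: "'s \<Rightarrow> real"
    and p :: "'s \<Rightarrow> 's \<Rightarrow> real"
  assumes lam_pos: "0 < lam i"
    and p_nonneg: "0 \<le> p i j"
    and p_diag: "p i i = 0"
    and p_sum: "(\<Sum>j\<in>UNIV. p i j) = 1"
    and prob_space_P: "prob_space (P i)"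
    and J_measurable: "0 \<le> t \<Longrightarrow> J t \<in> measurable (P i) (count_space UNIV)"
    and J_right_continuous: "w \<in> space (P i) \<Longrightarrow> 0 \<le> t \<Longrightarrow> \<forall>\<^sub>F s in at_right t. J s w = J t w"
    and J_left_limit: "w \<in> space (P i) \<Longrightarrow> 0 < t \<Longrightarrow> \<exists>k. \<forall>\<^sub>F s in at_left t. J s w = k"
    and J_initial: "AE w in P i. J 0 w = i"
    and J_Markov: "0 \<le> ts 0 \<Longrightarrow> strict_mono_on {..Suc n} ts \<Longrightarrow>
        \<P>(w in P i. \<forall>k\<le>Suc n. J (ts k) w = x k) =
        \<P>(w in P i. \<forall>k\<le>n. J (ts k) w = x k) *
        \<P>(w in P (x n). J (ts (Suc n) - ts n) w = x (Suc n))"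
    and J_remain: "0 \<le> \<Delta> \<Longrightarrow> \<P>(w in P i. \<forall>s\<in>{0..\<Delta>}. J s w = i) = exp (- lam i * \<Delta>)"
    and J_pass: "i \<noteq> j \<Longrightarrow>
        (\<lambda>\<Delta>. \<P>(w in P i. J \<Delta> w = j) - lam i * p i j * \<Delta>) \<in> o[at_right 0](\<lambda>\<Delta>. \<Delta>)"

definition interarrival :: "(nat \<Rightarrow> 'w \<Rightarrow> real) \<Rightarrow> nat \<Rightarrow> 'w \<Rightarrow> real" where
  "interarrival T n w = T n w - (if n = 0 then 0 else T (n - 1) w)"

definition poisson_flow :: "'w measure \<Rightarrow> real \<Rightarrow> (nat \<Rightarrow> 'w \<Rightarrow> real) \<Rightarrow> bool" where
  "poisson_flow M a T \<longleftrightarrow>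
     (\<forall>w\<in>space M. 0 < T 0 w \<and> strict_mono (\<lambda>n. T n w) \<and>
        filterlim (\<lambda>n. T n w) at_top sequentially) \<and>
     prob_space.indep_vars M (\<lambda>_. borel) (interarrival T) UNIV \<and>
     (\<forall>n. distributed M lborel (interarrival T n) (exponential_density a))"

datatype 's source = Environment | Arrivals 's | Claim_Size 's nat

fun source_events ::
  "'w measure \<Rightarrow> (real \<Rightarrow> 'w \<Rightarrow> 's) \<Rightarrow> ('s \<Rightarrow> nat \<Rightarrow> 'w \<Rightarrow> real) \<Rightarrow> ('s \<Rightarrow> nat \<Rightarrow> 'w \<Rightarrow> real) \<Rightarrow>
    's source \<Rightarrow> 'w set set" where
  "source_events M J T Z Environment =
     sigma_sets (space M) {J t -` B \<inter> space M | t B. 0 \<le> t}"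
| "source_events M J T Z (Arrivals i) =
     sigma_sets (space M) {T i n -` B \<inter> space M | n B. B \<in> sets borel}"
| "source_events M J T Z (Claim_Size i n) =
     sigma_sets (space M) {Z i n -` B \<inter> space M | B. B \<in> sets borel}"

definition growth_solution :: "(real \<Rightarrow> real) \<Rightarrow> real \<Rightarrow> (real \<Rightarrow> real) \<Rightarrow> bool" where
  "growth_solution c u y \<longleftrightarrow>
     y 0 = u \<and> (\<forall>t\<ge>0. (y has_real_derivative c (y t)) (at t within {0..}))"

text \<open>
  Every state \<open>i\<close> carries its own flow of arrival times \<open>T i 0 < T i 1 < \<dots>\<close>; the point \<open>T i n\<close> is
  a claim, of size \<open>Z i n\<close>, exactly when the environment \<open>J\<close> is in state \<open>i\<close> at that time.
  The sum has at most one summand, because \<open>T i\<close> is strictly increasing.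
\<close>

definition claim_amount ::
  "(real \<Rightarrow> 's) \<Rightarrow> ('s \<Rightarrow> nat \<Rightarrow> real) \<Rightarrow> ('s \<Rightarrow> nat \<Rightarrow> real) \<Rightarrow> real \<Rightarrow> real" where
  "claim_amount J T Z t = (\<Sum>n | T (J t) n = t. Z (J t) n)"

text \<open>
  \<open>x\<close> is the capital along one realisation, with \<open>x t\<close> the value just after a claim at time \<open>t\<close>.
  The dynamics are imposed only as long as the capital has not become negative: the growth
  equation is assumed solvable only from nonnegative capital, and the behaviour of \<open>x\<close>
  after ruin does not affect whether its infimum is nonnegative.
\<close>

definition capital_path ::
  "('s \<Rightarrow> real \<Rightarrow> real) \<Rightarrow> (real \<Rightarrow> 's) \<Rightarrow> ('s \<Rightarrow> nat \<Rightarrow> real) \<Rightarrow> ('s \<Rightarrow> nat \<Rightarrow> real) \<Rightarrow>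
    real \<Rightarrow> (real \<Rightarrow> real) \<Rightarrow> bool" where
  "capital_path c J T Z u x \<longleftrightarrow>
     x 0 = u \<and>
     (\<forall>i s t. 0 \<le> s \<and> s < t \<and> (\<forall>r\<in>{0..s}. 0 \<le> x r) \<and>
        (\<forall>r\<in>{s..<t}. J r = i) \<and> (\<forall>r\<in>{s<..<t}. \<forall>n. T i n \<noteq> r) \<longrightarrow>
        (\<forall>r\<in>{s..<t}. (x has_real_derivative c i (x r)) (at r within {s..<t}))) \<and>
     (\<forall>t>0. (\<forall>r\<in>{0..<t}. 0 \<le> x r) \<longrightarrow>
        (x \<longlongrightarrow> x t + claim_amount J T Z t) (at_left t))"

text \<open>\<open>\<xi> u t\<close> is the capital at time \<open>t\<close> for the initial capital \<open>u\<close>.\<close>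

locale markov_environment_risk_process = markov_environment P J lam p
  for P :: "'s::finite \<Rightarrow> 'w measure"
    and J :: "real \<Rightarrow> 'w \<Rightarrow> 's"
    and lam :: "'s \<Rightarrow> real"
    and p :: "'s \<Rightarrow> 's \<Rightarrow> real" +
  fixes \<alpha> :: "'s \<Rightarrow> real"
    and F :: "'s \<Rightarrow> real \<Rightarrow> real"
    and \<mu> :: "'s \<Rightarrow> real"
    and c :: "'s \<Rightarrow> real \<Rightarrow> real"
    and U :: "'s \<Rightarrow> real \<Rightarrow> real \<Rightarrow> real"
    and T :: "'s \<Rightarrow> nat \<Rightarrow> 'w \<Rightarrow> real"
    and Z :: "'s \<Rightarrow> nat \<Rightarrow> 'w \<Rightarrow> real"
    and \<xi> :: "real \<Rightarrow> real \<Rightarrow> 'w \<Rightarrow> real"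
  assumes \<alpha>_pos: "0 < \<alpha> j"
    and arrivals: "poisson_flow (P i) (\<alpha> j) (T j)"
    and claim_measurable: "Z j n \<in> borel_measurable (P i)"
    and claim_distribution: "cdf (distr (P i) borel (Z j n)) = F j"
    and F_nonpos: "z \<le> 0 \<Longrightarrow> F j z = 0"
    and claim_mean: "has_bochner_integral (P i) (Z j n) (\<mu> j)"
    and independence: "prob_space.indep_sets (P i) (source_events (P i) J T Z) UNIV"
    and c_nonneg: "0 \<le> c j r"
    and U_solution: "0 \<le> u \<Longrightarrow> growth_solution (c j) u (U j u)"
    and U_unique: "0 \<le> u \<Longrightarrow> growth_solution (c j) u y \<Longrightarrow> 0 \<le> t \<Longrightarrow> y t = U j u t"
    and capital: "0 \<le> u \<Longrightarrow> w \<in> space (P i) \<Longrightarrow>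
        capital_path c (\<lambda>t. J t w) (\<lambda>j n. T j n w) (\<lambda>j n. Z j n w) u (\<lambda>t. \<xi> u t w)"

definition nonruin_prob ::
  "('s \<Rightarrow> 'w measure) \<Rightarrow> (real \<Rightarrow> real \<Rightarrow> 'w \<Rightarrow> real) \<Rightarrow> 's \<Rightarrow> real \<Rightarrow> real" where
  "nonruin_prob P \<xi> i u = \<P>(w in P i. 0 \<le> (INF t\<in>{0..}. ereal (\<xi> u t w)))"

end

theory Submission
  imports Defs
begin

text \<open>
  Whether ruin occurs is a measurable function of the configuration consisting of the environment
  path and, for each state, the marked flow of interarrival times and claim sizes. At a deterministic
  time \<open>h\<close> the configuration restarts: given the environment state \<open>k\<close> at time \<open>h\<close>, the shifted
  configuration has the law of \<open>P k\<close> and is independent of the arrivals and claims before \<open>h\<close>.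
  Distinguishing what happens in \<open>[0, h]\<close> (nothing, one environment jump, one claim, or an event of
  probability \<open>o(h)\<close>) and using that survival is monotone in the capital, one obtains, with
  \<open>\<beta> = \<alpha> i + lam i\<close> and \<open>R\<close> the expression in braces as a function of the capital,
  \<open>h R(u) - o(h) \<le> \<phi>(u) - exp(- \<beta> h) \<phi>(U(u,h)) \<le> h R(U(u,h)) + o(h)\<close> uniformly in \<open>u\<close>.
  Along the flow \<open>t \<mapsto> U(u,t)\<close> the function \<open>R\<close> is monotone, so the errors telescope and
  \<open>exp(- \<beta> t) \<phi>(U(u,t)) + \<integral> exp(- \<beta> s) R(U(u,s)) ds\<close> over \<open>[0, t]\<close> is constant in \<open>t\<close>; let \<open>t\<close> tend to infinity.
  No strong Markov property is needed, and \<open>U\<close> need not be continuous in the initial capital.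
\<close>

section \<open>Growth flows and capital paths\<close>

text \<open>The hypotheses do not say that two environment jumps in \<open>[0, h]\<close> have
  probability of order \<open>h\<close> squared. This is derived by scanning a grid for the first
  point at which the state has changed and restarting there, with a bound independent of the mesh. A
  second obstacle is that the instant of a jump or claim is unknown, so the capital at time
  \<open>h\<close> is confined only to an interval, while the non-ruin probability is not known to
  be continuous in the capital. The upper end of that interval carries an extra growth step
  \<open>U k _ h\<close>. It is removed by the lower estimate itself: with jumps and claims dropped,
  that estimate says that growth for a time \<open>h\<close> in state \<open>k\<close> raises the
  non-ruin probability by at most \<open>lag k h\<close>, which tends to 0 with \<open>h\<close>,
  uniformly in the capital. This replaces continuity. Finally, the claim flows of all states run
  permanently, so for an environment jump only the case in which all of them are silent is analysed;
  the loss is a factor of order \<open>h\<close> on an event that is already of order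
  \<open>h\<close>.\<close>

locale growth_flow =
  fixes c :: "'s::finite \<Rightarrow> real \<Rightarrow> real" and U :: "'s \<Rightarrow> real \<Rightarrow> real \<Rightarrow> real"
  assumes c_nonneg: "0 \<le> c j r"
    and U_solution: "0 \<le> u \<Longrightarrow> growth_solution (c j) u (U j u)"
    and U_unique: "0 \<le> u \<Longrightarrow> growth_solution (c j) u y \<Longrightarrow> 0 \<le> t \<Longrightarrow> y t = U j u t"
begin

lemma U_0: "0 \<le> u \<Longrightarrow> U j u 0 = u"
  using U_solution[of u j] by (simp add: growth_solution_def)

lemma U_derivative: "0 \<le> u \<Longrightarrow> 0 \<le> t \<Longrightarrow> (U j u has_real_derivative c j (U j u t)) (at t within {0..})"
  using U_solution[of u j] by (simp add: growth_solution_def)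

lemma U_continuous: "0 \<le> u \<Longrightarrow> continuous_on {0..} (U j u)"
  by (rule DERIV_continuous_on) (use U_derivative in auto)

text \<open>The mean value theorem together with \<open>0 \<le> c j r\<close>. The one-sided
  derivatives at \<open>a\<close> and \<open>b\<close> enter only through continuity.\<close>

lemma solution_mono:
  assumes "\<And>q. q \<in> {a..b} \<Longrightarrow> (y has_real_derivative c j (y q)) (at q within {a..b})" "a \<le> b"
  shows "y a \<le> y b"
proof (cases "a = b")
  case False
  have d: "(y has_real_derivative c j (y x)) (at x)" if "a < x" "x < b" for x
    using assms(1)[of x] at_within_Icc_at[of a x b] that by auto
  have "continuous_on {a..b} y" by (rule DERIV_continuous_on[OF assms(1)])
  then obtain l z where "a < z" "z < b" "DERIV y z :> l" "y b - y a = (b - a) * l"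
    using MVT[of a b y] False assms(2) d by (metis order_le_less real_differentiable_def)
  moreover from this have "l = c j (y z)" using d DERIV_unique by blast
  ultimately have "0 \<le> y b - y a" using c_nonneg[of j "y z"] assms(2) by simp
  then show ?thesis by simp
qed simp

lemma U_mono_time:
  assumes "0 \<le> u" "0 \<le> s" "s \<le> t" shows "U j u s \<le> U j u t"
proof (rule solution_mono[OF _ assms(3)])
  fix q assume "q \<in> {s..t}"
  with assms show "(U j u has_real_derivative c j (U j u q)) (at q within {s..t})"
    by (intro has_field_derivative_subset[OF U_derivative]) auto
qed

lemma U_ge: "0 \<le> u \<Longrightarrow> 0 \<le> t \<Longrightarrow> u \<le> U j u t"
  using U_mono_time[of u 0 t j] U_0[of u j] by simp

lemma U_nonneg: "0 \<le> u \<Longrightarrow> 0 \<le> t \<Longrightarrow> 0 \<le> U j u t"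
  using U_ge[of u t j] by linarith

lemma has_derivative_shift:
  assumes "(y has_real_derivative d) (at (s + q) within (+) s ` A)"
  shows "((\<lambda>q. y (s + q)) has_real_derivative d) (at q within A)"
proof -
  have "((+) s has_real_derivative 1) (at q within A)" by (auto intro!: derivative_eq_intros)
  from DERIV_image_chain[OF assms this] show ?thesis by (simp add: o_def)
qed

text \<open>The time-shifted solution solves the growth equation from \<open>U j u s\<close>, so
  uniqueness applies. This is what lets successive short steps compose along one trajectory.\<close>

lemma U_flow:
  assumes "0 \<le> u" "0 \<le> s" "0 \<le> t" shows "U j u (s + t) = U j (U j u s) t"
proof (rule U_unique[OF U_nonneg[OF assms(1,2)] _ assms(3)])
  have "((\<lambda>q. U j u (s + q)) has_real_derivative c j (U j u (s + q))) (at q within {0..})" if "0 \<le> q" for q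
    by (rule has_derivative_shift, rule has_field_derivative_subset[OF U_derivative]) (use assms that in auto)
  then show "growth_solution (c j) (U j u s) (\<lambda>q. U j u (s + q))"
    by (auto simp: growth_solution_def)
qed

text \<open>The candidate is glued strictly before the end of the interval: at the end point itself the
  left derivative of \<open>y\<close> need not be \<open>c j\<close> of the limit, since \<open>c j\<close> may be discontinuous.\<close>

lemma local_solution_eq_U:
  assumes y: "\<And>q. q \<in> {s..<t} \<Longrightarrow> (y has_real_derivative c j (y q)) (at q within {s..<t})"
    and "0 \<le> y s" and r: "r \<in> {s..<t}"
  shows "y r = U j (y s) (r - s)"
proof -
  have yr: "y s \<le> y r"
    by (rule solution_mono) (use r in \<open>auto intro!: has_field_derivative_subset[OF y]\<close>)
  then have yr0: "0 \<le> y r" using assms by linarith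
  define l where "l = r - s"
  have l: "0 \<le> l" using r by (simp add: l_def)
  define z where "z q = (if q \<le> l then y (s + q) else U j (y r) (q - l))" for q
  have zl: "z q = y (s + q)" if "q \<in> {0..l}" for q using that by (simp add: z_def)
  have zr: "z q = U j (y r) (q - l)" if "q \<in> {l..}" for q
    using that yr0 by (auto simp: z_def l_def U_0)
  have left: "(z has_real_derivative c j (z q)) (at q within {0..l})" if q: "q \<in> {0..l}" for q
  proof -
    have "((\<lambda>q. y (s + q)) has_real_derivative c j (y (s + q))) (at q within {0..l})"
      by (rule has_derivative_shift, rule has_field_derivative_subset[OF y]) (use q r in \<open>auto simp: l_def\<close>)
    then show ?thesis using zl q
      by (auto intro: has_field_derivative_transform_within[OF _ zero_less_one])
  qed
  have right: "(z has_real_derivative c j (z q)) (at q within {l..})" if q: "q \<in> {l..}" for q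
  proof -
    have "((\<lambda>q. U j (y r) (- l + q)) has_real_derivative c j (U j (y r) (- l + q))) (at q within {l..})"
      by (rule has_derivative_shift, rule has_field_derivative_subset[OF U_derivative]) (use q yr0 in auto)
    then have "((\<lambda>q. U j (y r) (q - l)) has_real_derivative c j (U j (y r) (q - l))) (at q within {l..})"
      by simp
    then show ?thesis using zr q
      by (auto intro: has_field_derivative_transform_within[OF _ zero_less_one])
  qed
  have "(z has_real_derivative c j (z q)) (at q within {0..})" if q: "0 \<le> q" for q
  proof -
    consider "q < l" | "q > l" | "q = l" by linarith
    then show ?thesis
    proof cases
      case 1
      then have "at q within {0..l} = at q within {0..}"
        by (intro at_within_nhd[of _ "{..<l}"]) auto
      then show ?thesis using left[of q] 1 q by auto
    next
      case 2
      then have "at q within {l..} = at q within {0..}"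
        by (intro at_within_nhd[of _ "{l<..}"]) (use l in auto)
      then show ?thesis using right[of q] 2 by auto
    next
      case 3
      have "{0..} = {0..l} \<union> {l..}" using l by auto
      then show ?thesis using left[of q] right[of q] 3 q
        unfolding has_field_derivative_iff by (auto simp: at_within_union intro!: filterlim_sup)
    qed
  qed
  then have "growth_solution (c j) (y s) z"
    using l by (auto simp: growth_solution_def z_def)
  from U_unique[OF assms(2) this l] show ?thesis using l by (simp add: z_def l_def)
qed

text \<open>Comparison without a Lipschitz condition: if the solution started lower were ahead at
  time \<open>t\<close>, the two would have met at some \<open>s\<close> by the intermediate value
  theorem, and from a common value on they coincide by \<open>U_flow\<close>.\<close>

lemma U_mono_initial:
  assumes "0 \<le> u" "u \<le> v" "0 \<le> t" shows "U j u t \<le> U j v t"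
proof (rule ccontr)
  assume less: "\<not> ?thesis"
  have "continuous_on {0..t} (\<lambda>s. U j u s - U j v s)"
    using assms by (intro continuous_intros continuous_on_subset[OF U_continuous]) auto
  then obtain s where s: "0 \<le> s" "s \<le> t" "U j u s - U j v s = 0"
    using IVT'[of "\<lambda>s. U j u s - U j v s" 0 0 t] less assms by (auto simp: U_0)
  have "U j u t = U j v t"
    using U_flow[of u s "t - s" j] U_flow[of v s "t - s" j] s assms by auto
  with less show False by simp
qed

text \<open>One event-free stretch. On \<open>{s..<t}\<close> the capital is a local solution, hence
  given by \<open>U i\<close>. The value at \<open>t\<close> follows by computing the left limit
  there twice, from \<open>capital_path\<close> and from the continuity of \<open>U i\<close> in
  time. Nothing is excluded at \<open>t\<close> itself, which may carry a jump of the environment, a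
  claim, or both.\<close>

lemma capital_path_step:
  assumes y: "capital_path c x T Z u y" and s: "0 \<le> s" "s < t" and pos: "\<forall>r\<in>{0..s}. 0 \<le> y r"
    and x: "\<forall>r\<in>{s..<t}. x r = i" and T: "\<forall>r\<in>{s<..<t}. \<forall>n. T i n \<noteq> r"
  shows "\<forall>r\<in>{s..<t}. y r = U i (y s) (r - s)"
    and "y t = U i (y s) (t - s) - claim_amount x T Z t"
    and "\<forall>r\<in>{0..<t}. 0 \<le> y r"
proof -
  have "\<forall>r\<in>{s..<t}. (y has_real_derivative c i (y r)) (at r within {s..<t})"
    using y s pos x T unfolding capital_path_def by blast
  moreover have ys: "0 \<le> y s" using pos s by auto
  ultimately show *: "\<forall>r\<in>{s..<t}. y r = U i (y s) (r - s)"
    using local_solution_eq_U[of s t y i] by blast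
  show nn: "\<forall>r\<in>{0..<t}. 0 \<le> y r"
  proof
    fix r assume r: "r \<in> {0..<t}"
    show "0 \<le> y r"
    proof (cases "r \<le> s")
      case False
      then have "y r = U i (y s) (r - s)" by (intro *[rule_format]) (use r in auto)
      then show ?thesis using False U_nonneg[OF ys, of "r - s" i] by simp
    qed (use pos r in auto)
  qed
  have "(y \<longlongrightarrow> y t + claim_amount x T Z t) (at_left t)"
    using y nn s unfolding capital_path_def by auto
  moreover have "(y \<longlongrightarrow> U i (y s) (t - s)) (at_left t)"
  proof -
    have "continuous_on {s..} (\<lambda>r. U i (y s) (r - s))"
      by (rule continuous_on_compose2[OF U_continuous[OF ys]]) (auto intro!: continuous_intros)
    then have "((\<lambda>r. U i (y s) (r - s)) \<longlongrightarrow> U i (y s) (t - s)) (at t within {s..})"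
      using s by (auto simp: continuous_on_def)
    then have "((\<lambda>r. U i (y s) (r - s)) \<longlongrightarrow> U i (y s) (t - s)) (at t within {s..<t})"
      by (rule tendsto_within_subset) auto
    moreover have "at t within {s..<t} = at_left t"
      by (rule at_within_nhd[of _ "{s<..}"]) (use s in auto)
    ultimately have l: "((\<lambda>r. U i (y s) (r - s)) \<longlongrightarrow> U i (y s) (t - s)) (at_left t)" by simp
    have "\<forall>\<^sub>F r in at_left t. r \<in> {s<..<t}" by (rule eventually_at_leftI[OF _ s(2)])
    then have "\<forall>\<^sub>F r in at_left t. U i (y s) (r - s) = y r"
      by eventually_elim (rule *[rule_format, symmetric], auto)
    from Lim_transform_eventually[OF l this] show ?thesis .
  qed
  ultimately have "y t + claim_amount x T Z t = U i (y s) (t - s)"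
    using tendsto_unique[of "at_left t"] trivial_limit_at_left_real by blast
  then show "y t = U i (y s) (t - s) - claim_amount x T Z t" by simp
qed

end

section \<open>Ruin read off from the sequence of event times\<close>

definition step_path :: "(real \<Rightarrow> 's) \<Rightarrow> bool" where
  "step_path x \<longleftrightarrow> (\<forall>t\<ge>0. \<forall>\<^sub>F s in at_right t. x s = x t) \<and> (\<forall>t>0. \<exists>k. \<forall>\<^sub>F s in at_left t. x s = k)"

definition arrival_sequence :: "(nat \<Rightarrow> real) \<Rightarrow> bool" where
  "arrival_sequence T \<longleftrightarrow> 0 < T 0 \<and> strict_mono T \<and> filterlim T at_top sequentially"

text \<open>The artificial event \<open>s + 1\<close> keeps the set of candidate times nonempty on every configuration.\<close>

definition next_event :: "(real \<Rightarrow> 's) \<Rightarrow> ('s \<Rightarrow> nat \<Rightarrow> real) \<Rightarrow> real \<Rightarrow> real" where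
  "next_event x T s = Inf ({r. s < r \<and> (x r \<noteq> x s \<or> (\<exists>n. T (x s) n = r))} \<union> {s + 1})"

text \<open>Unlike the sum in \<open>claim_amount\<close>, which is \<open>0\<close> over an infinite index set, this is visibly
  measurable in the configuration; truncating negative capital in \<open>event_state\<close> serves the same purpose,
  as nothing is known about \<open>U j v\<close> for \<open>v < 0\<close>.\<close>

definition claim_at :: "(real \<Rightarrow> 's) \<Rightarrow> ('s \<Rightarrow> nat \<Rightarrow> real) \<Rightarrow> ('s \<Rightarrow> nat \<Rightarrow> real) \<Rightarrow> real \<Rightarrow> real" where
  "claim_at x T Z t = (if \<exists>n. T (x t) n = t then Z (x t) (LEAST n. T (x t) n = t) else 0)"

primrec event_state ::
  "('s \<Rightarrow> real \<Rightarrow> real \<Rightarrow> real) \<Rightarrow> (real \<Rightarrow> 's) \<Rightarrow> ('s \<Rightarrow> nat \<Rightarrow> real) \<Rightarrow> ('s \<Rightarrow> nat \<Rightarrow> real) \<Rightarrow>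
    real \<Rightarrow> nat \<Rightarrow> real \<times> real" where
  "event_state U x T Z u 0 = (0, u)"
| "event_state U x T Z u (Suc n) =
    (let s = fst (event_state U x T Z u n); t = next_event x T s
     in (t, U (x s) (max 0 (snd (event_state U x T Z u n))) (t - s) - claim_at x T Z t))"

text \<open>Only countably many times are inspected. Between them the capital does not decrease, so
  nothing is lost, and in this form ruin no longer refers to a given capital path: it is a function
  of the environment, the arrivals, the claim sizes and the initial capital.\<close>

definition survives ::
  "('s \<Rightarrow> real \<Rightarrow> real \<Rightarrow> real) \<Rightarrow> (real \<Rightarrow> 's) \<Rightarrow> ('s \<Rightarrow> nat \<Rightarrow> real) \<Rightarrow> ('s \<Rightarrow> nat \<Rightarrow> real) \<Rightarrow>
    real \<Rightarrow> bool" where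
  "survives U x T Z u \<longleftrightarrow> (\<forall>n. 0 \<le> snd (event_state U x T Z u n))"

lemma claim_at_eq_claim_amount:
  assumes "\<And>j. strict_mono (T j)"
  shows "claim_at x T Z t = claim_amount x T Z t"
proof (cases "\<exists>n. T (x t) n = t")
  case True
  then obtain n where n: "T (x t) n = t" by blast
  have "{m. T (x t) m = t} = {n}" using n strict_mono_eq[OF assms[of "x t"], of _ n] by auto
  moreover have "(LEAST m. T (x t) m = t) = n"
    using n strict_mono_eq[OF assms, of "x t"] by (intro Least_equality) (simp, metis order_refl)
  ultimately show ?thesis using True by (simp add: claim_at_def claim_amount_def)
qed (simp add: claim_at_def claim_amount_def)

lemma next_event_bounds: "s \<le> next_event x T s" "next_event x T s \<le> s + 1"
  unfolding next_event_def by (auto intro!: cInf_greatest cInf_lower bdd_belowI[of _ s])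

text \<open>A strict upper bound turns the infimum into existence statements. With \<open>a\<close>
  equal to the infimum it shows that nothing happens before it; with arbitrary \<open>a\<close> it
  is the route to measurability of the next event time.\<close>

lemma next_event_less_iff:
  "next_event x T s < a \<longleftrightarrow> (\<exists>r. s < r \<and> r < a \<and> x r \<noteq> x s) \<or> (\<exists>n. s < T (x s) n \<and> T (x s) n < a) \<or> s + 1 < a"
  unfolding next_event_def by (subst cInf_less_iff) (auto intro!: bdd_belowI[of _ s])

lemma next_event_no_event:
  assumes "s < r" "r < next_event x T s" shows "x r = x s" "T (x s) n \<noteq> r"
proof -
  \<comment> \<open>A number is not below itself; expanded by \<open>next_event_less_iff\<close>,
    this excludes every event strictly before the infimum.\<close>
  have "\<not> next_event x T s < next_event x T s" by simp
  with assms show "x r = x s" "T (x s) n \<noteq> r"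
    unfolding next_event_less_iff[of _ _ _ "next_event x T s"] by auto
qed

lemma fst_event_state_nonneg: "0 \<le> fst (event_state U x T Z u n)"
  by (induction n) (auto simp: Let_def intro: order_trans[OF _ next_event_bounds(1)])

lemma arrival_sequence_finite:
  assumes "arrival_sequence T" shows "finite {n. T n \<le> b}"
proof -
  have "\<forall>\<^sub>F n in sequentially. b < T n"
    using assms by (auto simp: arrival_sequence_def filterlim_at_top_dense)
  then obtain N where "\<And>n. N \<le> n \<Longrightarrow> b < T n" by (auto simp: eventually_sequentially)
  then have "{n. T n \<le> b} \<subseteq> {..<N}" by (metis (mono_tags) lessThan_iff linorder_not_less mem_Collect_eq subsetI)
  then show ?thesis using finite_subset by blast
qed

lemma arrival_free_right:
  fixes T :: "'s::finite \<Rightarrow> nat \<Rightarrow> real"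
  assumes "\<And>j. arrival_sequence (T j)"
  shows "\<exists>b>a. \<forall>j n. T j n \<notin> {a<..<b}"
proof -
  have "finite (\<Union>j. T j ` {n. T j n \<le> a + 1})" using arrival_sequence_finite[OF assms] by auto
  then have "finite {r\<in>(\<Union>j. T j ` {n. T j n \<le> a + 1}). a < r}" (is "finite ?A")
    by (rule rev_finite_subset) auto
  define b where "b = Min (insert (a+1) ?A)"
  have "b > a" using \<open>finite ?A\<close> by (auto simp: b_def)
  moreover have "T j n \<notin> {a<..<b}" for j n
  proof
    assume that: "T j n \<in> {a<..<b}"
    have "b \<le> a + 1" using \<open>finite ?A\<close> by (auto simp: b_def)
    then have "T j n \<in> ?A" using that by (auto intro!: exI[of _ j])
    then have "b \<le> T j n" using \<open>finite ?A\<close> by (auto simp: b_def intro!: Min_le)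
    then show False using that by auto
  qed
  ultimately show ?thesis by blast
qed

lemma arrival_free_left:
  fixes T :: "'s::finite \<Rightarrow> nat \<Rightarrow> real"
  assumes "\<And>j. arrival_sequence (T j)"
  shows "\<exists>a<b. \<forall>j n. T j n \<notin> {a<..<b}"
proof -
  have "finite (\<Union>j. T j ` {n. T j n \<le> b})" using arrival_sequence_finite[OF assms] by auto
  then have fin: "finite {r\<in>(\<Union>j. T j ` {n. T j n \<le> b}). r < b}" (is "finite ?A")
    by (rule rev_finite_subset) auto
  define a where "a = Max (insert (b-1) ?A)"
  have "a < b" using \<open>finite ?A\<close> by (auto simp: a_def)
  moreover have "T j n \<notin> {a<..<b}" for j n
  proof
    assume that: "T j n \<in> {a<..<b}"
    have "T j n \<in> ?A" using that by (auto intro!: exI[of _ j])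
    then have "T j n \<le> a" using \<open>finite ?A\<close> by (auto simp: a_def intro!: Max_ge)
    then show False using that by auto
  qed
  ultimately show ?thesis by blast
qed

text \<open>Right-continuity of the environment and local finiteness of the arrivals both leave a
  gap after \<open>s\<close>, and the artificial event lies at distance 1.\<close>

lemma next_event_greater:
  fixes T :: "'s::finite \<Rightarrow> nat \<Rightarrow> real"
  assumes "step_path x" "\<And>j. arrival_sequence (T j)" "0 \<le> s"
  shows "s < next_event x T s"
proof -
  have "\<forall>\<^sub>F r in at_right s. x r = x s" using assms(1,3) by (simp add: step_path_def)
  then obtain b where b: "b > s" "\<forall>r>s. r < b \<longrightarrow> x r = x s"
    unfolding eventually_at_right_field by blast
  obtain b' where b': "b' > s" "\<forall>j n. T j n \<notin> {s<..<b'}"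
    using arrival_free_right[of T s] assms(2) by auto
  have "\<not> next_event x T s < min (s+1) (min b b')"
  proof -
    have "\<not> (\<exists>r. s < r \<and> r < min (s+1) (min b b') \<and> x r \<noteq> x s)" using b(2) by auto
    moreover have "\<not> (s < T (x s) n \<and> T (x s) n < min (s+1) (min b b'))" for n
      using b'(2)[rule_format, of "x s" n] by auto
    ultimately show ?thesis unfolding next_event_less_iff by auto
  qed
  then show ?thesis using b b' by auto
qed

text \<open>Otherwise the strictly increasing event times would converge to a finite
  \<open>L\<close>. The environment has a left limit at \<open>L\<close> and arrivals do not
  accumulate, so some interval to the left of \<open>L\<close> is free of events, and an event time
  inside it can only be followed by one at \<open>L\<close> or later.\<close>

lemma fst_event_state_unbounded:
  fixes T :: "'s::finite \<Rightarrow> nat \<Rightarrow> real"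
  assumes x: "step_path x" and T: "\<And>j. arrival_sequence (T j)"
  shows "\<exists>n. a < fst (event_state U x T Z u n)"
proof (rule ccontr)
  define t where "t n = fst (event_state U x T Z u n)" for n
  have tS: "t (Suc n) = next_event x T (t n)" for n by (simp add: t_def Let_def)
  have t0: "0 \<le> t n" for n by (simp add: t_def fst_event_state_nonneg)
  have inc: "t n < t (Suc n)" for n using next_event_greater[OF x T t0] by (simp add: tS)
  assume "\<not> ?thesis"
  then have bd: "t n \<le> a" for n by (auto simp: t_def not_less)
  define L where "L = (SUP n. t n)"
  have bdd: "bdd_above (range t)" using bd by (intro bdd_aboveI[of _ a]) auto
  have tL: "t n < L" for n
    using inc[of n] cSUP_upper[OF UNIV_I bdd, of "Suc n"] by (simp add: L_def)
  have "0 < L" using tL[of 0] t0[of 0] by simp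
  then obtain k where "\<forall>\<^sub>F s in at_left L. x s = k" using x by (auto simp: step_path_def)
  then obtain b where b: "b < L" "\<forall>r>b. r < L \<longrightarrow> x r = k"
    unfolding eventually_at_left_field by blast
  obtain b' where b': "b' < L" "\<forall>j n. T j n \<notin> {b'<..<L}"
    using arrival_free_left[of T L] T by auto
  \<comment> \<open>The bound \<open>L - 1\<close> keeps the artificial event of
    \<open>next_event\<close> from falling before \<open>L\<close>.\<close>
  have "max (L - 1) (max b b') < L" using b b' by auto
  then obtain n where n: "max (L - 1) (max b b') < t n"
    unfolding L_def using less_cSUP_iff[OF _ bdd, of "max (L - 1) (max b b')"] by (auto simp: L_def)
  have "\<not> next_event x T (t n) < L"
  proof -
    have "\<not> (\<exists>r. t n < r \<and> r < L \<and> x r \<noteq> x (t n))" using b(2) n tL[of n] by auto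
    moreover have "\<not> (t n < T (x (t n)) m \<and> T (x (t n)) m < L)" for m
      using b'(2)[rule_format, of "x (t n)" m] n by auto
    ultimately show ?thesis unfolding next_event_less_iff using n by auto
  qed
  then show False using tL[of "Suc n"] by (simp add: tS)
qed

context growth_flow
begin

text \<open>Event times do not depend on the capital. As long as the smaller capital survives, the
  truncation \<open>max 0\<close> is inactive in both recursions, and monotonicity of
  \<open>U\<close> in its initial value carries the order from one event to the next.\<close>

lemma event_state_mono:
  assumes "0 \<le> u" "u \<le> v" "survives U x T Z u"
  shows "fst (event_state U x T Z u n) = fst (event_state U x T Z v n) \<and>
    snd (event_state U x T Z u n) \<le> snd (event_state U x T Z v n)"
proof (induction n)
  case (Suc n)
  have "0 \<le> snd (event_state U x T Z u n)" using assms by (auto simp: survives_def)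
  with Suc next_event_bounds(1)[of "fst (event_state U x T Z u n)" x T] show ?case
    by (auto simp: Let_def intro!: U_mono_initial)
qed (use assms in auto)

lemma survives_mono: "0 \<le> u \<Longrightarrow> u \<le> v \<Longrightarrow> survives U x T Z u \<Longrightarrow> survives U x T Z v"
  using event_state_mono[of u v x T Z] unfolding survives_def by (meson order_trans)

text \<open>Induction step for matching the path with the recursion. The sign is concluded only
  strictly before the new event time, where a claim may cause ruin; at that time the value is the
  new entry of \<open>event_state\<close>, of whatever sign.\<close>

lemma capital_path_event_state:
  assumes x: "step_path x" and T: "\<And>j. arrival_sequence (T j)"
    and y: "capital_path c x T Z u y"
    and nn: "\<forall>r\<in>{0..fst (event_state U x T Z u n)}. 0 \<le> y r"
    and e: "y (fst (event_state U x T Z u n)) = snd (event_state U x T Z u n)"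
  shows "\<forall>r\<in>{0..<fst (event_state U x T Z u (Suc n))}. 0 \<le> y r"
    and "y (fst (event_state U x T Z u (Suc n))) = snd (event_state U x T Z u (Suc n))"
proof -
  define s where "s = fst (event_state U x T Z u n)"
  define t where "t = next_event x T s"
  have t: "fst (event_state U x T Z u (Suc n)) = t" by (simp add: t_def s_def Let_def)
  have s0: "0 \<le> s" by (simp add: s_def fst_event_state_nonneg)
  have st: "s < t" unfolding t_def by (rule next_event_greater[OF x T s0])
  have "\<forall>r\<in>{s..<t}. x r = x s"
    using next_event_no_event(1)[of s _ x T] by (auto simp: t_def) (metis antisym_conv1)
  moreover have "\<forall>r\<in>{s<..<t}. \<forall>n. T (x s) n \<noteq> r"
    using next_event_no_event(2)[of s _ x T] by (auto simp: t_def)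
  moreover have "\<forall>r\<in>{0..s}. 0 \<le> y r" using nn by (simp add: s_def)
  ultimately have "y t = U (x s) (y s) (t - s) - claim_amount x T Z t" "\<forall>r\<in>{0..<t}. 0 \<le> y r"
    using capital_path_step[OF y s0 st] by blast+
  moreover have "claim_at x T Z t = claim_amount x T Z t"
    using T by (intro claim_at_eq_claim_amount) (auto simp: arrival_sequence_def)
  moreover have "0 \<le> y s" using nn s0 by (auto simp: s_def)
  ultimately show "\<forall>r\<in>{0..<fst (event_state U x T Z u (Suc n))}. 0 \<le> y r"
    "y (fst (event_state U x T Z u (Suc n))) = snd (event_state U x T Z u (Suc n))"
    using e unfolding t by (auto simp: Let_def t_def s_def)
qed

text \<open>From left to right the recursion reproduces the values of \<open>y\<close> at the event
  times. Conversely, a nonnegative entry at each event time allows the path to be followed through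
  the next stretch, and the event times exhaust the time axis by
  \<open>fst_event_state_unbounded\<close>.\<close>

lemma capital_path_nonneg_iff_survives:
  assumes x: "step_path x" and T: "\<And>j. arrival_sequence (T j)"
    and y: "capital_path c x T Z u y" and u: "0 \<le> u"
  shows "(\<forall>t\<ge>0. 0 \<le> y t) \<longleftrightarrow> survives U x T Z u"
proof
  have y0: "y 0 = u" using y by (simp add: capital_path_def)
  note step = capital_path_event_state[OF x T y]
  {
    assume nn: "\<forall>t\<ge>0. 0 \<le> y t"
    have "y (fst (event_state U x T Z u n)) = snd (event_state U x T Z u n)" for n
    proof (induction n)
      case (Suc n)
      show ?case by (rule step(2)[OF _ Suc]) (use nn in auto)
    qed (simp add: y0)
    then show "survives U x T Z u"
      unfolding survives_def using nn fst_event_state_nonneg by metis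
  next
    assume s: "survives U x T Z u"
    have *: "(\<forall>r\<in>{0..fst (event_state U x T Z u n)}. 0 \<le> y r) \<and>
      y (fst (event_state U x T Z u n)) = snd (event_state U x T Z u n)" for n
    proof (induction n)
      case (Suc n)
      note st = step[OF conjunct1[OF Suc] conjunct2[OF Suc]]
      have "0 \<le> snd (event_state U x T Z u (Suc n))" using s unfolding survives_def by blast
      with st show ?case by (metis atLeastAtMost_iff atLeastLessThan_iff order_le_less)
    qed (use u y0 in auto)
    show "\<forall>t\<ge>0. 0 \<le> y t"
    proof (intro allI impI)
      fix t :: real assume "0 \<le> t"
      moreover obtain n where "t < fst (event_state U x T Z u n)"
        using fst_event_state_unbounded[of x T t U Z u] x T by auto
      ultimately show "0 \<le> y t" using * by (meson atLeastAtMost_iff less_imp_le)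
    qed
  }
qed

end

section \<open>Restarting a single realisation at a fixed time\<close>

definition shifted_path :: "real \<Rightarrow> (real \<Rightarrow> 's) \<Rightarrow> real \<Rightarrow> 's" where
  "shifted_path h x = (\<lambda>t\<in>{0..}. x (h + t))"

lemma shifted_path_apply: "0 \<le> t \<Longrightarrow> shifted_path h x t = x (h + t)"
  by (simp add: shifted_path_def)

lemma step_path_shifted_path:
  assumes "step_path x" "0 \<le> h" shows "step_path (shifted_path h x)"
  unfolding step_path_def
proof safe
  fix t :: real assume t: "0 \<le> t"
  then have "\<forall>\<^sub>F s in at_right (h + t). x s = x (h + t)" using assms by (auto simp: step_path_def)
  then obtain b where b: "b > h + t" "\<forall>s>h+t. s < b \<longrightarrow> x s = x (h + t)"
    unfolding eventually_at_right_field by blast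
  then show "\<forall>\<^sub>F s in at_right t. shifted_path h x s = shifted_path h x t"
    unfolding eventually_at_right_field using t by (intro exI[of _ "b - h"]) (auto simp: shifted_path_apply)
next
  fix t :: real assume t: "0 < t"
  then obtain k where "\<forall>\<^sub>F s in at_left (h + t). x s = k" using assms by (fastforce simp: step_path_def)
  then obtain b where b: "b < h + t" "\<forall>s>b. s < h+t \<longrightarrow> x s = k"
    unfolding eventually_at_left_field by blast
  then show "\<exists>k. \<forall>\<^sub>F s in at_left t. shifted_path h x s = k"
    unfolding eventually_at_left_field using t
    by (intro exI[of _ k] exI[of _ "max 0 (b - h)"]) (auto simp: shifted_path_apply)
qed

lemma step_path_restrict: "step_path x \<Longrightarrow> step_path (restrict x {0..})"
  using step_path_shifted_path[of x 0] by (simp add: shifted_path_def restrict_def)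

text \<open>The index of the first arrival after \<open>h\<close>. An arrival exactly at
  \<open>h\<close> counts as past, in agreement with taking the capital just after a claim.\<close>

definition passage :: "(nat \<Rightarrow> real) \<Rightarrow> real \<Rightarrow> nat \<Rightarrow> bool" where
  "passage T h n \<longleftrightarrow> h < T n \<and> (\<forall>m<n. T m \<le> h)"

lemma passage_unique: "passage T h n \<Longrightarrow> passage T h m \<Longrightarrow> n = m"
  unfolding passage_def by (metis linorder_neqE_nat not_less)

lemma passage_exists: "arrival_sequence T \<Longrightarrow> \<exists>n. passage T h n"
proof -
  assume T: "arrival_sequence T"
  then have "\<forall>\<^sub>F n in sequentially. h < T n"
    by (auto simp: arrival_sequence_def filterlim_at_top_dense)
  then have "\<exists>n. h < T n" by (auto simp: eventually_sequentially)
  then obtain n where "h < T n" "\<forall>m<n. \<not> h < T m" using exists_least_iff[of "\<lambda>n. h < T n"] by auto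
  then show ?thesis by (auto simp: passage_def not_less)
qed

lemma arrival_sequence_shift:
  assumes T: "arrival_sequence T" and "passage T h N"
  shows "arrival_sequence (\<lambda>n. T (N + n) - h)"
proof -
  have "filterlim (\<lambda>n. T (n + N)) at_top sequentially"
    using T by (intro filterlim_compose[OF _ filterlim_add_const_nat_at_top]) (simp add: arrival_sequence_def)
  then have "filterlim (\<lambda>n. - h + T (n + N)) at_top sequentially"
    by (rule filterlim_tendsto_add_at_top[OF tendsto_const])
  then show ?thesis using assms
    by (auto simp: arrival_sequence_def strict_mono_def passage_def add.commute)
qed

text \<open>An arrival at \<open>h + t\<close> with \<open>0 < t\<close> has an index of at least
  \<open>N j\<close>, so the arrivals that matter are reindexed by subtracting
  \<open>N j\<close>.\<close>

lemma claim_amount_shift: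
  assumes T: "\<And>j. arrival_sequence (T j)" "\<And>j. passage (T j) h (N j)" and t: "0 < t"
  shows "claim_amount (shifted_path h x) (\<lambda>j n. T j (N j + n) - h) (\<lambda>j n. Z j (N j + n)) t =
    claim_amount x T Z (h + t)"
proof -
  define j where "j = x (h + t)"
  have "(\<Sum>n | T j (N j + n) - h = t. Z j (N j + n)) = (\<Sum>n | T j n = h + t. Z j n)"
  proof (rule sum.reindex_bij_witness[of _ "\<lambda>n. n - N j" "\<lambda>n. N j + n"])
    fix n assume n: "n \<in> {n. T j n = h + t}"
    then have "\<not> T j n \<le> h" using t by auto
    then have "N j \<le> n" using T(2)[of j] by (auto simp: passage_def not_less[symmetric])
    then show "N j + (n - N j) = n" "n - N j \<in> {n. T j (N j + n) - h = t}" using n by auto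
  qed auto
  then show ?thesis using t by (simp add: claim_amount_def shifted_path_apply j_def)
qed

context growth_flow
begin

text \<open>The dynamics of \<open>y\<close> are imposed only before ruin. The shifted path inherits
  them because \<open>nn\<close> supplies nonnegativity on the part of the time axis that the shift
  cuts off.\<close>

lemma capital_path_shift:
  assumes T: "\<And>j. arrival_sequence (T j)" "\<And>j. passage (T j) h (N j)" and h: "0 \<le> h"
    and y: "capital_path c x T Z u y" and nn: "\<forall>r\<in>{0..h}. 0 \<le> y r"
  shows "capital_path c (shifted_path h x) (\<lambda>j n. T j (N j + n) - h) (\<lambda>j n. Z j (N j + n)) (y h) (\<lambda>t. y (h + t))"
  unfolding capital_path_def
proof (intro conjI allI impI)
  fix i s t
  assume a: "0 \<le> s \<and> s < t \<and> (\<forall>r\<in>{0..s}. 0 \<le> y (h + r)) \<and> (\<forall>r\<in>{s..<t}. shifted_path h x r = i) \<and>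
    (\<forall>r\<in>{s<..<t}. \<forall>n. T i (N i + n) - h \<noteq> r)"
  have "\<forall>r\<in>{0..h+s}. 0 \<le> y r"
  proof
    fix r assume r: "r \<in> {0..h+s}"
    show "0 \<le> y r"
    proof (cases "r \<le> h")
      case False
      then have "r - h \<in> {0..s}" using r by auto
      then have "0 \<le> y (h + (r - h))" using a by blast
      then show ?thesis by simp
    qed (use nn r in auto)
  qed
  moreover have "\<forall>r\<in>{h+s..<h+t}. x r = i"
  proof
    fix r assume "r \<in> {h+s..<h+t}"
    then have "r - h \<in> {s..<t}" by auto
    then have "shifted_path h x (r - h) = i" "0 \<le> r - h" using a by auto
    then show "x r = i" by (simp add: shifted_path_apply)
  qed
  moreover have "\<forall>r\<in>{h+s<..<h+t}. \<forall>n. T i n \<noteq> r"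
  proof (intro ballI allI)
    fix r n assume r: "r \<in> {h+s<..<h+t}"
    show "T i n \<noteq> r"
    proof
      assume e: "T i n = r"
      then have "\<not> T i n \<le> h" using r a by auto
      then have "N i \<le> n" using T(2)[of i] by (auto simp: passage_def not_less[symmetric])
      then have "T i (N i + (n - N i)) - h = r - h" using e by simp
      moreover have "r - h \<in> {s<..<t}" using r by auto
      ultimately show False using a by blast
    qed
  qed
  moreover have "0 \<le> h + s" "h + s < h + t" using a h by auto
  ultimately have d: "\<forall>r\<in>{h+s..<h+t}. (y has_real_derivative c i (y r)) (at r within {h+s..<h+t})"
    using conjunct1[OF conjunct2[OF y[unfolded capital_path_def]]] by blast
  show "\<forall>r\<in>{s..<t}. ((\<lambda>t. y (h + t)) has_real_derivative c i (y (h + r))) (at r within {s..<t})"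
    by (intro ballI has_derivative_shift) (use d in \<open>auto simp: add.commute\<close>)
next
  fix t :: real
  assume t: "0 < t" and a: "\<forall>r\<in>{0..<t}. 0 \<le> y (h + r)"
  have "\<forall>r\<in>{0..<h+t}. 0 \<le> y r"
  proof
    fix r assume r: "r \<in> {0..<h+t}"
    show "0 \<le> y r"
    proof (cases "r \<le> h")
      case False
      then have "r - h \<in> {0..<t}" using r by auto
      then have "0 \<le> y (h + (r - h))" using a by blast
      then show ?thesis by simp
    qed (use nn r in auto)
  qed
  then have "(y \<longlongrightarrow> y (h + t) + claim_amount x T Z (h + t)) (at_left (h + t))"
    using y t h unfolding capital_path_def by auto
  moreover have "filterlim ((+) h) (at_left (h + t)) (at_left t)"
    unfolding filterlim_at by (auto intro!: tendsto_intros simp: eventually_at_filter)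
  ultimately have "((\<lambda>t. y (h + t)) \<longlongrightarrow> y (h + t) + claim_amount x T Z (h + t)) (at_left t)"
    by (rule filterlim_compose)
  then show "((\<lambda>t. y (h + t)) \<longlongrightarrow> y (h + t) +
     claim_amount (shifted_path h x) (\<lambda>j n. T j (N j + n) - h) (\<lambda>j n. Z j (N j + n)) t) (at_left t)"
    by (subst claim_amount_shift[where T=T and N=N]) (use T t in auto)
qed simp

lemma capital_path_nonneg_iff_shift_survives:
  assumes x: "step_path x" and T: "\<And>j. arrival_sequence (T j)" "\<And>j. passage (T j) h (N j)" and h: "0 \<le> h"
    and y: "capital_path c x T Z u y" and nn: "\<forall>r\<in>{0..h}. 0 \<le> y r"
  shows "(\<forall>t\<ge>0. 0 \<le> y t) \<longleftrightarrow>
    survives U (shifted_path h x) (\<lambda>j n. T j (N j + n) - h) (\<lambda>j n. Z j (N j + n)) (y h)"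
proof -
  have "(\<forall>t\<ge>0. 0 \<le> y t) \<longleftrightarrow> (\<forall>t\<ge>0. 0 \<le> y (h + t))"
  proof safe
    fix t assume a: "\<forall>t\<ge>0. 0 \<le> y (h + t)" and t: "(0::real) \<le> t"
    show "0 \<le> y t"
    proof (cases "t \<le> h")
      case False
      then have "0 \<le> y (h + (t - h))" by (intro a[rule_format]) simp
      then show ?thesis by simp
    qed (use nn t in simp)
  qed (use h in simp)
  also have "\<dots> \<longleftrightarrow> survives U (shifted_path h x) (\<lambda>j n. T j (N j + n) - h) (\<lambda>j n. Z j (N j + n)) (y h)"
  proof (rule capital_path_nonneg_iff_survives)
    show "step_path (shifted_path h x)" by (rule step_path_shifted_path[OF x h])
    show "arrival_sequence (\<lambda>n. T j (N j + n) - h)" for j by (rule arrival_sequence_shift[OF T])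
    show "capital_path c (shifted_path h x) (\<lambda>j n. T j (N j + n) - h) (\<lambda>j n. Z j (N j + n)) (y h) (\<lambda>t. y (h + t))"
      by (rule capital_path_shift[where T=T and N=N, OF T h y nn])
    show "0 \<le> y h" using nn h by simp
  qed
  finally show ?thesis .
qed

end

section \<open>Measurability of survival\<close>

text \<open>The image of \<open>M\<close> restricted to \<open>C\<close> is the unnormalised
  conditional law of \<open>g\<close> given \<open>C\<close>. Keeping it as a measure lets
  uniqueness theorems extend restart formulas from rectangles to all measurable sets, without
  dividing by the measure of \<open>C\<close>.\<close>

lemma emeasure_distr_indicator:
  assumes C: "C \<in> sets M" and g: "g \<in> measurable M N" and B: "B \<in> sets N"
  shows "emeasure (distr (density M (indicator C)) N g) B = emeasure M (C \<inter> (g -` B \<inter> space M))"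
proof -
  have "emeasure (distr (density M (indicator C)) N g) B = emeasure (density M (indicator C)) (g -` B \<inter> space M)"
    using g B by (subst emeasure_distr) auto
  then show ?thesis
    using C measurable_sets[OF g B] by (simp add: emeasure_density indicator_inter_arith[symmetric] del: indicator_simps)
qed

lemma finite_measure_distr_indicator:
  assumes "finite_measure M" "C \<in> sets M" "g \<in> measurable M N"
  shows "finite_measure (distr (density M (indicator C)) N g)"
proof (rule finite_measureI)
  show "emeasure (distr (density M (indicator C)) N g) (space (distr (density M (indicator C)) N g)) \<noteq> \<infinity>"
    using emeasure_distr_indicator[OF assms(2,3) sets.top] finite_measure.emeasure_finite[OF assms(1)] by simp
qed

text \<open>The trace of the product sigma-algebra is taken, because the step paths need not form a
  measurable subset of an uncountable product.\<close>

definition path_space :: "(real \<Rightarrow> 's) measure" where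
  "path_space = restrict_space (PiM {0..} (\<lambda>_. count_space UNIV)) {x. step_path x}"

text \<open>A mark is a pair of interarrival time and claim size. Interarrival times rather than
  arrival times are recorded because the marks are then independent and identically
  distributed.\<close>

definition flow_space :: "(nat \<Rightarrow> real \<times> real) measure" where
  "flow_space = PiM UNIV (\<lambda>_. borel \<Otimes>\<^sub>M borel)"

definition config_space :: "((real \<Rightarrow> 's) \<times> ('s \<Rightarrow> nat \<Rightarrow> real \<times> real)) measure" where
  "config_space = path_space \<Otimes>\<^sub>M PiM UNIV (\<lambda>_. flow_space)"

definition arrival_time :: "(nat \<Rightarrow> real \<times> real) \<Rightarrow> nat \<Rightarrow> real" where
  "arrival_time y n = (\<Sum>k\<le>n. fst (y k))"

definition config_survives ::
  "('s \<Rightarrow> real \<Rightarrow> real \<Rightarrow> real) \<Rightarrow> real \<Rightarrow> (real \<Rightarrow> 's) \<times> ('s \<Rightarrow> nat \<Rightarrow> real \<times> real) \<Rightarrow> bool" where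
  "config_survives U u w = survives U (fst w) (\<lambda>j. arrival_time (snd w j)) (\<lambda>j n. snd (snd w j n)) u"

lemma space_path_space: "x \<in> space path_space \<longleftrightarrow> x \<in> extensional {0..} \<and> step_path x"
  by (auto simp: path_space_def space_restrict_space space_PiM PiE_def)

lemma measurable_path_component:
  assumes "X \<in> measurable M path_space" "0 \<le> t"
  shows "(\<lambda>w. X w t) \<in> measurable M (count_space UNIV)"
proof -
  have "X \<in> measurable M (PiM {0..} (\<lambda>_. count_space UNIV))"
    using assms(1) by (simp add: path_space_def measurable_restrict_space2_iff)
  then show ?thesis by (rule measurable_compose[OF _ measurable_component_singleton]) (use assms(2) in auto)
qed

lemma sets_path_component:
  assumes "0 \<le> t" shows "{x\<in>space path_space. x t = k} \<in> sets path_space"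
  using measurable_sets[OF measurable_path_component[OF measurable_ident assms], of "{k}"]
  by (simp add: vimage_def Int_def conj_commute)

lemma measurable_into_path_space:
  assumes "\<And>w. w \<in> space M \<Longrightarrow> X w \<in> extensional {0..} \<and> step_path (X w)"
    and "\<And>t. 0 \<le> t \<Longrightarrow> (\<lambda>w. X w t) \<in> measurable M (count_space UNIV)"
  shows "X \<in> measurable M path_space"
proof -
  have "X \<in> measurable M (PiM {0..} (\<lambda>_. count_space UNIV))"
    by (rule measurable_PiM_single') (use assms in \<open>auto simp: PiE_def\<close>)
  then show ?thesis using assms(1) by (auto simp: path_space_def measurable_restrict_space2_iff)
qed

text \<open>As functions of \<open>s\<close> these points take countably many values, and they
  approach \<open>s\<close> strictly from the right. Evaluating a right-continuous path, or
  \<open>U\<close>, at a random time thus becomes a limit of countable case distinctions.\<close>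

lemma grid_point:
  fixes s :: real
  assumes "0 \<le> s"
  shows "s < (real (nat \<lfloor>s * real (Suc n)\<rfloor>) + 1) / real (Suc n)"
    and "(real (nat \<lfloor>s * real (Suc n)\<rfloor>) + 1) / real (Suc n) \<le> s + 1 / real (Suc n)"
proof -
  have "real (nat \<lfloor>s * real (Suc n)\<rfloor>) = of_int \<lfloor>s * real (Suc n)\<rfloor>" using assms by simp
  then have a: "s * real (Suc n) < real (nat \<lfloor>s * real (Suc n)\<rfloor>) + 1"
    and b: "real (nat \<lfloor>s * real (Suc n)\<rfloor>) \<le> s * real (Suc n)" by linarith+
  show "s < (real (nat \<lfloor>s * real (Suc n)\<rfloor>) + 1) / real (Suc n)"
    using a by (simp add: pos_less_divide_eq del: of_nat_Suc)
  have "(real (nat \<lfloor>s * real (Suc n)\<rfloor>) + 1) / real (Suc n) \<le> (s * real (Suc n) + 1) / real (Suc n)"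
    using b by (intro divide_right_mono) auto
  also have "\<dots> = s + 1 / real (Suc n)" by (simp add: field_simps)
  finally show "(real (nat \<lfloor>s * real (Suc n)\<rfloor>) + 1) / real (Suc n) \<le> s + 1 / real (Suc n)" .
qed

lemma grid_point_tendsto:
  fixes s :: real
  assumes "0 \<le> s"
  shows "(\<lambda>n. (real (nat \<lfloor>s * real (Suc n)\<rfloor>) + 1) / real (Suc n)) \<longlonglongrightarrow> s"
proof (rule tendsto_sandwich[of "\<lambda>_. s" _ _ "\<lambda>n. s + 1 / real (Suc n)"])
  show "(\<lambda>n. s + 1 / real (Suc n)) \<longlonglongrightarrow> s"
    using tendsto_add[OF tendsto_const[of s] LIMSEQ_inverse_real_of_nat] by (simp add: inverse_eq_divide)
qed (use grid_point[OF assms] in \<open>auto intro!: always_eventually less_imp_le\<close>)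

lemma grid_point_at_right:
  fixes s :: real
  assumes "0 \<le> s"
  shows "filterlim (\<lambda>n. (real (nat \<lfloor>s * real (Suc n)\<rfloor>) + 1) / real (Suc n)) (at_right s) sequentially"
  unfolding filterlim_at
  using grid_point_tendsto[OF assms] grid_point(1)[OF assms] by (auto intro!: always_eventually simp: less_imp_neq[symmetric] simp del: of_nat_Suc)

lemma measurable_path_eval:
  fixes X :: "'w \<Rightarrow> real \<Rightarrow> 's::finite"
  assumes X: "X \<in> measurable M path_space" and s: "s \<in> borel_measurable M"
    and nn: "\<And>w. w \<in> space M \<Longrightarrow> 0 \<le> s w"
  shows "(\<lambda>w. X w (s w)) \<in> measurable M (count_space UNIV)"
proof -
  define g where "g n w = (real (nat \<lfloor>s w * real (Suc n)\<rfloor>) + 1) / real (Suc n)" for n w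
  have m: "(\<lambda>w. X w (g n w)) \<in> measurable M (count_space UNIV)" for n
    unfolding g_def
    by (rule measurable_compose_countable[where f="\<lambda>k w. X w ((real k + 1) / real (Suc n))"])
      (use s X in \<open>auto intro!: measurable_path_component\<close>)
  \<comment> \<open>By right-continuity the values at the grid points are eventually constant, so
    the event that the value at the random time is \<open>j\<close> becomes a countable combination
    of measurable events.\<close>
  have eq: "X w (s w) = j \<longleftrightarrow> (\<exists>N. \<forall>n\<ge>N. X w (g n w) = j)" if w: "w \<in> space M" for w j
  proof -
    have "step_path (X w)" using measurable_space[OF X w] by (simp add: space_path_space)
    then have "\<forall>\<^sub>F r in at_right (s w). X w r = X w (s w)" using nn[OF w] by (auto simp: step_path_def)
    from eventually_compose_filterlim[OF this grid_point_at_right[OF nn[OF w]]]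
    obtain N where N: "\<And>n. n \<ge> N \<Longrightarrow> X w (g n w) = X w (s w)"
      unfolding g_def eventually_sequentially by blast
    show ?thesis
    proof
      assume "\<exists>N. \<forall>n\<ge>N. X w (g n w) = j"
      then obtain N' where "\<forall>n\<ge>N'. X w (g n w) = j" by blast
      then show "X w (s w) = j" using N[of "max N N'"] by auto
    qed (use N in blast)
  qed
  show ?thesis
    unfolding measurable_count_space_eq2[OF finite_class.finite_UNIV]
  proof safe
    fix j
    have "{w\<in>space M. \<exists>N. \<forall>n\<ge>N. X w (g n w) = j} \<in> sets M"
      using m by measurable
    also have "{w\<in>space M. \<exists>N. \<forall>n\<ge>N. X w (g n w) = j} = (\<lambda>w. X w (s w)) -` {j} \<inter> space M"
      using eq by auto
    finally show "(\<lambda>w. X w (s w)) -` {j} \<inter> space M \<in> sets M" .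
  qed auto
qed

context growth_flow
begin

text \<open>Monotonicity in the initial capital gives Borel measurability for each fixed time, and
  continuity in time gives the passage to the limit along the grid. This avoids joint continuity,
  which may fail.\<close>

lemma measurable_U:
  assumes v: "v \<in> borel_measurable M" and t: "t \<in> borel_measurable M" "\<And>w. w \<in> space M \<Longrightarrow> 0 \<le> t w"
  shows "(\<lambda>w. U j (max 0 (v w)) (t w)) \<in> borel_measurable M"
proof (rule borel_measurable_LIMSEQ_real)
  fix w assume w: "w \<in> space M"
  have "(U j (max 0 (v w)) \<longlongrightarrow> U j (max 0 (v w)) (t w)) (at (t w) within {0..})"
    using U_continuous[of "max 0 (v w)" j] t(2)[OF w] by (simp add: continuous_on_def)
  then have "(U j (max 0 (v w)) \<longlongrightarrow> U j (max 0 (v w)) (t w)) (at_right (t w))"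
    by (rule tendsto_within_subset) (use t(2)[OF w] in auto)
  from filterlim_compose[OF this grid_point_at_right[OF t(2)[OF w]]]
  show "(\<lambda>n. U j (max 0 (v w)) ((real (nat \<lfloor>t w * real (Suc n)\<rfloor>) + 1) / real (Suc n))) \<longlonglongrightarrow> U j (max 0 (v w)) (t w)" .
next
  fix n
  have m: "(\<lambda>w. U j (max 0 (v w)) r) \<in> borel_measurable M" if "0 \<le> r" for r
    by (rule measurable_compose[OF v borel_measurable_mono])
      (use that in \<open>auto intro!: monoI U_mono_initial\<close>)
  show "(\<lambda>w. U j (max 0 (v w)) ((real (nat \<lfloor>t w * real (Suc n)\<rfloor>) + 1) / real (Suc n))) \<in> borel_measurable M"
    by (rule measurable_compose_countable[where f="\<lambda>k w. U j (max 0 (v w)) ((real k + 1) / real (Suc n))"])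
      (use t m in auto)
qed

text \<open>The delicate point is the next event time: a jump of the environment may occur at any of
  uncountably many times and has to be detected on the rationals.\<close>

lemma measurable_event_state:
  fixes X :: "'w \<Rightarrow> real \<Rightarrow> 's"
  assumes X: "X \<in> measurable M path_space"
    and T: "\<And>j n. (\<lambda>w. T w j n) \<in> borel_measurable M" and Z: "\<And>j n. (\<lambda>w. Z w j n) \<in> borel_measurable M"
    and u: "u \<in> borel_measurable M"
  shows "(\<lambda>w. fst (event_state U (X w) (T w) (Z w) (u w) n)) \<in> borel_measurable M \<and>
    (\<lambda>w. snd (event_state U (X w) (T w) (Z w) (u w) n)) \<in> borel_measurable M"
proof (induction n)
  case (Suc n)
  define s where "s w = fst (event_state U (X w) (T w) (Z w) (u w) n)" for w
  define v where "v w = snd (event_state U (X w) (T w) (Z w) (u w) n)" for w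
  define t where "t w = next_event (X w) (T w) (s w)" for w
  have s0: "0 \<le> s w" for w by (simp add: s_def fst_event_state_nonneg)
  have st: "s w \<le> t w" for w by (simp add: t_def next_event_bounds)
  have [measurable]: "s \<in> borel_measurable M" "v \<in> borel_measurable M" using Suc by (simp_all add: s_def[abs_def] v_def[abs_def])
  have [measurable]: "(\<lambda>w. X w (s w)) \<in> measurable M (count_space UNIV)"
    by (rule measurable_path_eval[OF X]) (use s0 in auto)
  note [measurable] = T Z u
  have [measurable]: "(\<lambda>w. T w (X w (s w)) m) \<in> borel_measurable M" for m
    by (rule measurable_compose_countable[where f="\<lambda>j w. T w j m"]) auto
  have t[measurable]: "t \<in> borel_measurable M"
    unfolding borel_measurable_iff_less
  proof
    fix a :: real
    \<comment> \<open>Coordinates of a path are measurable at nonnegative times. Negative rationals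
      yield the empty event because \<open>s w\<close> is nonnegative.\<close>
    have comp: "{w\<in>space M. s w < of_rat q \<and> of_rat q < a \<and> X w (of_rat q) \<noteq> X w (s w)} \<in> sets M" for q
    proof (cases "0 \<le> (of_rat q :: real)")
      case True
      have [measurable]: "(\<lambda>w. X w (of_rat q)) \<in> measurable M (count_space UNIV)"
        by (rule measurable_path_component[OF X True])
      show ?thesis by measurable
    next
      case False
      have "\<not> s w < of_rat q" for w using s0[of w] False by linarith
      then have "{w\<in>space M. s w < of_rat q \<and> of_rat q < a \<and> X w (of_rat q) \<noteq> X w (s w)} = {}" by auto
      then show ?thesis by (simp only: sets.empty_sets)
    qed
    have A: "{w\<in>space M. (\<exists>q::rat. s w < of_rat q \<and> of_rat q < a \<and> X w (of_rat q) \<noteq> X w (s w))} \<in> sets M"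
      by (rule sets.sets_Collect_countable_Ex) (rule comp)
    have B: "{w\<in>space M. (\<exists>n. s w < T w (X w (s w)) n \<and> T w (X w (s w)) n < a) \<or> s w + 1 < a} \<in> sets M"
      by measurable
    have "{w\<in>space M. (\<exists>q::rat. s w < of_rat q \<and> of_rat q < a \<and> X w (of_rat q) \<noteq> X w (s w)) \<or>
      (\<exists>n. s w < T w (X w (s w)) n \<and> T w (X w (s w)) n < a) \<or> s w + 1 < a} \<in> sets M"
      by (rule back_subst[of "\<lambda>S. S \<in> sets M", OF sets.Un[OF A B]]) blast
    also have "{w\<in>space M. (\<exists>q::rat. s w < of_rat q \<and> of_rat q < a \<and> X w (of_rat q) \<noteq> X w (s w)) \<or>
      (\<exists>n. s w < T w (X w (s w)) n \<and> T w (X w (s w)) n < a) \<or> s w + 1 < a} = {w\<in>space M. t w < a}"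
    proof -
      \<comment> \<open>Right-continuity at \<open>r\<close> keeps the changed state for a while, so
        some rational time before \<open>a\<close> shows a changed state too.\<close>
      have "(\<exists>r. s w < r \<and> r < a \<and> X w r \<noteq> X w (s w)) \<longleftrightarrow>
        (\<exists>q::rat. s w < of_rat q \<and> of_rat q < a \<and> X w (of_rat q) \<noteq> X w (s w))" if w: "w \<in> space M" for w
      proof
        assume "\<exists>r. s w < r \<and> r < a \<and> X w r \<noteq> X w (s w)"
        then obtain r where r: "s w < r" "r < a" "X w r \<noteq> X w (s w)" by blast
        have "step_path (X w)" using measurable_space[OF X w] by (simp add: space_path_space)
        then have "\<forall>\<^sub>F q in at_right r. X w q = X w r" using r s0[of w] by (auto simp: step_path_def)
        then obtain b where b: "b > r" "\<forall>q>r. q < b \<longrightarrow> X w q = X w r"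
          unfolding eventually_at_right_field by blast
        obtain q where "r < of_rat q" "of_rat q < min a b" using of_rat_dense[of r "min a b"] r b by auto
        then show "\<exists>q::rat. s w < of_rat q \<and> of_rat q < a \<and> X w (of_rat q) \<noteq> X w (s w)"
          using r b(2) by (intro exI[of _ q]) auto
      qed blast
      then show ?thesis unfolding t_def next_event_less_iff by auto
    qed
    finally show "{w\<in>space M. t w < a} \<in> sets M" .
  qed
  have [measurable]: "(\<lambda>w. X w (t w)) \<in> measurable M (count_space UNIV)"
    by (rule measurable_path_eval[OF X t order_trans[OF s0 st]])
  have [measurable]: "(\<lambda>w. T w (X w (t w)) m) \<in> borel_measurable M" for m
    by (rule measurable_compose_countable[where f="\<lambda>j w. T w j m"]) auto
  have [measurable]: "(\<lambda>w. Z w (X w (t w)) m) \<in> borel_measurable M" for m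
    by (rule measurable_compose_countable[where f="\<lambda>j w. Z w j m"]) auto
  have [measurable]: "(\<lambda>w. Z w (X w (t w)) (LEAST m. T w (X w (t w)) m = t w)) \<in> borel_measurable M"
    by (rule measurable_compose_countable[where f="\<lambda>m w. Z w (X w (t w)) m"]) measurable
  have cl[measurable]: "(\<lambda>w. claim_at (X w) (T w) (Z w) (t w)) \<in> borel_measurable M"
    unfolding claim_at_def by measurable
  have "(\<lambda>w. U (X w (s w)) (max 0 (v w)) (t w - s w)) \<in> borel_measurable M"
    by (rule measurable_compose_countable[where f="\<lambda>j w. U j (max 0 (v w)) (t w - s w)"])
      (use st in \<open>auto intro!: measurable_U\<close>)
  then have "(\<lambda>w. U (X w (s w)) (max 0 (v w)) (t w - s w) - claim_at (X w) (T w) (Z w) (t w)) \<in> borel_measurable M"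
    using cl by (intro borel_measurable_diff)
  with t show ?case
    by (simp add: Let_def s_def[abs_def] v_def[abs_def] t_def[abs_def])
qed (use u in auto)

lemma measurable_config_survives:
  assumes "u \<in> borel_measurable M" "w \<in> measurable M config_space"
  shows "{a \<in> space M. config_survives U (u a) (w a)} \<in> sets M"
proof -
  have p: "(\<lambda>a. fst (w a)) \<in> measurable M path_space"
    and q: "(\<lambda>a. snd (w a)) \<in> measurable M (PiM UNIV (\<lambda>_. flow_space))"
    using assms(2) unfolding config_space_def by auto
  have f: "(\<lambda>a. snd (w a) j) \<in> measurable M flow_space" for j
    by (rule measurable_compose[OF q measurable_component_singleton]) auto
  have y: "(\<lambda>a. snd (w a) j n) \<in> measurable M (borel \<Otimes>\<^sub>M borel)" for j n
    by (rule measurable_compose[OF f[unfolded flow_space_def] measurable_component_singleton]) auto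
  have "(\<lambda>a. snd (event_state U (fst (w a)) (\<lambda>j. arrival_time (snd (w a) j)) (\<lambda>j n. snd (snd (w a) j n)) (u a) n)) \<in> borel_measurable M" for n
    using assms(1) y unfolding arrival_time_def
    by (intro conjunct2[OF measurable_event_state[OF p]] borel_measurable_sum
      measurable_compose[OF y measurable_fst] measurable_compose[OF y measurable_snd]) auto
  then show ?thesis unfolding config_survives_def survives_def by measurable
qed

end

section \<open>Restarting a marked Poisson flow\<close>

definition exponential_law :: "real \<Rightarrow> real measure" where
  "exponential_law a = density lborel (\<lambda>x. ennreal (exponential_density a x))"

definition flow_law :: "real \<Rightarrow> real measure \<Rightarrow> (nat \<Rightarrow> real \<times> real) measure" where
  "flow_law a \<zeta> = PiM UNIV (\<lambda>_. exponential_law a \<Otimes>\<^sub>M \<zeta>)"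

text \<open>The waiting time running at time \<open>h\<close> is replaced by its residual part, so
  that the restarted flow is described in the same coordinates as the original one and the two laws
  can be compared.\<close>

definition flow_restart :: "real \<Rightarrow> nat \<Rightarrow> (nat \<Rightarrow> real \<times> real) \<Rightarrow> nat \<Rightarrow> real \<times> real" where
  "flow_restart h n y = (\<lambda>k. if k = 0 then (arrival_time y n - h, snd (y n)) else y (n + k))"

text \<open>If no arrival follows \<open>h\<close>, the \<open>LEAST\<close> is arbitrary; this has
  probability 0 by \<open>AE_passage_exists\<close>.\<close>

definition flow_shift :: "real \<Rightarrow> (nat \<Rightarrow> real \<times> real) \<Rightarrow> nat \<Rightarrow> real \<times> real" where
  "flow_shift h y = flow_restart h (LEAST n. h < arrival_time y n) y"

lemma passage_Least:
  assumes "passage T h n" shows "(LEAST n. h < T n) = n"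
  using assms unfolding passage_def by (intro Least_equality) (auto simp: not_less[symmetric])

lemma flow_shift_passage: "passage (arrival_time y) h n \<Longrightarrow> flow_shift h y = flow_restart h n y"
  by (simp add: flow_shift_def passage_Least)

lemma arrival_time_flow_restart: "arrival_time (flow_restart h n y) m = arrival_time y (n + m) - h"
proof (induction m)
  case (Suc m)
  have "arrival_time (flow_restart h n y) (Suc m) = arrival_time (flow_restart h n y) m + fst (y (n + Suc m))"
    by (simp add: arrival_time_def flow_restart_def)
  also have "\<dots> = arrival_time y (n + Suc m) - h" using Suc by (simp add: arrival_time_def)
  finally show ?case .
qed (simp add: arrival_time_def flow_restart_def)

lemma snd_flow_restart: "snd (flow_restart h n y m) = snd (y (n + m))"
  by (simp add: flow_restart_def)

lemma space_flow_space: "space flow_space = UNIV"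
  by (simp add: flow_space_def space_PiM space_pair_measure)

lemma UNIV_flow_space: "UNIV \<in> sets flow_space"
  using sets.top[of flow_space] by (simp add: space_flow_space)

lemma measurable_flow_component[measurable]: "(\<lambda>y. y n) \<in> measurable flow_space (borel \<Otimes>\<^sub>M borel)"
  unfolding flow_space_def by measurable

lemma measurable_arrival_time[measurable]: "(\<lambda>y. arrival_time y n) \<in> borel_measurable flow_space"
  unfolding arrival_time_def by measurable

lemma measurable_passage[measurable]: "Measurable.pred flow_space (\<lambda>y. passage (arrival_time y) h n)"
  unfolding passage_def by measurable

lemma measurable_flow_restart[measurable]: "flow_restart h n \<in> measurable flow_space flow_space"
proof -
  have "(\<lambda>y. flow_restart h n y k) \<in> measurable flow_space (borel \<Otimes>\<^sub>M borel)" for k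
    unfolding flow_restart_def by (cases "k = 0") (auto simp del: borel_prod)
  then show ?thesis
    by (subst (2) flow_space_def) (rule measurable_PiM_single', auto simp: space_pair_measure)
qed

lemma measurable_flow_shift[measurable]: "flow_shift h \<in> measurable flow_space flow_space"
  unfolding flow_shift_def[abs_def]
  by (rule measurable_compose_countable[where f="\<lambda>n y. flow_restart h n y"]) measurable

locale marked_flow =
  fixes a :: real and \<zeta> :: "real measure"
  assumes a_pos: "0 < a" and zeta: "real_distribution \<zeta>"
begin

sublocale zeta: real_distribution \<zeta> by (rule zeta)

lemma prob_space_exponential_law: "prob_space (exponential_law a)"
  unfolding exponential_law_def by (rule prob_space_exponential_density[OF a_pos])

sublocale expo: prob_space "exponential_law a" by (rule prob_space_exponential_law)

sublocale mark: pair_prob_space "exponential_law a" \<zeta> ..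

sublocale flow: sequence_space "exponential_law a \<Otimes>\<^sub>M \<zeta>" ..

lemma sets_exponential_law: "sets (exponential_law a) = sets borel" by (simp add: exponential_law_def)

lemma sets_flow_law: "sets (flow_law a \<zeta>) = sets flow_space"
  unfolding flow_law_def flow_space_def
  by (intro sets_PiM_cong sets_pair_measure_cong) (auto simp: sets_exponential_law)

lemma space_flow_law: "space (flow_law a \<zeta>) = UNIV"
  using sets_eq_imp_space_eq[OF sets_flow_law] by (simp add: space_flow_space)

lemma prob_space_flow_law: "prob_space (flow_law a \<zeta>)"
  unfolding flow_law_def
  by (intro prob_space_PiM prob_space_pair prob_space_exponential_law zeta.prob_space_axioms)

text \<open>Conditioning on the first mark \<open>(e, z)\<close>: prefixing it to an independent
  copy of the flow reproduces the law of the flow. The two measurability statements serve the later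
  manipulation of the iterated integral.\<close>

lemma emeasure_flow_law_split:
  assumes A: "A \<in> sets flow_space"
  shows "emeasure (flow_law a \<zeta>) A =
      (\<integral>\<^sup>+e. ennreal (exponential_density a e) * (\<integral>\<^sup>+z. emeasure (flow_law a \<zeta>) {y. case_nat (e, z) y \<in> A} \<partial>\<zeta>) \<partial>lborel)"
    and "(\<lambda>e. \<integral>\<^sup>+z. emeasure (flow_law a \<zeta>) {y. case_nat (e, z) y \<in> A} \<partial>\<zeta>) \<in> borel_measurable borel"
    and "(\<lambda>z. emeasure (flow_law a \<zeta>) {y. case_nat (e, z) y \<in> A}) \<in> borel_measurable borel"
proof -
  let ?D = "exponential_law a \<Otimes>\<^sub>M \<zeta>" and ?S = "flow_law a \<zeta>"
  interpret S: prob_space ?S by (rule prob_space_flow_law)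
  interpret DS: pair_prob_space ?D ?S ..
  have A': "A \<in> sets ?S" using A by (simp add: sets_flow_law)
  have m: "(\<lambda>(d, y). case_nat d y) \<in> measurable (?D \<Otimes>\<^sub>M ?S) ?S"
    unfolding flow_law_def by measurable
  have iter: "distr (?D \<Otimes>\<^sub>M ?S) ?S (\<lambda>(d, y). case_nat d y) = ?S"
    unfolding flow_law_def by (rule flow.PiM_iter)
  let ?V = "(\<lambda>(d, y). case_nat d y) -` A \<inter> space (?D \<Otimes>\<^sub>M ?S)"
  have V: "?V \<in> sets (?D \<Otimes>\<^sub>M ?S)" using m A' by (rule measurable_sets)
  have cut: "Pair d -` ?V = {y. case_nat d y \<in> A}" for d
    by (auto simp: space_pair_measure space_flow_law exponential_law_def)
  have meas: "(\<lambda>d. emeasure ?S {y. case_nat d y \<in> A}) \<in> borel_measurable ?D"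
    using S.measurable_emeasure_Pair[OF V] by (simp only: cut)
  have sD: "sets ?D = sets (borel \<Otimes>\<^sub>M borel)" by (intro sets_pair_measure_cong) (auto simp: sets_exponential_law)
  have meas': "(\<lambda>d. emeasure ?S {y. case_nat d y \<in> A}) \<in> borel_measurable (borel \<Otimes>\<^sub>M \<zeta>)"
    using meas by (subst measurable_cong_sets[OF _ refl, of _ ?D]) (auto intro!: sets_pair_measure_cong simp: sets_exponential_law)
  show m2: "(\<lambda>e. \<integral>\<^sup>+z. emeasure ?S {y. case_nat (e, z) y \<in> A} \<partial>\<zeta>) \<in> borel_measurable borel"
    using zeta.borel_measurable_nn_integral[of "\<lambda>e z. emeasure ?S {y. case_nat (e, z) y \<in> A}" borel] meas'
    by (simp add: split_beta')
  show "(\<lambda>z. emeasure ?S {y. case_nat (e, z) y \<in> A}) \<in> borel_measurable borel"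
    using measurable_compose[OF measurable_Pair1' meas', of e] by simp
  have "emeasure ?S A = emeasure (distr (?D \<Otimes>\<^sub>M ?S) ?S (\<lambda>(d, y). case_nat d y)) A" by (simp add: iter)
  also have "\<dots> = emeasure (?D \<Otimes>\<^sub>M ?S) ?V" by (rule emeasure_distr[OF m A'])
  also have "\<dots> = (\<integral>\<^sup>+d. emeasure ?S {y. case_nat d y \<in> A} \<partial>?D)"
    by (simp only: S.emeasure_pair_measure_alt[OF V] cut)
  also have "\<dots> = (\<integral>\<^sup>+e. \<integral>\<^sup>+z. emeasure ?S {y. case_nat (e, z) y \<in> A} \<partial>\<zeta> \<partial>exponential_law a)"
    using zeta.nn_integral_fst[OF meas] by simp
  also have "\<dots> = (\<integral>\<^sup>+e. ennreal (exponential_density a e) * (\<integral>\<^sup>+z. emeasure ?S {y. case_nat (e, z) y \<in> A} \<partial>\<zeta>) \<partial>lborel)"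
    unfolding exponential_law_def using m2 by (intro nn_integral_density) auto
  finally show "emeasure ?S A = \<dots>" .
qed

lemma arrival_time_case_nat: "arrival_time (case_nat d y) (Suc n) = fst d + arrival_time y n"
  "arrival_time (case_nat d y) 0 = fst d"
  by (simp_all add: arrival_time_def sum.atMost_Suc_shift del: sum.atMost_Suc)

text \<open>The recursion behind all formulas for \<open>passing\<close>: once the first arrival has
  come by time \<open>h\<close>, the rest of the flow has to pass the remaining time
  \<open>h - fst d\<close> with one arrival less.\<close>

lemma passage_case_nat:
  "passage (arrival_time (case_nat d y)) h (Suc n) \<longleftrightarrow> fst d \<le> h \<and> passage (arrival_time y) (h - fst d) n"
  "passage (arrival_time (case_nat d y)) h 0 \<longleftrightarrow> h < fst d"
  unfolding passage_def by (auto simp: arrival_time_case_nat All_less_Suc2 algebra_simps)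

lemma flow_restart_case_nat:
  "flow_restart h (Suc n) (case_nat d y) = flow_restart (h - fst d) n y"
  "flow_restart h 0 (case_nat d y) = case_nat (fst d - h, snd d) y"
  unfolding flow_restart_def by (auto simp: fun_eq_iff arrival_time_case_nat split: nat.split)

definition passing :: "real \<Rightarrow> nat \<Rightarrow> (nat \<Rightarrow> real \<times> real) set \<Rightarrow> (nat \<Rightarrow> real \<times> real) set" where
  "passing h n B = {y. passage (arrival_time y) h n \<and> flow_restart h n y \<in> B}"

lemma sets_passing:
  assumes [measurable]: "B \<in> sets flow_space" shows "passing h n B \<in> sets flow_space"
proof -
  have "{y \<in> space flow_space. passage (arrival_time y) h n \<and> flow_restart h n y \<in> B} \<in> sets flow_space" by measurable
  then show ?thesis by (simp add: passing_def space_flow_space)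
qed

text \<open>Memorylessness of the exponential law. The first waiting time exceeds \<open>h\<close>,
  and translating the integration variable by \<open>h\<close> pulls the factor
  \<open>exp (- a * h)\<close> out of its density.\<close>

lemma emeasure_passing_0:
  assumes B: "B \<in> sets flow_space" and h: "0 \<le> h"
  shows "emeasure (flow_law a \<zeta>) (passing h 0 B) = ennreal (exp (- a * h)) * emeasure (flow_law a \<zeta>) B"
proof -
  let ?G = "\<lambda>e. \<integral>\<^sup>+z. emeasure (flow_law a \<zeta>) {y. case_nat (e, z) y \<in> B} \<partial>\<zeta>"
  note [measurable] = emeasure_flow_law_split(2)[OF B]
  have eq: "{y. case_nat (e, z) y \<in> passing h 0 B} = (if h < e then {y. case_nat (e - h, z) y \<in> B} else {})" for e z
    by (auto simp: passing_def passage_case_nat flow_restart_case_nat)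
  have "emeasure (flow_law a \<zeta>) (passing h 0 B) =
    (\<integral>\<^sup>+e. ennreal (exponential_density a e) * (indicator {h<..} e * ?G (e - h)) \<partial>lborel)"
    by (subst emeasure_flow_law_split(1)[OF sets_passing[OF B]]) (auto intro!: nn_integral_cong simp: eq indicator_def)
  also have "\<dots> = (\<integral>\<^sup>+e. ennreal (exponential_density a (h + 1 * e)) * (indicator {h<..} (h + 1 * e) * ?G (h + 1 * e - h)) \<partial>lborel)"
    by (subst nn_integral_real_affine[where c=1 and t=h]) (auto simp: divide_ennreal_def)
  also have "\<dots> = (\<integral>\<^sup>+e. ennreal (exp (- a * h)) * (ennreal (exponential_density a e) * ?G e) \<partial>lborel)"
  proof (rule nn_integral_cong_AE)
    \<comment> \<open>At \<open>e = 0\<close> the density is positive while the strict condition in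
      the indicator fails, so this single point is excluded.\<close>
    have "AE e in lborel. e \<noteq> (0::real)" by (rule AE_lborel_singleton)
    then show "AE e in lborel. ennreal (exponential_density a (h + 1 * e)) * (indicator {h<..} (h + 1 * e) * ?G (h + 1 * e - h)) =
      ennreal (exp (- a * h)) * (ennreal (exponential_density a e) * ?G e)"
    proof eventually_elim
      fix e :: real assume e: "e \<noteq> 0"
      show "ennreal (exponential_density a (h + 1 * e)) * (indicator {h<..} (h + 1 * e) * ?G (h + 1 * e - h)) =
      ennreal (exp (- a * h)) * (ennreal (exponential_density a e) * ?G e)"
      proof (cases "0 < e")
        case True
        then have "exponential_density a (h + 1 * e) = exp (- a * h) * exponential_density a e"
          using h by (simp add: exponential_density_def exp_add[symmetric] algebra_simps)
        then show ?thesis using True a_pos by (simp add: ennreal_mult exponential_density_nonneg mult.assoc)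
      qed (use e in \<open>auto simp: exponential_density_def\<close>)
    qed
  qed
  also have "\<dots> = ennreal (exp (- a * h)) * emeasure (flow_law a \<zeta>) B"
    by (subst nn_integral_cmult) (auto simp: emeasure_flow_law_split(1)[OF B])
  finally show ?thesis .
qed

lemma emeasure_passing_0_UNIV:
  assumes "0 \<le> h" shows "emeasure (flow_law a \<zeta>) (passing h 0 UNIV) = ennreal (exp (- a * h))"
proof -
  interpret S: prob_space "flow_law a \<zeta>" by (rule prob_space_flow_law)
  from emeasure_passing_0[OF UNIV_flow_space assms] show ?thesis using S.emeasure_space_1 by (simp add: space_flow_law)
qed

text \<open>The number of arrivals up to \<open>h\<close> is independent of the restarted flow,
  which has the original law. Induction on that number for all \<open>h\<close> at once: after a
  first arrival at \<open>e \<le> h\<close> the remaining time is \<open>h - e\<close>.\<close>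

lemma emeasure_passing:
  assumes B: "B \<in> sets flow_space" and h: "0 \<le> h"
  shows "emeasure (flow_law a \<zeta>) (passing h n B) = emeasure (flow_law a \<zeta>) (passing h n UNIV) * emeasure (flow_law a \<zeta>) B"
  using h
proof (induction n arbitrary: h)
  case 0
  then show ?case using emeasure_passing_0[OF B] emeasure_passing_0_UNIV by simp
next
  case (Suc n)
  let ?S = "flow_law a \<zeta>"
  have eq: "{y. case_nat (e, z) y \<in> passing h (Suc n) B} = (if e \<le> h then passing (h - e) n B else {})" for e z B
    by (auto simp: passing_def passage_case_nat flow_restart_case_nat)
  have "emeasure ?S (passing h (Suc n) B) = (\<integral>\<^sup>+e. ennreal (exponential_density a e) *
     (\<integral>\<^sup>+z. emeasure ?S {y. case_nat (e, z) y \<in> passing h (Suc n) UNIV} \<partial>\<zeta>) * emeasure ?S B \<partial>lborel)"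
  proof (subst emeasure_flow_law_split(1)[OF sets_passing[OF B]], rule nn_integral_cong)
    fix e :: real
    have "(\<integral>\<^sup>+z. emeasure ?S {y. case_nat (e, z) y \<in> passing h (Suc n) B} \<partial>\<zeta>) =
      (\<integral>\<^sup>+z. emeasure ?S {y. case_nat (e, z) y \<in> passing h (Suc n) UNIV} * emeasure ?S B \<partial>\<zeta>)"
      unfolding eq using Suc.IH[of "h - e"] by (intro nn_integral_cong) auto
    also have "\<dots> = (\<integral>\<^sup>+z. emeasure ?S {y. case_nat (e, z) y \<in> passing h (Suc n) UNIV} \<partial>\<zeta>) * emeasure ?S B"
      using emeasure_flow_law_split(3)[OF sets_passing[OF UNIV_flow_space], of e h "Suc n"] by (intro nn_integral_multc) simp
    finally show "ennreal (exponential_density a e) * (\<integral>\<^sup>+z. emeasure ?S {y. case_nat (e, z) y \<in> passing h (Suc n) B} \<partial>\<zeta>) =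
      ennreal (exponential_density a e) * (\<integral>\<^sup>+z. emeasure ?S {y. case_nat (e, z) y \<in> passing h (Suc n) UNIV} \<partial>\<zeta>) * emeasure ?S B"
      by (simp add: mult.assoc)
  qed
  also have "\<dots> = emeasure ?S (passing h (Suc n) UNIV) * emeasure ?S B"
    using emeasure_flow_law_split(2)[OF sets_passing[OF UNIV_flow_space], of h "Suc n"]
    by (subst nn_integral_multc) (auto simp: emeasure_flow_law_split(1)[OF sets_passing[OF UNIV_flow_space], of h "Suc n"])
  finally show ?case .
qed

text \<open>With the only arrival at \<open>e\<close>, the factors \<open>a * exp (- a * e)\<close>
  and \<open>exp (- a * (h - e))\<close> multiply to a constant in \<open>e\<close>, and integration
  over \<open>{0..h}\<close> gives the Poisson weight of one arrival. The size of that claim is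
  independent of the restarted flow.\<close>

lemma emeasure_passing_1:
  assumes B: "B \<in> sets flow_space" and h: "0 \<le> h" and C: "C \<in> sets borel"
  shows "emeasure (flow_law a \<zeta>) {y \<in> passing h 1 B. snd (y 0) \<in> C} =
    ennreal (a * h * exp (- a * h)) * emeasure \<zeta> C * emeasure (flow_law a \<zeta>) B"
proof -
  let ?S = "flow_law a \<zeta>" and ?A = "{y \<in> passing h 1 B. snd (y 0) \<in> C}"
  have A: "?A \<in> sets flow_space"
  proof -
    note [measurable] = sets_passing[OF B, of h 1] C
    have "{y \<in> space flow_space. y \<in> passing h 1 B \<and> snd (y 0) \<in> C} \<in> sets flow_space" by measurable
    then show ?thesis by (simp add: space_flow_space)
  qed
  have eq: "{y. case_nat (e, z) y \<in> ?A} = (if e \<le> h \<and> z \<in> C then passing (h - e) 0 B else {})" for e z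
    by (auto simp: passing_def passage_case_nat flow_restart_case_nat)
  have "emeasure ?S ?A = (\<integral>\<^sup>+e. ennreal (exponential_density a e) *
     (\<integral>\<^sup>+z. (if e \<le> h then ennreal (exp (- a * (h - e))) * emeasure ?S B else 0) * indicator C z \<partial>\<zeta>) \<partial>lborel)"
    unfolding emeasure_flow_law_split(1)[OF A] eq
    by (intro nn_integral_cong arg_cong2[where f="(*)"] refl) (auto simp: emeasure_passing_0[OF B] indicator_def)
  also have "\<dots> = (\<integral>\<^sup>+e. ennreal (a * exp (- a * h)) * (emeasure \<zeta> C * emeasure ?S B) * indicator {0..h} e \<partial>lborel)"
  proof (rule nn_integral_cong)
    fix e :: real
    have "(\<integral>\<^sup>+z. (if e \<le> h then ennreal (exp (- a * (h - e))) * emeasure ?S B else 0) * indicator C z \<partial>\<zeta>) =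
      (if e \<le> h then ennreal (exp (- a * (h - e))) * emeasure ?S B else 0) * emeasure \<zeta> C"
      using C by (intro nn_integral_cmult_indicator) simp
    moreover have "ennreal (exponential_density a e) * ennreal (exp (- a * (h - e))) = ennreal (a * exp (- a * h))"
      if "0 \<le> e" using that a_pos
      by (simp add: exponential_density_def ennreal_mult[symmetric] mult.assoc exp_add[symmetric] algebra_simps)
    ultimately show "ennreal (exponential_density a e) *
       (\<integral>\<^sup>+z. (if e \<le> h then ennreal (exp (- a * (h - e))) * emeasure ?S B else 0) * indicator C z \<partial>\<zeta>) =
      ennreal (a * exp (- a * h)) * (emeasure \<zeta> C * emeasure ?S B) * indicator {0..h} e"
      by (cases "0 \<le> e"; cases "e \<le> h") (auto simp: mult_ac exponential_density_def)
  qed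
  also have "\<dots> = ennreal (a * exp (- a * h)) * (emeasure \<zeta> C * emeasure ?S B) * ennreal h"
    using h by (subst nn_integral_cmult_indicator) auto
  also have "\<dots> = ennreal (a * h * exp (- a * h)) * emeasure \<zeta> C * emeasure ?S B"
    using a_pos h by (simp add: ennreal_mult mult_ac)
  finally show ?thesis .
qed

text \<open>Summation over the number of arrivals up to \<open>h\<close>. The identity
  \<open>*\<close> is used twice, for \<open>B\<close> and for the whole space, where it shows that
  the weights sum to 1.\<close>

lemma emeasure_flow_shift:
  assumes B: "B \<in> sets flow_space" and h: "0 \<le> h" and ex: "AE y in flow_law a \<zeta>. \<exists>n. passage (arrival_time y) h n"
  shows "emeasure (flow_law a \<zeta>) {y. flow_shift h y \<in> B} = emeasure (flow_law a \<zeta>) B"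
proof -
  let ?S = "flow_law a \<zeta>"
  interpret S: prob_space ?S by (rule prob_space_flow_law)
  have *: "emeasure ?S {y. flow_shift h y \<in> B} = (\<Sum>n. emeasure ?S (passing h n B))" if B: "B \<in> sets flow_space" for B
  proof -
    have dis: "disjoint_family (\<lambda>n. passing h n B)"
      using passage_unique by (fastforce simp: disjoint_family_on_def passing_def)
    have 1: "{y. flow_shift h y \<in> B} \<in> sets ?S"
      using measurable_sets[OF measurable_flow_shift B] by (simp add: sets_flow_law space_flow_space vimage_def)
    have 2: "passing h n B \<in> sets ?S" for n using sets_passing[OF B] by (simp add: sets_flow_law)
    have "emeasure ?S {y. flow_shift h y \<in> B} = emeasure ?S (\<Union>n. passing h n B)"
    proof (rule emeasure_eq_AE)
      show "AE y in ?S. y \<in> {y. flow_shift h y \<in> B} \<longleftrightarrow> y \<in> (\<Union>n. passing h n B)"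
        using ex
      proof eventually_elim
        fix y assume "\<exists>n. passage (arrival_time y) h n"
        then obtain n where n: "passage (arrival_time y) h n" by blast
        then have "flow_shift h y = flow_restart h n y" by (rule flow_shift_passage)
        moreover have "passage (arrival_time y) h m \<longleftrightarrow> m = n" for m using n passage_unique by blast
        ultimately show "y \<in> {y. flow_shift h y \<in> B} \<longleftrightarrow> y \<in> (\<Union>n. passing h n B)"
          by (simp add: passing_def)
      qed
    qed (use 1 2 in auto)
    also have "\<dots> = (\<Sum>n. emeasure ?S (passing h n B))"
      using 2 by (intro suminf_emeasure[symmetric] dis) auto
    finally show ?thesis .
  qed
  have "emeasure ?S {y. flow_shift h y \<in> B} = (\<Sum>n. emeasure ?S (passing h n UNIV) * emeasure ?S B)"
    by (subst *[OF B], subst emeasure_passing[OF B h]) simp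
  also have "\<dots> = (\<Sum>n. emeasure ?S (passing h n UNIV)) * emeasure ?S B" by (rule ennreal_suminf_multc)
  also have "\<dots> = emeasure ?S UNIV * emeasure ?S B" using *[OF UNIV_flow_space] by simp
  finally show ?thesis using S.emeasure_space_1 by (simp add: space_flow_law)
qed

end

section \<open>Restarting the environment\<close>

context markov_environment
begin

lemma J_event[measurable]: "0 \<le> t \<Longrightarrow> {w\<in>space (P i). J t w = k} \<in> sets (P i)"
  using measurable_sets[OF J_measurable[of t i], of "{k}"] by (simp add: vimage_def Int_def conj_commute)

lemma J_events:
  assumes "finite I" "I \<subseteq> {0..}"
  shows "{w\<in>space (P i). \<forall>s\<in>I. J s w = b s} \<in> sets (P i)"
  using assms by (intro sets.sets_Collect_finite_All) (auto intro!: J_event)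

text \<open>The Markov property recast for finite sets of times. The enumeration \<open>ts\<close>
  lists \<open>insert t I\<close> in increasing order, so its last entry is \<open>t\<close> and the
  one before it is \<open>Max I\<close>.\<close>

lemma J_Markov_set:
  assumes "finite I" "I \<noteq> {}" "I \<subseteq> {0..}" "Max I < t"
  shows "\<P>(w in P i. \<forall>s\<in>insert t I. J s w = b s) =
    \<P>(w in P i. \<forall>s\<in>I. J s w = b s) * \<P>(w in P (b (Max I)). J (t - Max I) w = b t)"
proof -
  have lt: "s < t" if "s \<in> I" for s using assms Max_ge[of I s] that by auto
  obtain n where n: "card I = Suc n" using assms by (metis card_gt_0_iff gr0_implies_Suc)
  define K where "K = insert t I"
  have K: "finite K" using assms by (simp add: K_def)
  define ts where "ts = (!) (sorted_list_of_set K)"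
  have bij: "bij_betw ts {..<card K} K"
    unfolding ts_def by (rule bij_betw_nth) (use K in auto)
  have mono: "strict_mono_on {..<card K} ts"
    unfolding ts_def by (intro strict_mono_onI sorted_wrt_nth_less[of "(<)"]) auto
  have card: "card (insert t I) = Suc (Suc n)" using n assms lt by (subst card_insert_disjoint) auto
  have set: "{..<card (insert t I)} = {..Suc n}" unfolding card by auto
  note bij = bij[unfolded K_def set] and mono = mono[unfolded K_def set]
  have img: "ts ` {..Suc n} = insert t I" using bij by (simp add: bij_betw_def)
  have less: "ts k < ts l" if "k < l" "l \<le> Suc n" for k l
    using strict_mono_onD[OF mono _ _ that(1)] that by auto
  have top: "ts (Suc n) = t"
  proof -
    obtain k where k: "k \<le> Suc n" "ts k = t" using img by (metis atMost_iff imageE insertI1)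
    show ?thesis
    proof (cases "k = Suc n")
      case False
      then have "ts k < ts (Suc n)" using k by (intro less) auto
      moreover have "ts (Suc n) \<in> insert t I" using img by auto
      ultimately show ?thesis using k lt[of "ts (Suc n)"] by auto
    qed (use k in simp)
  qed
  have "ts ` {..n} = I"
  proof -
    have "ts ` {..Suc n} = insert t (ts ` {..n})" using top by (simp add: atMost_Suc)
    moreover have "ts k < t" if "k \<le> n" for k using less[of k "Suc n"] top that by simp
    then have "t \<notin> ts ` {..n}" by auto
    moreover have "t \<notin> I" using lt by auto
    ultimately show ?thesis using img by auto
  qed
  have mx: "Max I = ts n"
  proof (rule Max_eqI)
    fix y assume "y \<in> I"
    then obtain k where "k \<le> n" "y = ts k" using \<open>ts ` {..n} = I\<close> by auto
    then show "y \<le> ts n" using less[of k n] by (cases "k = n") auto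
  qed (use assms \<open>ts ` {..n} = I\<close> in auto)
  have "0 \<le> ts 0" using assms(3) \<open>ts ` {..n} = I\<close> by auto
  from J_Markov[OF this mono, of i "\<lambda>k. b (ts k)"]
  have "\<P>(w in P i. \<forall>k\<le>Suc n. J (ts k) w = b (ts k)) =
    \<P>(w in P i. \<forall>k\<le>n. J (ts k) w = b (ts k)) * \<P>(w in P (b (ts n)). J (ts (Suc n) - ts n) w = b (ts (Suc n)))" .
  moreover have "(\<forall>k\<le>Suc n. J (ts k) w = b (ts k)) \<longleftrightarrow> (\<forall>s\<in>insert t I. J s w = b s)" for w
    unfolding img[symmetric] by auto
  moreover have "(\<forall>k\<le>n. J (ts k) w = b (ts k)) \<longleftrightarrow> (\<forall>s\<in>I. J s w = b s)" for w
    unfolding \<open>ts ` {..n} = I\<close>[symmetric] by auto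
  ultimately show ?thesis by (simp only: mx top)
qed

lemma prob_initial_conj:
  assumes "{w\<in>space (P i). Q w} \<in> sets (P i)"
  shows "\<P>(w in P i. J 0 w = i \<and> Q w) = \<P>(w in P i. Q w)"
proof (rule measure_eq_AE)
  show "AE w in P i. w \<in> {w\<in>space (P i). J 0 w = i \<and> Q w} \<longleftrightarrow> w \<in> {w\<in>space (P i). Q w}"
    using J_initial[of i] by eventually_elim auto
  have "{w\<in>space (P i). J 0 w = i \<and> Q w} = {w\<in>space (P i). J 0 w = i} \<inter> {w\<in>space (P i). Q w}" by auto
  then show "{w\<in>space (P i). J 0 w = i \<and> Q w} \<in> sets (P i)" using assms J_event[of 0 i i] by auto
qed (use assms in auto)

text \<open>Induction on the largest future time \<open>t\<close>. On both sides the new factor is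
  the transition out of the state at the latest earlier time \<open>m\<close>, on the right after
  translating all times by \<open>h\<close>.\<close>

lemma J_restart_cylinder:
  assumes I: "finite I" "I \<subseteq> {0..h}" "h \<in> I" and A: "finite A" "A \<subseteq> {h<..}"
  shows "\<P>(w in P i. \<forall>s\<in>I \<union> A. J s w = b s) =
    \<P>(w in P i. \<forall>s\<in>I. J s w = b s) * \<P>(w in P (b h). \<forall>s\<in>A. J (s - h) w = b s)"
  using A
proof (induction A rule: finite_linorder_max_induct)
  case empty
  interpret prob_space "P (b h)" by (rule prob_space_P)
  show ?case by (simp add: prob_space)
next
  case (insert t A)
  define m where "m = Max (I \<union> A)"
  have h0: "0 \<le> h" using I by auto
  have fin: "finite (I \<union> A)" "I \<union> A \<noteq> {}" using I insert by auto
  have m: "m \<in> I \<union> A" "\<And>s. s \<in> I \<union> A \<Longrightarrow> s \<le> m" unfolding m_def using Max_in[OF fin] Max_ge[OF fin(1)] by auto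
  have mh: "h \<le> m" using m(2) I by auto
  have mt: "m < t" using m(1) insert I by force
  have At: "A \<subseteq> {h<..}" "h < t" using insert by auto
  \<comment> \<open>Time 0 is inserted so that the set is nonempty and has maximum
    \<open>m - h\<close> even when \<open>A\<close> is empty and \<open>m = h\<close>; under
    \<open>P (b h)\<close> this does not change the probability, by
    \<open>J_initial\<close>.\<close>
  define I' where "I' = insert 0 ((\<lambda>s. s - h) ` A)"
  have mA: "m = h \<or> m \<in> A" using m(1) mh I by force
  have MaxI': "Max I' = m - h"
  proof (rule Max_eqI)
    show "finite I'" using insert by (simp add: I'_def)
    fix y assume "y \<in> I'" then show "y \<le> m - h" using m(2) mh by (auto simp: I'_def)
  next
    show "m - h \<in> I'" using mA by (auto simp: I'_def)
  qed
  have sub: "I \<union> A \<subseteq> {0..}" using I At h0 by force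
  have "\<P>(w in P i. \<forall>s\<in>I \<union> insert t A. J s w = b s) = \<P>(w in P i. \<forall>s\<in>insert t (I \<union> A). J s w = b s)"
    by simp
  also have "\<dots> = \<P>(w in P i. \<forall>s\<in>I \<union> A. J s w = b s) * \<P>(w in P (b m). J (t - m) w = b t)"
    unfolding m_def by (rule J_Markov_set[OF fin sub]) (use mt in \<open>simp add: m_def\<close>)
  also have "\<P>(w in P i. \<forall>s\<in>I \<union> A. J s w = b s) =
     \<P>(w in P i. \<forall>s\<in>I. J s w = b s) * \<P>(w in P (b h). \<forall>s\<in>A. J (s - h) w = b s)"
    by (rule insert.IH[OF At(1)])
  finally have L: "\<P>(w in P i. \<forall>s\<in>I \<union> insert t A. J s w = b s) =
     \<P>(w in P i. \<forall>s\<in>I. J s w = b s) * (\<P>(w in P (b h). \<forall>s\<in>A. J (s - h) w = b s) * \<P>(w in P (b m). J (t - m) w = b t))"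
    by (simp only: mult.assoc)
  have init: "\<P>(w in P (b h). \<forall>s\<in>B. J (s - h) w = b s) = \<P>(w in P (b h). \<forall>s\<in>insert 0 ((\<lambda>s. s - h) ` B). J s w = b (s + h))"
    if "finite B" "B \<subseteq> {h<..}" for B
  proof -
    have "{w\<in>space (P (b h)). \<forall>s\<in>(\<lambda>s. s - h) ` B. J s w = b (s + h)} \<in> sets (P (b h))"
      by (rule J_events) (use that in auto)
    then have "{w\<in>space (P (b h)). \<forall>s\<in>B. J (s - h) w = b s} \<in> sets (P (b h))" by simp
    from prob_initial_conj[OF this] show ?thesis by simp
  qed
  have "\<P>(w in P (b h). \<forall>s\<in>insert t A. J (s - h) w = b s) = \<P>(w in P (b h). \<forall>s\<in>insert (t - h) I'. J s w = b (s + h))"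
    by (subst init) (use insert in \<open>auto simp: I'_def insert_commute\<close>)
  also have "\<dots> = \<P>(w in P (b h). \<forall>s\<in>I'. J s w = b (s + h)) * \<P>(w in P (b (Max I' + h)). J (t - h - Max I') w = b (t - h + h))"
    by (rule J_Markov_set) (use insert At MaxI' mt in \<open>auto simp: I'_def\<close>)
  also have "\<dots> = \<P>(w in P (b h). \<forall>s\<in>I'. J s w = b (s + h)) * \<P>(w in P (b m). J (t - m) w = b t)"
    by (simp add: MaxI')
  also have "\<P>(w in P (b h). \<forall>s\<in>I'. J s w = b (s + h)) = \<P>(w in P (b h). \<forall>s\<in>A. J (s - h) w = b s)"
    unfolding I'_def by (rule init[symmetric]) (use insert At in auto)
  finally show ?case using L by simp
qed

text \<open>Here \<open>F\<close> may contain 0, that is, prescribe the state at time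
  \<open>h\<close> a second time. If the two prescriptions differ, both sides vanish, the right one
  because \<open>P (b h)\<close> starts in \<open>b h\<close>; if they agree, 0 can be removed from
  \<open>F\<close>.\<close>

lemma J_restart_point:
  assumes I: "finite I" "I \<subseteq> {0..h}" "h \<in> I" and F: "finite F" "F \<subseteq> {0..}"
  shows "\<P>(w in P i. (\<forall>s\<in>I. J s w = b s) \<and> (\<forall>t\<in>F. J (h + t) w = d t)) =
    \<P>(w in P i. \<forall>s\<in>I. J s w = b s) * \<P>(w in P (b h). \<forall>t\<in>F. J t w = d t)"
proof (cases "0 \<in> F \<and> d 0 \<noteq> b h")
  case True
  then have "{w\<in>space (P i). (\<forall>s\<in>I. J s w = b s) \<and> (\<forall>t\<in>F. J (h + t) w = d t)} = {}"
    using I by force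
  then have "\<P>(w in P i. (\<forall>s\<in>I. J s w = b s) \<and> (\<forall>t\<in>F. J (h + t) w = d t)) = 0"
    by (simp only: measure_empty)
  moreover have "\<P>(w in P (b h). \<forall>t\<in>F. J t w = d t) = 0"
  proof -
    have "\<P>(w in P (b h). J 0 w = b h \<and> (\<forall>t\<in>F. J t w = d t)) = \<P>(w in P (b h). \<forall>t\<in>F. J t w = d t)"
      by (rule prob_initial_conj[OF J_events[OF F]])
    moreover have "{w\<in>space (P (b h)). J 0 w = b h \<and> (\<forall>t\<in>F. J t w = d t)} = {}" using True by force
    ultimately show ?thesis by (simp only: measure_empty)
  qed
  ultimately show ?thesis by simp
next
  case False
  define G where "G = F - {0}"
  define e where "e s = (if s \<le> h then b s else d (s - h))" for s
  have G: "finite G" "G \<subseteq> {0<..}" using F by (auto simp: G_def order_le_less)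
  have e: "e h = b h" "\<And>s. s \<in> I \<Longrightarrow> e s = b s" "\<And>t. t \<in> G \<Longrightarrow> e (h + t) = d t"
    using I G by (auto simp: e_def)
  have FG: "(\<forall>t\<in>F. J (q + t) w = d t) \<longleftrightarrow> (\<forall>t\<in>G. J (q + t) w = d t)" if "J q w = b h" for q w
    using False that by (auto simp: G_def)
  have eq: "(\<forall>s\<in>I. J s w = b s) \<and> (\<forall>t\<in>F. J (h + t) w = d t) \<longleftrightarrow> (\<forall>s\<in>I \<union> (+) h ` G. J s w = e s)" for w
    using e FG[of h w] I(3) by auto
  have "\<P>(w in P i. (\<forall>s\<in>I. J s w = b s) \<and> (\<forall>t\<in>F. J (h + t) w = d t)) =
     \<P>(w in P i. \<forall>s\<in>I. J s w = e s) * \<P>(w in P (e h). \<forall>s\<in>(+) h ` G. J (s - h) w = e s)"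
    unfolding eq by (rule J_restart_cylinder) (use I G in auto)
  also have "\<P>(w in P i. \<forall>s\<in>I. J s w = e s) = \<P>(w in P i. \<forall>s\<in>I. J s w = b s)"
    using e(2) by simp
  also have "\<P>(w in P (e h). \<forall>s\<in>(+) h ` G. J (s - h) w = e s) = \<P>(w in P (b h). \<forall>t\<in>G. J t w = d t)"
    using e(1,3) by simp
  also have "\<P>(w in P (b h). \<forall>t\<in>G. J t w = d t) = \<P>(w in P (b h). J 0 w = b h \<and> (\<forall>t\<in>G. J t w = d t))"
    by (rule prob_initial_conj[symmetric], rule J_events) (use G in auto)
  also have "\<dots> = \<P>(w in P (b h). J 0 w = b h \<and> (\<forall>t\<in>F. J t w = d t))"
    using FG[of 0] by (intro arg_cong[where f="measure (P (b h))"]) auto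
  also have "\<dots> = \<P>(w in P (b h). \<forall>t\<in>F. J t w = d t)"
    by (rule prob_initial_conj[OF J_events[OF F]])
  finally show ?thesis .
qed

definition env_path :: "'w \<Rightarrow> real \<Rightarrow> 's" where
  "env_path w = (\<lambda>t\<in>{0..}. J t w)"

definition env_law :: "'s \<Rightarrow> (real \<Rightarrow> 's) measure" where
  "env_law i = distr (P i) path_space env_path"

lemma env_path_apply: "0 \<le> t \<Longrightarrow> env_path w t = J t w" by (simp add: env_path_def)

lemma step_path_J: "w \<in> space (P i) \<Longrightarrow> step_path (\<lambda>t. J t w)"
  using J_right_continuous J_left_limit by (simp add: step_path_def)

lemma step_path_env_path: "w \<in> space (P i) \<Longrightarrow> step_path (env_path w)"
  unfolding env_path_def by (rule step_path_restrict[OF step_path_J])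

lemma measurable_env_path: "env_path \<in> measurable (P i) path_space"
proof (rule measurable_into_path_space)
  show "(\<lambda>w. env_path w t) \<in> measurable (P i) (count_space UNIV)" if "0 \<le> t" for t
    using J_measurable[OF that, of i] that by (simp add: env_path_apply)
qed (use step_path_env_path in \<open>auto simp: env_path_def\<close>)

lemma prob_space_env_law: "prob_space (env_law i)"
  unfolding env_law_def by (rule prob_space.prob_space_distr[OF prob_space_P measurable_env_path])

lemma sets_env_law[simp]: "sets (env_law i) = sets path_space" by (simp add: env_law_def)

end

lemma measurable_shifted_path:
  assumes "0 \<le> h" shows "shifted_path h \<in> measurable path_space path_space"
proof (rule measurable_into_path_space)
  show "(\<lambda>x. shifted_path h x t) \<in> measurable path_space (count_space UNIV)" if "0 \<le> t" for t
    using measurable_path_component[OF measurable_ident, of "h + t"] that assms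
    by (simp add: shifted_path_apply)
qed (use assms in \<open>auto simp: space_path_space step_path_shifted_path, auto simp: shifted_path_def\<close>)

context markov_environment
begin

text \<open>There are finitely many states, so the event is a finite disjoint union over the
  possible values \<open>d\<close> at the times in \<open>F\<close>.\<close>

lemma J_restart_rectangle:
  assumes I: "finite I" "I \<subseteq> {0..h}" "h \<in> I" and F: "finite F" "F \<subseteq> {0..}"
  shows "\<P>(w in P i. (\<forall>s\<in>I. J s w = b s) \<and> (\<forall>t\<in>F. J (h + t) w \<in> D t)) =
    \<P>(w in P i. \<forall>s\<in>I. J s w = b s) * \<P>(w in P (b h). \<forall>t\<in>F. J t w \<in> D t)"
proof -
  have h0: "0 \<le> h" using I by auto
  have finD: "finite (PiE F D)" by (intro finite_PiE F) simp
  have split: "\<P>(w in P j. Q w \<and> (\<forall>t\<in>F. J (q + t) w \<in> D t)) = (\<Sum>d\<in>PiE F D. \<P>(w in P j. Q w \<and> (\<forall>t\<in>F. J (q + t) w = d t)))"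
    if Q: "{w\<in>space (P j). Q w} \<in> sets (P j)" and q: "0 \<le> q" for j Q q
  proof -
    interpret prob_space "P j" by (rule prob_space_P)
    have "{w\<in>space (P j). Q w \<and> (\<forall>t\<in>F. J (q + t) w \<in> D t)} =
      (\<Union>d\<in>PiE F D. {w\<in>space (P j). Q w \<and> (\<forall>t\<in>F. J (q + t) w = d t)})"
    proof safe
      fix w assume "w \<in> space (P j)" "Q w" "\<forall>t\<in>F. J (q + t) w \<in> D t"
      then show "w \<in> (\<Union>d\<in>PiE F D. {w\<in>space (P j). Q w \<and> (\<forall>t\<in>F. J (q + t) w = d t)})"
        by (intro UN_I[of "restrict (\<lambda>t. J (q + t) w) F"]) auto
    qed (auto simp: PiE_iff)
    moreover have "measure (P j) \<dots> = (\<Sum>d\<in>PiE F D. \<P>(w in P j. Q w \<and> (\<forall>t\<in>F. J (q + t) w = d t)))"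
    proof (rule finite_measure_finite_Union[OF finD])
      show "(\<lambda>d. {w\<in>space (P j). Q w \<and> (\<forall>t\<in>F. J (q + t) w = d t)}) ` PiE F D \<subseteq> sets (P j)"
      proof safe
        fix d
        have "{w\<in>space (P j). \<forall>s\<in>(+) q ` F. J s w = d (s - q)} \<in> sets (P j)"
          by (rule J_events) (use F q in auto)
        then have "{w\<in>space (P j). Q w} \<inter> {w\<in>space (P j). \<forall>t\<in>F. J (q + t) w = d t} \<in> sets (P j)" using Q by auto
        then show "{w\<in>space (P j). Q w \<and> (\<forall>t\<in>F. J (q + t) w = d t)} \<in> sets (P j)"
          by (rule back_subst[of "\<lambda>S. S \<in> sets (P j)"]) auto
      qed
      show "disjoint_family_on (\<lambda>d. {w\<in>space (P j). Q w \<and> (\<forall>t\<in>F. J (q + t) w = d t)}) (PiE F D)"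
        unfolding disjoint_family_on_def
      proof (intro ballI impI)
        fix d e assume "d \<in> PiE F D" "e \<in> PiE F D" "d \<noteq> e"
        then obtain t where "t \<in> F" "d t \<noteq> e t" by (meson PiE_ext)
        then show "{w\<in>space (P j). Q w \<and> (\<forall>t\<in>F. J (q + t) w = d t)} \<inter> {w\<in>space (P j). Q w \<and> (\<forall>t\<in>F. J (q + t) w = e t)} = {}"
          by auto
      qed
    qed
    ultimately show ?thesis by simp
  qed
  have "\<P>(w in P i. (\<forall>s\<in>I. J s w = b s) \<and> (\<forall>t\<in>F. J (h + t) w \<in> D t)) =
    (\<Sum>d\<in>PiE F D. \<P>(w in P i. (\<forall>s\<in>I. J s w = b s) \<and> (\<forall>t\<in>F. J (h + t) w = d t)))"
    by (rule split[OF J_events h0]) (use I in auto)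
  also have "\<dots> = (\<Sum>d\<in>PiE F D. \<P>(w in P i. \<forall>s\<in>I. J s w = b s) * \<P>(w in P (b h). \<forall>t\<in>F. J t w = d t))"
    by (intro sum.cong refl J_restart_point I F)
  also have "\<dots> = \<P>(w in P i. \<forall>s\<in>I. J s w = b s) * \<P>(w in P (b h). \<forall>t\<in>F. J t w \<in> D t)"
    using split[of "b h" "\<lambda>_. True" 0] by (simp add: sum_distrib_left)
  finally show ?thesis .
qed

text \<open>For a fixed past event \<open>C\<close> both sides are finite measures in the future
  event. They agree on cylinders by \<open>J_restart_rectangle\<close>, hence on the product
  sigma-algebra, and finally on its trace.\<close>

lemma J_restart:
  assumes I: "finite I" "I \<subseteq> {0..h}" "h \<in> I" and B: "B \<in> sets path_space"
  shows "\<P>(w in P i. (\<forall>s\<in>I. J s w = b s) \<and> shifted_path h (env_path w) \<in> B) =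
    \<P>(w in P i. \<forall>s\<in>I. J s w = b s) * measure (env_law (b h)) B"
proof -
  have h0: "0 \<le> h" using I by auto
  interpret i: prob_space "P i" by (rule prob_space_P)
  interpret j: prob_space "P (b h)" by (rule prob_space_P)
  interpret e: prob_space "env_law (b h)" by (rule prob_space_env_law)
  let ?S = "PiM {0..} (\<lambda>_. count_space UNIV) :: (real \<Rightarrow> 's) measure"
  define C where "C = {w\<in>space (P i). \<forall>s\<in>I. J s w = b s}"
  have C: "C \<in> sets (P i)" unfolding C_def by (rule J_events) (use I in auto)
  define X where "X w = shifted_path h (env_path w)" for w
  have Xp: "X \<in> measurable (P i) path_space"
    unfolding X_def[abs_def] by (rule measurable_compose[OF measurable_env_path measurable_shifted_path[OF h0]])
  then have X: "X \<in> measurable (P i) ?S" by (simp add: path_space_def measurable_restrict_space2_iff)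
  have Y: "env_path \<in> measurable (P (b h)) ?S"
    using measurable_env_path[of "b h"] by (simp add: path_space_def measurable_restrict_space2_iff)
  let ?M = "density (P i) (indicator C)"
  note dens = emeasure_distr_indicator[OF C X]
  have eq: "distr ?M ?S X = scale_measure (emeasure (P i) C) (distr (P (b h)) ?S env_path)"
  proof (rule measure_eqI_PiM_infinite)
    fix F and D :: "real \<Rightarrow> 's set"
    assume F: "finite F" "F \<subseteq> {0..}" and D: "\<And>t. t \<in> F \<Longrightarrow> D t \<in> sets (count_space UNIV)"
    let ?E = "prod_emb {0..} (\<lambda>_. count_space UNIV) F (PiE F D)"
    have E: "?E \<in> sets ?S" using F by (intro sets_PiM_I) auto
    have mem: "x \<in> ?E \<longleftrightarrow> (\<forall>t\<in>F. x t \<in> D t)" if "x \<in> extensional {0..}" for x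
      using that F by (auto simp: prod_emb_def PiE_iff)
    have 1: "C \<inter> (X -` ?E \<inter> space (P i)) = {w\<in>space (P i). (\<forall>s\<in>I. J s w = b s) \<and> (\<forall>t\<in>F. J (h + t) w \<in> D t)}"
    proof -
      have "X w \<in> ?E \<longleftrightarrow> (\<forall>t\<in>F. J (h + t) w \<in> D t)" for w
      proof -
        have "X w t = J (h + t) w" if "t \<in> F" for t
          using that F h0 by (auto simp: X_def shifted_path_apply env_path_apply)
        then show ?thesis by (subst mem) (auto simp: X_def shifted_path_def)
      qed
      then show ?thesis by (auto simp: C_def)
    qed
    have 2: "env_path -` ?E \<inter> space (P (b h)) = {w\<in>space (P (b h)). \<forall>t\<in>F. J t w \<in> D t}"
    proof -
      have "env_path w \<in> ?E \<longleftrightarrow> (\<forall>t\<in>F. J t w \<in> D t)" for w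
      proof -
        have "env_path w t = J t w" if "t \<in> F" for t using that F by (auto simp: env_path_apply)
        then show ?thesis by (subst mem) (auto simp: env_path_def)
      qed
      then show ?thesis by auto
    qed
    have "emeasure (distr ?M ?S X) ?E = emeasure (P i) (C \<inter> (X -` ?E \<inter> space (P i)))"
      by (rule dens[OF E])
    also have "\<dots> = ennreal (\<P>(w in P i. \<forall>s\<in>I. J s w = b s) * \<P>(w in P (b h). \<forall>t\<in>F. J t w \<in> D t))"
      unfolding 1 i.emeasure_eq_measure J_restart_rectangle[OF I F] ..
    also have "\<dots> = emeasure (P i) C * emeasure (P (b h)) {w\<in>space (P (b h)). \<forall>t\<in>F. J t w \<in> D t}"
      by (simp add: ennreal_mult i.emeasure_eq_measure j.emeasure_eq_measure C_def)
    also have "\<dots> = emeasure (scale_measure (emeasure (P i) C) (distr (P (b h)) ?S env_path)) ?E"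
      using Y E by (simp add: emeasure_distr 2)
    finally show "emeasure (distr ?M ?S X) ?E = emeasure (scale_measure (emeasure (P i) C) (distr (P (b h)) ?S env_path)) ?E" .
  next
    show "finite_measure (distr ?M ?S X)"
      by (rule finite_measure_distr_indicator[OF i.finite_measure_axioms C X])
  qed simp_all
  \<comment> \<open>An event of \<open>path_space\<close> is the trace of a product event
    \<open>A\<close>. Since both path maps take values in step paths, \<open>A\<close> and
    \<open>B\<close> have the same preimages.\<close>
  obtain A where A: "A \<in> sets ?S" "B = A \<inter> {x. step_path x}"
    using B by (auto simp: path_space_def sets_restrict_space)
  have XB: "X w \<in> B \<longleftrightarrow> X w \<in> A" if "w \<in> space (P i)" for w
    using measurable_space[OF Xp that] A(2) by (auto simp: space_path_space)
  have YB: "env_path w \<in> B \<longleftrightarrow> env_path w \<in> A" if "w \<in> space (P (b h))" for w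
    using measurable_space[OF measurable_env_path that] A(2) by (auto simp: space_path_space)
  have "emeasure (P i) (C \<inter> (X -` A \<inter> space (P i))) = emeasure (distr ?M ?S X) A"
    by (rule dens[OF A(1), symmetric])
  also have "\<dots> = emeasure (P i) C * emeasure (P (b h)) (env_path -` A \<inter> space (P (b h)))"
    unfolding eq using Y A by (simp add: emeasure_distr)
  also have "env_path -` A \<inter> space (P (b h)) = env_path -` B \<inter> space (P (b h))" using YB by auto
  also have "emeasure (P (b h)) \<dots> = emeasure (env_law (b h)) B"
    unfolding env_law_def using B by (subst emeasure_distr[OF measurable_env_path]) auto
  also have "C \<inter> (X -` A \<inter> space (P i)) = {w\<in>space (P i). (\<forall>s\<in>I. J s w = b s) \<and> shifted_path h (env_path w) \<in> B}"
    using XB by (auto simp: C_def X_def)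
  finally show ?thesis
    by (simp add: i.emeasure_eq_measure e.emeasure_eq_measure ennreal_mult[symmetric] C_def)
qed

end

section \<open>At most one environment jump in a short interval, up to a quadratic error\<close>

lemma constant_path_iff_rational:
  fixes x :: "real \<Rightarrow> 's"
  assumes "step_path x" "0 \<le> d"
  shows "(\<forall>s\<in>{0..d}. x s = k) \<longleftrightarrow> x d = k \<and> (\<forall>q::rat. 0 \<le> real_of_rat q \<and> real_of_rat q < d \<longrightarrow> x (of_rat q) = k)"
proof safe
  fix s assume d: "k = x d" and q: "\<forall>q::rat. 0 \<le> real_of_rat q \<and> real_of_rat q < d \<longrightarrow> x (of_rat q) = x d"
    and s: "s \<in> {0..d}"
  show "x s = x d"
  proof (cases "s = d")
    case False
    have "\<forall>\<^sub>F r in at_right s. x r = x s" using assms s by (simp add: step_path_def)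
    then obtain b where b: "b > s" "\<forall>r>s. r < b \<longrightarrow> x r = x s"
      unfolding eventually_at_right_field by blast
    obtain q' where q': "s < of_rat q'" "of_rat q' < min d b" using of_rat_dense[of s "min d b"] b s False by auto
    have "0 \<le> s" using s by simp
    then have "0 \<le> real_of_rat q'" using q'(1) by linarith
    moreover have "real_of_rat q' < d" using q'(2) by simp
    ultimately have "x (of_rat q') = x d" using q by blast
    then show ?thesis using b(2)[rule_format, of "of_rat q'"] q' by simp
  qed simp
qed (use assms in auto)

lemma sets_constant_path:
  fixes k :: "'s::finite"
  assumes "0 \<le> d"
  shows "{x\<in>space path_space. \<forall>s\<in>{0..d}. x s = k} \<in> sets path_space"
proof -
  note c = sets_path_component[where k=k]
  have "{x\<in>space path_space. 0 \<le> real_of_rat q \<and> real_of_rat q < d \<longrightarrow> x (of_rat q) = k} \<in> sets path_space" for q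
  proof (cases "0 \<le> real_of_rat q \<and> real_of_rat q < d")
    case True
    then show ?thesis using c[of "of_rat q"] by (simp only: True simp_thms)
  next
    case False
    show ?thesis by (simp only: False simp_thms sets.top Collect_mem_eq)
  qed
  then have "{x\<in>space path_space. \<forall>q. 0 \<le> real_of_rat q \<and> real_of_rat q < d \<longrightarrow> x (of_rat q) = k} \<in> sets path_space"
    by (rule sets.sets_Collect_countable_All)
  from sets.Int[OF c[OF assms] this] show ?thesis
  proof (rule back_subst[of "\<lambda>S. S \<in> sets path_space"], intro set_eqI)
    fix x :: "real \<Rightarrow> 's"
    show "x \<in> {x \<in> space path_space. x d = k} \<inter>
         {x \<in> space path_space. \<forall>q. 0 \<le> real_of_rat q \<and> real_of_rat q < d \<longrightarrow> x (real_of_rat q) = k} \<longleftrightarrow>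
      x \<in> {x \<in> space path_space. \<forall>s\<in>{0..d}. x s = k}"
      unfolding Int_iff mem_Collect_eq space_path_space using constant_path_iff_rational[of x d k] assms by blast
  qed
qed

text \<open>The path without any jump is included, so this is the property of having at most one
  jump when started in \<open>i\<close>.\<close>

definition single_jump :: "(real \<Rightarrow> 's) \<Rightarrow> 's \<Rightarrow> real \<Rightarrow> bool" where
  "single_jump x i h \<longleftrightarrow> (\<forall>s\<in>{0..h}. x s = i) \<or>
    (\<exists>r k. 0 < r \<and> r \<le> h \<and> k \<noteq> i \<and> (\<forall>s\<in>{0..<r}. x s = i) \<and> (\<forall>s\<in>{r..h}. x s = k))"

text \<open>Let \<open>r\<close> be the first time off \<open>i\<close>. The path keeps the value
  \<open>x r\<close> up to some \<open>b\<close>, so a mesh below \<open>b - r\<close> puts a grid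
  point into \<open>{r..<b}\<close>: it is the first grid point off \<open>i\<close>, and the path
  changes again after it. The claim is made for all fine meshes, not for one, so that a liminf of
  events can be formed.\<close>

lemma not_single_jump_grid:
  fixes x :: "real \<Rightarrow> 's"
  assumes x: "step_path x" "x 0 = i" and h: "0 < h" and ns: "\<not> single_jump x i h"
  shows "\<exists>N. \<forall>n\<ge>N. \<exists>l\<le>n. \<exists>k. k \<noteq> i \<and> (\<forall>m\<le>l. x (real m * h / real (Suc n)) = i) \<and>
    x (real (Suc l) * h / real (Suc n)) = k \<and> \<not> (\<forall>s\<in>{real (Suc l) * h / real (Suc n)..h}. x s = k)"
proof -
  define r where "r = Inf {t\<in>{0..h}. x t \<noteq> i}"
  have "\<not> (\<forall>s\<in>{0..h}. x s = i)" using ns by (simp add: single_jump_def)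
  then obtain t0 where t0: "t0 \<in> {0..h}" "x t0 \<noteq> i" by blast
  have bdd: "bdd_below {t\<in>{0..h}. x t \<noteq> i}" by (rule bdd_belowI[of _ 0]) auto
  have r0: "0 \<le> r" unfolding r_def using t0 by (intro cInf_greatest) auto
  have rt0: "r \<le> t0" unfolding r_def using t0 bdd by (intro cInf_lower) auto
  have rh: "r \<le> h" using rt0 t0 by auto
  have before: "x s = i" if "0 \<le> s" "s < r" for s
  proof (rule ccontr)
    assume "x s \<noteq> i"
    then have "r \<le> s" unfolding r_def using that rh bdd by (intro cInf_lower) auto
    with that show False by simp
  qed
  have "\<forall>\<^sub>F s in at_right r. x s = x r" using x r0 by (simp add: step_path_def)
  then obtain b where b: "b > r" "\<forall>s>r. s < b \<longrightarrow> x s = x r"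
    unfolding eventually_at_right_field by blast
  have b': "x s = x r" if "r \<le> s" "s < b" for s using that b(2) by (cases "s = r") auto
  have xr: "x r \<noteq> i"
  proof
    assume e: "x r = i"
    obtain t where "t \<in> {0..h}" "x t \<noteq> i" "t < b"
      using cInf_lessD[of "{t\<in>{0..h}. x t \<noteq> i}" b] b(1) t0 unfolding r_def by auto
    then show False using before[of t] b'[of t] e by (cases "t < r") auto
  qed
  then have rpos: "0 < r" using r0 x(2) by (cases "r = 0") auto
  have "\<not> (\<forall>s\<in>{r..h}. x s = x r)"
  proof
    assume "\<forall>s\<in>{r..h}. x s = x r"
    moreover have "\<forall>s\<in>{0..<r}. x s = i" using before by simp
    ultimately show False using ns rpos rh xr unfolding single_jump_def by blast
  qed
  then obtain r2 where r2: "r \<le> r2" "r2 \<le> h" "x r2 \<noteq> x r" by auto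
  have br2: "b \<le> r2" using b'[of r2] r2 by force
  obtain N where N: "h / real (Suc N) < b - r"
  proof -
    obtain N where "h / (b - r) < real N" using reals_Archimedean2 by blast
    then have "h / (b - r) < real (Suc N)" by simp
    then show ?thesis using b(1) that[of N] by (simp add: field_simps)
  qed
  show ?thesis
  proof (rule exI[of _ N], intro allI impI)
    fix n assume n: "N \<le> n"
    have step: "h / real (Suc n) < b - r"
    proof -
      have "h / real (Suc n) \<le> h / real (Suc N)" using n h by (intro divide_left_mono) auto
      then show ?thesis using N by simp
    qed
    \<comment> \<open>\<open>q\<close> is the time \<open>r\<close> measured in units of the mesh,
      and \<open>l\<close> is the last grid index strictly before \<open>r\<close>, hence the
      ceiling minus one.\<close>
    define q where "q = r * real (Suc n) / h"
    have q0: "0 < q" using rpos h by (simp add: q_def)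
    define l where "l = nat (\<lceil>q\<rceil> - 1)"
    have l: "real l < q" "q \<le> real (Suc l)" using q0 unfolding l_def by linarith+
    have grid_less: "real m * h / real (Suc n) < r" if "m \<le> l" for m
    proof -
      have "real m < q" using l that by linarith
      then show ?thesis using h by (simp add: q_def field_simps)
    qed
    define s where "s = real (Suc l) * h / real (Suc n)"
    have rs: "r \<le> s" using l(2) h by (simp add: q_def s_def field_simps)
    have "s = real l * h / real (Suc n) + h / real (Suc n)"
      unfolding s_def add_divide_distrib[symmetric] by (simp add: algebra_simps)
    then have sb: "s < b" using grid_less[of l] step by simp
    have "l \<le> n"
    proof (rule ccontr)
      assume "\<not> l \<le> n"
      then have "real (Suc n) \<le> real l" by simp
      then have "h * real (Suc n) \<le> h * real l" using h by (intro mult_left_mono) auto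
      then have "h \<le> real l * h / real (Suc n)" by (simp add: field_simps)
      then show False using grid_less[of l] rh by simp
    qed
    moreover have "x (real m * h / real (Suc n)) = i" if "m \<le> l" for m
      using grid_less[OF that] h by (intro before) auto
    moreover have "x s = x r" using rs sb by (rule b')
    moreover have "\<not> (\<forall>t\<in>{s..h}. x t = x r)" using r2 br2 sb by auto
    ultimately show "\<exists>l\<le>n. \<exists>k. k \<noteq> i \<and> (\<forall>m\<le>l. x (real m * h / real (Suc n)) = i) \<and>
      x (real (Suc l) * h / real (Suc n)) = k \<and> \<not> (\<forall>s\<in>{real (Suc l) * h / real (Suc n)..h}. x s = k)"
      using xr unfolding s_def by blast
  qed
qed

context markov_environment
begin

lemma env_law_constant:
  assumes "0 \<le> d"
  shows "measure (env_law k) {x\<in>space path_space. \<forall>s\<in>{0..d}. x s = k} = exp (- lam k * d)"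
proof -
  have "measure (env_law k) {x\<in>space path_space. \<forall>s\<in>{0..d}. x s = k} = \<P>(w in P k. \<forall>s\<in>{0..d}. J s w = k)"
    unfolding env_law_def
    by (subst measure_distr[OF measurable_env_path sets_constant_path[OF assms]])
      (auto intro!: arg_cong[where f="measure (P k)"] simp: env_path_apply measurable_space[OF measurable_env_path])
  then show ?thesis using J_remain[OF assms] by simp
qed

lemma sets_J_constant:
  assumes "0 \<le> d" shows "{w\<in>space (P i). \<forall>s\<in>{0..d}. J s w = k} \<in> sets (P i)"
  using measurable_sets[OF measurable_env_path[of i] sets_constant_path[OF assms, of k]]
  by (rule back_subst[of "\<lambda>S. S \<in> sets (P i)"])
    (auto simp: env_path_apply measurable_space[OF measurable_env_path])

text \<open>For \<open>k\<close> other than \<open>i\<close>, the event \<open>A\<close> says that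
  \<open>s\<close> is the first grid point off \<open>i\<close> and shows state \<open>k\<close>;
  \<open>D\<close> adds a further change of state up to \<open>h\<close>. A restart at the fixed
  time \<open>s\<close> gives this addition the conditional probability
  \<open>1 - exp (- lam k * (h - s))\<close>.\<close>

lemma grid_double_jump_event:
  fixes i k :: 's and h :: real and l n :: nat
  assumes h: "0 < h" and l: "l \<le> n"
  defines "s \<equiv> real (Suc l) * h / real (Suc n)"
  defines "A \<equiv> {w\<in>space (P i). (\<forall>m\<le>l. J (real m * h / real (Suc n)) w = i) \<and> J s w = k}"
  defines "D \<equiv> {w\<in>space (P i). ((\<forall>m\<le>l. J (real m * h / real (Suc n)) w = i) \<and> J s w = k) \<and> \<not> (\<forall>t\<in>{s..h}. J t w = k)}"
  shows "A \<in> sets (P i)" "D \<in> sets (P i)" "measure (P i) D \<le> measure (P i) A * (lam k * h)"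
proof -
  interpret i: prob_space "P i" by (rule prob_space_P)
  interpret e: prob_space "env_law k" by (rule prob_space_env_law)
  have sh: "0 < s" "s \<le> h"
  proof -
    have "real (Suc l) * h \<le> real (Suc n) * h" using l h by (intro mult_right_mono) auto
    then show "s \<le> h" by (simp add: s_def pos_divide_le_eq mult.commute del: of_nat_Suc)
    show "0 < s" unfolding s_def using h by (intro divide_pos_pos mult_pos_pos) auto
  qed
  define I where "I = insert s ((\<lambda>m. real m * h / real (Suc n)) ` {..l})"
  define b where "b t = (if t < s then i else k)" for t
  have lt: "real m * h / real (Suc n) < s" if "m \<le> l" for m
    unfolding s_def using that h by (intro divide_strict_right_mono mult_strict_right_mono) auto
  have I: "finite I" "I \<subseteq> {0..s}" "s \<in> I"
  proof -
    show "I \<subseteq> {0..s}"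
    proof
      fix t assume "t \<in> I"
      then consider "t = s" | m where "m \<le> l" "t = real m * h / real (Suc n)" unfolding I_def by blast
      then show "t \<in> {0..s}"
      proof cases
        case 2
        have "0 \<le> t" unfolding 2(2) using h by (intro divide_nonneg_nonneg mult_nonneg_nonneg) auto
        then show ?thesis using lt[OF 2(1)] 2(2) by simp
      qed (use sh in simp)
    qed
  qed (simp_all add: I_def)
  have eq: "(\<forall>t\<in>I. J t w = b t) \<longleftrightarrow> (\<forall>m\<le>l. J (real m * h / real (Suc n)) w = i) \<and> J s w = k" for w
    using lt by (auto simp: I_def b_def)
  show A: "A \<in> sets (P i)" unfolding A_def eq[symmetric] by (rule J_events) (use I in auto)
  define B where "B = space path_space - {x\<in>space path_space. \<forall>t\<in>{0..h - s}. x t = k}"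
  have B: "B \<in> sets path_space" unfolding B_def using sh by (intro sets.compl_sets sets_constant_path) simp
  have mem: "shifted_path s (env_path w) \<in> B \<longleftrightarrow> \<not> (\<forall>t\<in>{s..h}. J t w = k)" if "w \<in> space (P i)" for w
  proof -
    have "shifted_path s (env_path w) \<in> space path_space"
      using measurable_space[OF measurable_compose[OF measurable_env_path measurable_shifted_path] that] sh by simp
    moreover have "(\<forall>t\<in>{0..h - s}. shifted_path s (env_path w) t = k) \<longleftrightarrow> (\<forall>t\<in>{s..h}. J t w = k)"
    proof
      assume a: "\<forall>t\<in>{0..h - s}. shifted_path s (env_path w) t = k"
      show "\<forall>t\<in>{s..h}. J t w = k"
      proof
        fix t assume "t \<in> {s..h}"
        then show "J t w = k" using a[rule_format, of "t - s"] sh by (simp add: shifted_path_apply env_path_apply)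
      qed
    qed (use sh in \<open>auto simp: shifted_path_apply env_path_apply\<close>)
    ultimately show ?thesis by (simp add: B_def)
  qed
  have D: "D = {w\<in>space (P i). (\<forall>t\<in>I. J t w = b t) \<and> shifted_path s (env_path w) \<in> B}"
    using mem unfolding D_def eq[symmetric] by auto
  have "D = A \<inter> ((\<lambda>w. shifted_path s (env_path w)) -` B \<inter> space (P i))"
    unfolding D A_def eq[symmetric] by auto
  then show "D \<in> sets (P i)"
    using A measurable_sets[OF measurable_compose[OF measurable_env_path measurable_shifted_path] B] sh by auto
  have "measure (P i) D = measure (P i) A * measure (env_law (b s)) B"
    unfolding D A_def eq[symmetric] by (rule J_restart[OF I B])
  also have "measure (env_law (b s)) B = 1 - exp (- lam k * (h - s))"
    using e.prob_compl[of "{x\<in>space path_space. \<forall>t\<in>{0..h - s}. x t = k}"] sets_constant_path[of "h - s" k] sh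
      env_law_constant[of "h - s" k]
    by (simp add: b_def B_def env_law_def)
  also have "\<dots> \<le> lam k * h"
  proof -
    have "1 - lam k * (h - s) \<le> exp (- lam k * (h - s))" using exp_ge_add_one_self[of "- lam k * (h - s)"] by simp
    moreover have "lam k * (h - s) \<le> lam k * h" using lam_pos[of k] sh by simp
    ultimately show ?thesis by linarith
  qed
  finally show "measure (P i) D \<le> measure (P i) A * (lam k * h)" by (simp add: mult_left_mono)
qed

text \<open>For a fixed mesh the events \<open>A n l k\<close> are disjoint and force a departure
  from \<open>i\<close>, so their probabilities add up to at most \<open>lam i * h\<close>; passing
  to \<open>D n l k\<close> costs a further factor of at most \<open>L * h\<close>. The resulting
  bound does not depend on \<open>n\<close>.\<close>

lemma double_jump_bound:
  assumes h: "0 < h"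
  shows "\<exists>B\<in>sets (P i). measure (P i) B \<le> (\<Sum>k\<in>UNIV. lam k) * lam i * h\<^sup>2 \<and>
    (\<forall>w\<in>space (P i). J 0 w = i \<longrightarrow> w \<notin> B \<longrightarrow> single_jump (\<lambda>t. J t w) i h)"
proof -
  interpret i: prob_space "P i" by (rule prob_space_P)
  define L where "L = (\<Sum>k\<in>UNIV. lam k)"
  have Lk: "lam k \<le> L" for k unfolding L_def using lam_pos by (intro member_le_sum) (auto intro: less_imp_le)
  define A where "A n l k = {w\<in>space (P i). (\<forall>m\<le>l. J (real m * h / real (Suc n)) w = i) \<and> J (real (Suc l) * h / real (Suc n)) w = k}" for n l k
  define D where "D n l k = {w\<in>space (P i). ((\<forall>m\<le>l. J (real m * h / real (Suc n)) w = i) \<and> J (real (Suc l) * h / real (Suc n)) w = k)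
    \<and> \<not> (\<forall>t\<in>{real (Suc l) * h / real (Suc n)..h}. J t w = k)}" for n l k
  note AD = grid_double_jump_event[OF h, where i=i, folded A_def D_def]
  define K where "K n = {..n} \<times> (UNIV - {i})" for n :: nat
  have finK: "finite (K n)" for n by (simp add: K_def)
  define E where "E n = (\<Union>(l, k)\<in>K n. D n l k)" for n
  have E: "E n \<in> sets (P i)" for n
    unfolding E_def using AD(2) by (intro sets.finite_UN finK) (auto simp: K_def)
  have bound: "measure (P i) (E n) \<le> L * lam i * h\<^sup>2" for n
  proof -
    have "measure (P i) (E n) \<le> (\<Sum>(l, k)\<in>K n. measure (P i) (D n l k))"
      unfolding E_def split_def using AD(2) by (intro i.finite_measure_subadditive_finite finK) (auto simp: K_def)
    also have "\<dots> \<le> (\<Sum>(l, k)\<in>K n. measure (P i) (A n l k) * (L * h))"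
    proof (rule sum_mono, clarify)
      fix l k assume "(l, k) \<in> K n"
      then have "measure (P i) (D n l k) \<le> measure (P i) (A n l k) * (lam k * h)" by (intro AD(3)) (auto simp: K_def)
      also have "\<dots> \<le> measure (P i) (A n l k) * (L * h)" using Lk h by (intro mult_left_mono mult_right_mono) auto
      finally show "measure (P i) (D n l k) \<le> measure (P i) (A n l k) * (L * h)" .
    qed
    also have "\<dots> = (\<Sum>(l, k)\<in>K n. measure (P i) (A n l k)) * (L * h)" by (simp add: sum_distrib_right split_def)
    also have "(\<Sum>(l, k)\<in>K n. measure (P i) (A n l k)) = measure (P i) (\<Union>(l, k)\<in>K n. A n l k)"
      unfolding split_def
    proof (rule i.finite_measure_finite_Union[symmetric, OF finK])
      show "(\<lambda>a. A n (fst a) (snd a)) ` K n \<subseteq> sets (P i)" using AD(1) by (auto simp: K_def)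
      show "disjoint_family_on (\<lambda>a. A n (fst a) (snd a)) (K n)"
        unfolding disjoint_family_on_def
      proof (intro ballI impI)
        fix a a' assume a: "a \<in> K n" "a' \<in> K n" "a \<noteq> a'"
        show "A n (fst a) (snd a) \<inter> A n (fst a') (snd a') = {}"
        proof (rule ccontr)
          assume "A n (fst a) (snd a) \<inter> A n (fst a') (snd a') \<noteq> {}"
          then obtain w where w: "w \<in> A n (fst a) (snd a)" "w \<in> A n (fst a') (snd a')" by blast
          have "snd a \<noteq> i" "snd a' \<noteq> i" using a by (auto simp: K_def)
          \<comment> \<open>If one exit index were smaller, the event with the larger index would
            force the state \<open>i\<close> at the other's exit point.\<close>
          then have "\<not> Suc (fst a) \<le> fst a'" "\<not> Suc (fst a') \<le> fst a" using w unfolding A_def by (metis (mono_tags, lifting) mem_Collect_eq)+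
          then have "fst a = fst a'" by simp
          then show False using w a(3) by (auto simp: A_def prod_eq_iff)
        qed
      qed
    qed
    also have "\<dots> \<le> measure (P i) (space (P i) - {w\<in>space (P i). \<forall>s\<in>{0..h}. J s w = i})"
    proof (rule i.finite_measure_mono)
      show "(\<Union>(l, k)\<in>K n. A n l k) \<subseteq> space (P i) - {w\<in>space (P i). \<forall>s\<in>{0..h}. J s w = i}"
      proof clarify
        fix w l k assume lk: "(l, k) \<in> K n" and w: "w \<in> A n l k"
        have "real (Suc l) * h \<le> real (Suc n) * h" using lk h by (intro mult_right_mono) (auto simp: K_def)
        then have "real (Suc l) * h / real (Suc n) \<in> {0..h}" using h by (auto simp: field_simps)
        then show "w \<in> space (P i) - {w\<in>space (P i). \<forall>s\<in>{0..h}. J s w = i}" using lk w by (auto simp: A_def K_def)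
      qed
    qed (use sets_J_constant[of h] h in auto)
    also have "\<dots> = 1 - exp (- lam i * h)"
      using i.prob_compl[OF sets_J_constant[of h]] J_remain[of h i] h by simp
    also have "\<dots> \<le> lam i * h" using exp_ge_add_one_self[of "- lam i * h"] by simp
    finally show ?thesis
      using order_trans[OF lam_pos[THEN less_imp_le] Lk] h by (auto simp: power2_eq_square mult_ac mult_right_mono mult_left_mono)
  qed
  \<comment> \<open>A path starting in \<open>i\<close> that violates \<open>single_jump\<close>
    lies in \<open>E n\<close> for all large \<open>n\<close>, so the exceptional set is a liminf;
    its probability inherits the uniform bound as the limit along an increasing union.\<close>
  define B where "B = (\<Union>N. \<Inter>n\<in>{N..}. E n)"
  have inter: "(\<Inter>n\<in>{N..}. E n) \<in> sets (P i)" for N using E by (intro sets.countable_INT) auto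
  then have B: "B \<in> sets (P i)" unfolding B_def by auto
  have "incseq (\<lambda>N. \<Inter>n\<in>{N..}. E n)" by (auto simp: incseq_def)
  then have "(\<lambda>N. measure (P i) (\<Inter>n\<in>{N..}. E n)) \<longlonglongrightarrow> measure (P i) B"
    unfolding B_def using inter by (intro i.finite_Lim_measure_incseq) auto
  then have "measure (P i) B \<le> L * lam i * h\<^sup>2"
  proof (rule LIMSEQ_le_const2, intro exI allI impI)
    fix N :: nat
    have "measure (P i) (\<Inter>n\<in>{N..}. E n) \<le> measure (P i) (E N)" using E by (intro i.finite_measure_mono) auto
    also have "\<dots> \<le> L * lam i * h\<^sup>2" by (rule bound)
    finally show "measure (P i) (\<Inter>n\<in>{N..}. E n) \<le> L * lam i * h\<^sup>2" .
  qed
  moreover have "single_jump (\<lambda>t. J t w) i h" if w: "w \<in> space (P i)" "J 0 w = i" "w \<notin> B" for w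
  proof (rule ccontr)
    assume "\<not> single_jump (\<lambda>t. J t w) i h"
    from not_single_jump_grid[OF step_path_J[OF w(1)] w(2) h this]
    obtain N where N: "\<And>n. n \<ge> N \<Longrightarrow> \<exists>l\<le>n. \<exists>k. k \<noteq> i \<and> (\<forall>m\<le>l. J (real m * h / real (Suc n)) w = i) \<and>
      J (real (Suc l) * h / real (Suc n)) w = k \<and> \<not> (\<forall>s\<in>{real (Suc l) * h / real (Suc n)..h}. J s w = k)" by blast
    have "w \<in> E n" if n: "n \<ge> N" for n
    proof -
      obtain l k where "l \<le> n" "k \<noteq> i" "w \<in> D n l k" using N[OF n] w(1) unfolding D_def by blast
      then show ?thesis unfolding E_def K_def by blast
    qed
    then have "w \<in> B" unfolding B_def by auto
    with w(3) show False by simp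
  qed
  ultimately show ?thesis using B unfolding L_def by blast
qed

section \<open>Transition probabilities to first order in the step\<close>

definition transition :: "'s \<Rightarrow> 's \<Rightarrow> real \<Rightarrow> real" where
  "transition i j h = \<P>(w in P i. J h w = j)"

lemma transition_sum:
  assumes "0 \<le> h" shows "(\<Sum>j\<in>UNIV. transition i j h) = 1"
proof -
  interpret i: prob_space "P i" by (rule prob_space_P)
  have "(\<Sum>j\<in>UNIV. transition i j h) = measure (P i) (\<Union>j\<in>UNIV. {w\<in>space (P i). J h w = j})"
    unfolding transition_def using assms
    by (intro i.finite_measure_finite_Union[symmetric]) (auto simp: disjoint_family_on_def intro!: J_event)
  also have "(\<Union>j\<in>UNIV. {w\<in>space (P i). J h w = j}) = space (P i)" by auto
  finally show ?thesis by (simp add: i.prob_space)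
qed

lemma transition_smallo: "i \<noteq> j \<Longrightarrow> (\<lambda>h. transition i j h - lam i * p i j * h) \<in> o[at_right 0](\<lambda>h. h)"
  unfolding transition_def by (rule J_pass)

text \<open>Staying is the complement of finitely many passages to other states, whose rates
  \<open>lam i * p i j\<close> sum to \<open>lam i\<close> because \<open>p i i = 0\<close>.\<close>

lemma transition_stay_smallo: "(\<lambda>h. transition i i h - (1 - lam i * h)) \<in> o[at_right 0](\<lambda>h. h)"
proof -
  have "(\<lambda>h. \<Sum>j\<in>UNIV - {i}. transition i j h - lam i * p i j * h) \<in> o[at_right 0](\<lambda>h. h)"
    by (rule big_sum_in_smallo) (auto intro: transition_smallo)
  then have "(\<lambda>h. - (\<Sum>j\<in>UNIV - {i}. transition i j h - lam i * p i j * h)) \<in> o[at_right 0](\<lambda>h. h)" by simp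
  moreover have "\<forall>\<^sub>F h in at_right 0. - (\<Sum>j\<in>UNIV - {i}. transition i j h - lam i * p i j * h) = transition i i h - (1 - lam i * h)"
  proof -
    have "- (\<Sum>j\<in>UNIV - {i}. transition i j h - lam i * p i j * h) = transition i i h - (1 - lam i * h)" if "0 < h" for h
    proof -
      have "(\<Sum>j\<in>UNIV - {i}. transition i j h) = 1 - transition i i h"
        using transition_sum[of h i] that by (simp add: sum_diff1)
      moreover have "(\<Sum>j\<in>UNIV - {i}. lam i * p i j * h) = lam i * h"
      proof -
        have "(\<Sum>j\<in>UNIV - {i}. p i j) = 1" using p_sum[of i] p_diag[of i] by (simp add: sum_diff1)
        then have "lam i * h * (\<Sum>j\<in>UNIV - {i}. p i j) = lam i * h" by simp
        then show ?thesis by (simp add: sum_distrib_left mult_ac)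
      qed
      ultimately show ?thesis by (simp add: sum_subtractf)
    qed
    then show ?thesis by (auto simp: eventually_at_right_field intro!: exI[of _ 1])
  qed
  ultimately show ?thesis by (rule landau_o.small.in_cong[THEN iffD1, rotated])
qed

end

section \<open>The law of the configuration\<close>

context markov_environment_risk_process
begin

sublocale growth_flow c U
  by unfold_locales (rule c_nonneg, erule U_solution, erule U_unique)

text \<open>The Stieltjes measure of the integral equation; it is identified below with the law of
  every \<open>Z j n\<close> under every \<open>P i\<close>.\<close>

definition claim_law :: "'s \<Rightarrow> real measure" where
  "claim_law j = interval_measure (F j)"

lemma real_distribution_Z: "real_distribution (distr (P i) borel (Z j n))"
proof -
  interpret prob_space "P i" by (rule prob_space_P)
  show ?thesis by (rule real_distribution_distr[OF claim_measurable])
qed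

text \<open>Both measures have the distribution function \<open>F j\<close>. Since the left side
  mentions neither \<open>i\<close> nor \<open>n\<close>, the claim flows have one and the same law
  for all initial states.\<close>

lemma claim_law_eq_distr: "claim_law j = distr (P i) borel (Z j n)"
proof -
  interpret D: real_distribution "distr (P i) borel (Z j n)" by (rule real_distribution_Z)
  note Fj = claim_distribution[of i j n]
  have F: "\<And>x y. x \<le> y \<Longrightarrow> F j x \<le> F j y" "\<And>a. continuous (at_right a) (F j)"
    "(F j \<longlongrightarrow> 0) at_bot" "(F j \<longlongrightarrow> 1) at_top"
    using D.cdf_nondecreasing D.cdf_is_right_cont D.cdf_lim_at_bot D.cdf_lim_at_top_prob by (simp_all add: Fj)
  show ?thesis
  proof (rule cdf_unique[OF _ real_distribution_Z])
    show "real_distribution (claim_law j)"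
      unfolding claim_law_def by (rule real_distribution_interval_measure[OF F])
    show "cdf (claim_law j) = cdf (distr (P i) borel (Z j n))"
      unfolding claim_law_def Fj using measure_interval_measure_Iic[OF F(1,2,3)] by (simp add: cdf_def fun_eq_iff)
  qed
qed

lemma real_distribution_claim_law: "real_distribution (claim_law j)"
  using real_distribution_Z[of j j 0] claim_law_eq_distr[of j j 0] by simp

lemma marked_flow_claims: "marked_flow (\<alpha> j) (claim_law j)"
  by (rule marked_flow.intro[OF \<alpha>_pos real_distribution_claim_law])

lemmas prob_space_exponential_law = marked_flow.prob_space_exponential_law[OF marked_flow_claims]
lemmas sets_exponential_law = marked_flow.sets_exponential_law[OF marked_flow_claims]
lemmas prob_space_flow_law = marked_flow.prob_space_flow_law[OF marked_flow_claims]
lemmas sets_flow_law = marked_flow.sets_flow_law[OF marked_flow_claims]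
lemmas space_flow_law = marked_flow.space_flow_law[OF marked_flow_claims]

lemma prob_space_claim_law: "prob_space (claim_law j)"
  using real_distribution_claim_law by (rule real_distribution.axioms(1))

lemma sets_claim_law[simp]: "sets (claim_law j) = sets borel" by (simp add: claim_law_def)

lemma source_events_sigma_sets:
  "\<exists>G. source_events (P i) J T Z s = sigma_sets (space (P i)) G \<and> G \<subseteq> Pow (space (P i))"
proof (cases s)
  case Environment
  then show ?thesis by (intro exI[of _ "{J t -` B \<inter> space (P i) | t B. 0 \<le> t}"]) auto
next
  case (Arrivals j)
  then show ?thesis by (intro exI[of _ "{T j n -` B \<inter> space (P i) | n B. B \<in> sets borel}"]) auto
next
  case (Claim_Size j n)
  then show ?thesis by (intro exI[of _ "{Z j n -` B \<inter> space (P i) | B. B \<in> sets borel}"]) auto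
qed

lemma Int_stable_source_events: "Int_stable (source_events (P i) J T Z s)"
proof -
  obtain G where G: "source_events (P i) J T Z s = sigma_sets (space (P i)) G" "G \<subseteq> Pow (space (P i))"
    using source_events_sigma_sets by blast
  interpret sigma_algebra "space (P i)" "sigma_sets (space (P i)) G" by (rule sigma_algebra_sigma_sets[OF G(2)])
  show ?thesis unfolding G(1) by (auto simp: Int_stable_def)
qed

text \<open>The information carried by a group of sources, packed as a measurable space, so that
  membership of an event in the independent sigma-algebras follows from ordinary measurability
  lemmas.\<close>

definition source_space :: "'s \<Rightarrow> 's source set \<Rightarrow> 'w measure" where
  "source_space i S = sigma (space (P i)) (\<Union>s\<in>S. source_events (P i) J T Z s)"

lemma source_events_Pow: "(\<Union>s\<in>S. source_events (P i) J T Z s) \<subseteq> Pow (space (P i))"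
proof safe
  fix s A w assume "A \<in> source_events (P i) J T Z s" "w \<in> A"
  moreover obtain G where "source_events (P i) J T Z s = sigma_sets (space (P i)) G" "G \<subseteq> Pow (space (P i))"
    using source_events_sigma_sets by blast
  ultimately show "w \<in> space (P i)" using sigma_sets_into_sp by blast
qed

lemma space_source_space[simp]: "space (source_space i S) = space (P i)"
  unfolding source_space_def by (rule space_measure_of[OF source_events_Pow])

lemma sets_source_space: "sets (source_space i S) = sigma_sets (space (P i)) (\<Union>s\<in>S. source_events (P i) J T Z s)"
  unfolding source_space_def by (rule sets_measure_of[OF source_events_Pow])

lemma source_events_in_source_space:
  "s \<in> S \<Longrightarrow> A \<in> source_events (P i) J T Z s \<Longrightarrow> A \<in> sets (source_space i S)"
  unfolding sets_source_space by (rule sigma_sets.Basic) auto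

lemma sets_source_space_single: "sets (source_space i {s}) = source_events (P i) J T Z s"
proof -
  obtain G where G: "source_events (P i) J T Z s = sigma_sets (space (P i)) G" "G \<subseteq> Pow (space (P i))"
    using source_events_sigma_sets by blast
  show ?thesis unfolding sets_source_space by (simp add: G sigma_sets_sigma_sets_eq)
qed

lemma measurable_env_path_source: "Environment \<in> S \<Longrightarrow> env_path \<in> measurable (source_space i S) path_space"
proof (rule measurable_into_path_space)
  fix t :: real assume S: "Environment \<in> S" and t: "0 \<le> t"
  show "(\<lambda>w. env_path w t) \<in> measurable (source_space i S) (count_space UNIV)"
  proof (rule measurableI)
    fix B :: "'s set"
    have "J t -` B \<inter> space (P i) \<in> source_events (P i) J T Z Environment"
      using t by (auto intro!: sigma_sets.Basic)
    then show "(\<lambda>w. env_path w t) -` B \<inter> space (source_space i S) \<in> sets (source_space i S)"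
      using source_events_in_source_space[OF S] t by (simp add: env_path_apply vimage_def)
  qed simp
qed (use step_path_env_path in \<open>auto simp: env_path_def\<close>)

lemma measurable_T_source: "Arrivals j \<in> S \<Longrightarrow> T j n \<in> borel_measurable (source_space i S)"
proof (rule measurableI)
  fix B :: "real set" assume S: "Arrivals j \<in> S" and "B \<in> sets borel"
  then have "T j n -` B \<inter> space (P i) \<in> source_events (P i) J T Z (Arrivals j)" by (auto intro!: sigma_sets.Basic)
  then show "T j n -` B \<inter> space (source_space i S) \<in> sets (source_space i S)"
    using source_events_in_source_space[OF S] by simp
qed simp

lemma measurable_interarrival_source: "Arrivals j \<in> S \<Longrightarrow> interarrival (T j) n \<in> borel_measurable (source_space i S)"
  unfolding interarrival_def[abs_def] using measurable_T_source[of j S]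
  by (cases "n = 0") (auto intro!: borel_measurable_diff)

lemma measurable_Z_source: "Claim_Size j n \<in> S \<Longrightarrow> Z j n \<in> borel_measurable (source_space i S)"
proof (rule measurableI)
  fix B :: "real set" assume S: "Claim_Size j n \<in> S" and "B \<in> sets borel"
  then have "Z j n -` B \<inter> space (P i) \<in> source_events (P i) J T Z (Claim_Size j n)" by (auto intro!: sigma_sets.Basic)
  then show "Z j n -` B \<inter> space (source_space i S) \<in> sets (source_space i S)"
    using source_events_in_source_space[OF S] by simp
qed simp

definition mark :: "'s \<Rightarrow> nat \<Rightarrow> 'w \<Rightarrow> real \<times> real" where
  "mark j k w = (interarrival (T j) k w, Z j k w)"

definition marks :: "'w \<Rightarrow> 's \<Rightarrow> nat \<Rightarrow> real \<times> real" where
  "marks w j k = mark j k w"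

definition flow_sources :: "'s \<Rightarrow> 's source set" where
  "flow_sources j = insert (Arrivals j) (range (Claim_Size j))"

lemma measurable_mark_source:
  assumes "Arrivals j \<in> S" "Claim_Size j k \<in> S"
  shows "mark j k \<in> measurable (source_space i S) (borel \<Otimes>\<^sub>M borel)"
  unfolding mark_def[abs_def]
  using measurable_interarrival_source[OF assms(1)] measurable_Z_source[OF assms(2)] by (intro measurable_Pair)

lemma measurable_marks_source: "(\<lambda>w. marks w j) \<in> measurable (source_space i (flow_sources j)) flow_space"
  unfolding flow_space_def
proof (rule measurable_PiM_single')
  show "(\<lambda>w. marks w j k) \<in> measurable (source_space i (flow_sources j)) (borel \<Otimes>\<^sub>M borel)" for k
    unfolding marks_def by (rule measurable_mark_source) (auto simp: flow_sources_def)
qed (auto simp: space_pair_measure)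

lemma source_space_sub: "sets (source_space i S) \<subseteq> sets (P i)"
proof -
  interpret prob_space "P i" by (rule prob_space_P)
  have "source_events (P i) J T Z s \<subseteq> sets (P i)" for s
    using independence[of i] unfolding indep_sets_def by auto
  then show ?thesis unfolding sets_source_space by (intro sets.sigma_sets_subset) blast
qed

lemma measurable_source_sub: "f \<in> measurable (source_space i S) N \<Longrightarrow> f \<in> measurable (P i) N"
  using source_space_sub[of i S] by (auto simp: measurable_def)

lemma measurable_interarrival: "interarrival (T j) k \<in> borel_measurable (P i)"
  by (rule measurable_source_sub[OF measurable_interarrival_source[of j UNIV]]) simp

lemma measurable_marks: "(\<lambda>w. marks w j) \<in> measurable (P i) flow_space"
  by (rule measurable_source_sub[OF measurable_marks_source])

lemma measurable_mark: "mark j k \<in> measurable (P i) (borel \<Otimes>\<^sub>M borel)"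
  by (rule measurable_source_sub[OF measurable_mark_source[of _ UNIV]]) auto

lemma distr_interarrival: "distr (P i) borel (interarrival (T j) k) = exponential_law (\<alpha> j)"
proof -
  have "distributed (P i) lborel (interarrival (T j) k) (exponential_density (\<alpha> j))"
    using arrivals[of i j] by (simp add: poisson_flow_def)
  then have "distr (P i) lborel (interarrival (T j) k) = exponential_law (\<alpha> j)"
    unfolding exponential_law_def by (rule distributed_distr_eq_density)
  then show ?thesis by (simp add: distr_cong[of "P i" "P i" lborel borel, symmetric])
qed

lemma prob_interarrivals:
  assumes K: "finite K" and A: "\<And>k. k \<in> K \<Longrightarrow> A k \<in> sets borel"
  shows "\<P>(w in P i. \<forall>k\<in>K. interarrival (T j) k w \<in> A k) = (\<Prod>k\<in>K. \<P>(w in P i. interarrival (T j) k w \<in> A k))"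
proof (cases "K = {}")
  case False
  interpret prob_space "P i" by (rule prob_space_P)
  have "indep_vars (\<lambda>_. borel) (interarrival (T j)) UNIV"
    using arrivals[of i j] by (simp add: poisson_flow_def)
  from indep_varsD[OF this False K] A
  have "prob (\<Inter>k\<in>K. interarrival (T j) k -` A k \<inter> space (P i)) = (\<Prod>k\<in>K. prob (interarrival (T j) k -` A k \<inter> space (P i)))"
    by auto
  moreover have "(\<Inter>k\<in>K. interarrival (T j) k -` A k \<inter> space (P i)) = {w\<in>space (P i). \<forall>k\<in>K. interarrival (T j) k w \<in> A k}"
    using False by auto
  moreover have "interarrival (T j) k -` A k \<inter> space (P i) = {w\<in>space (P i). interarrival (T j) k w \<in> A k}" for k by auto
  ultimately show ?thesis by simp
next
  case True
  interpret prob_space "P i" by (rule prob_space_P)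
  show ?thesis by (simp add: True prob_space)
qed

text \<open>Two kinds of independence are combined: \<open>independence\<close> separates the claim
  sizes from one another and from the arrival flow, and \<open>prob_interarrivals\<close> factors
  the interarrival times within that flow.\<close>

lemma prob_marks_rectangle:
  assumes K: "finite K" and A: "\<And>k. k \<in> K \<Longrightarrow> A k \<in> sets borel" and B: "\<And>k. k \<in> K \<Longrightarrow> B k \<in> sets borel"
  shows "\<P>(w in P i. \<forall>k\<in>K. interarrival (T j) k w \<in> A k \<and> Z j k w \<in> B k) =
    (\<Prod>k\<in>K. \<P>(w in P i. interarrival (T j) k w \<in> A k) * \<P>(w in P i. Z j k w \<in> B k))"
proof -
  interpret prob_space "P i" by (rule prob_space_P)
  define S where "S = insert (Arrivals j) (Claim_Size j ` K)"
  define E where "E s = (case s of Claim_Size _ k \<Rightarrow> {w\<in>space (P i). Z j k w \<in> B k} |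
     _ \<Rightarrow> {w\<in>space (P i). \<forall>k\<in>K. interarrival (T j) k w \<in> A k})" for s :: "'s source"
  have "prob (\<Inter>s\<in>S. E s) = (\<Prod>s\<in>S. prob (E s))"
  proof (rule indep_setsD[OF independence])
    show "\<forall>s\<in>S. E s \<in> source_events (P i) J T Z s"
    proof
      fix s assume "s \<in> S"
      then consider "s = Arrivals j" | k where "k \<in> K" "s = Claim_Size j k" by (auto simp: S_def)
      then show "E s \<in> source_events (P i) J T Z s"
      proof cases
        case 1
        have "{w\<in>space (source_space i {s}). \<forall>k\<in>K. interarrival (T j) k w \<in> A k} \<in> sets (source_space i {s})"
        proof (rule sets.sets_Collect_finite_All[OF _ K])
          fix k assume "k \<in> K"
          then show "{w\<in>space (source_space i {s}). interarrival (T j) k w \<in> A k} \<in> sets (source_space i {s})"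
            using measurable_sets[OF measurable_interarrival_source[of j "{s}" k i] A] 1
            by (simp add: vimage_def Int_def conj_commute)
        qed
        then show ?thesis by (simp add: sets_source_space_single E_def 1 del: source_events.simps)
      next
        case 2
        have "Z j k -` B k \<inter> space (source_space i {s}) \<in> sets (source_space i {s})"
          using 2 B by (intro measurable_sets[OF measurable_Z_source]) auto
        then show ?thesis
          by (simp add: sets_source_space_single E_def 2 vimage_def Int_def conj_commute del: source_events.simps)
      qed
    qed
  qed (use K in \<open>auto simp: S_def\<close>)
  moreover have "(\<Inter>s\<in>S. E s) = {w\<in>space (P i). \<forall>k\<in>K. interarrival (T j) k w \<in> A k \<and> Z j k w \<in> B k}"
    by (auto simp: S_def E_def)
  moreover have "(\<Prod>s\<in>S. prob (E s)) = \<P>(w in P i. \<forall>k\<in>K. interarrival (T j) k w \<in> A k) * (\<Prod>k\<in>K. \<P>(w in P i. Z j k w \<in> B k))"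
    unfolding S_def using K
    by (subst prod.insert) (auto simp: E_def prod.reindex inj_on_def)
  ultimately show ?thesis using prob_interarrivals[OF K A] by (simp add: prod.distrib)
qed

lemma distr_mark: "distr (P i) (borel \<Otimes>\<^sub>M borel) (mark j k) = exponential_law (\<alpha> j) \<Otimes>\<^sub>M claim_law j"
proof (rule pair_measure_eqI[symmetric])
  interpret prob_space "P i" by (rule prob_space_P)
  show "sigma_finite_measure (exponential_law (\<alpha> j))" "sigma_finite_measure (claim_law j)"
    by (rule prob_space_imp_sigma_finite, rule prob_space_exponential_law)
      (rule prob_space_imp_sigma_finite, rule prob_space_claim_law)
  show "sets (exponential_law (\<alpha> j) \<Otimes>\<^sub>M claim_law j) = sets (distr (P i) (borel \<Otimes>\<^sub>M borel) (mark j k))"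
    by (simp add: sets_exponential_law cong: sets_pair_measure_cong)
  fix A B assume A: "A \<in> sets (exponential_law (\<alpha> j))" and B: "B \<in> sets (claim_law j)"
  then have AB: "A \<in> sets borel" "B \<in> sets borel" by (auto simp: sets_exponential_law)
  have "emeasure (distr (P i) (borel \<Otimes>\<^sub>M borel) (mark j k)) (A \<times> B) = emeasure (P i) (mark j k -` (A \<times> B) \<inter> space (P i))"
    using AB by (intro emeasure_distr measurable_mark) auto
  also have "mark j k -` (A \<times> B) \<inter> space (P i) = {w\<in>space (P i). \<forall>l\<in>{k}. interarrival (T j) l w \<in> A \<and> Z j l w \<in> B}"
    by (auto simp: mark_def)
  also have "emeasure (P i) \<dots> = ennreal (\<P>(w in P i. interarrival (T j) k w \<in> A) * \<P>(w in P i. Z j k w \<in> B))"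
    unfolding emeasure_eq_measure using AB by (subst prob_marks_rectangle[of "{k}" "\<lambda>_. A" "\<lambda>_. B"]) auto
  also have "\<dots> = emeasure (P i) (interarrival (T j) k -` A \<inter> space (P i)) * emeasure (P i) (Z j k -` B \<inter> space (P i))"
    by (simp add: emeasure_eq_measure ennreal_mult vimage_def Int_def conj_commute)
  also have "\<dots> = emeasure (exponential_law (\<alpha> j)) A * emeasure (claim_law j) B"
    using AB by (simp add: distr_interarrival[of i j k, symmetric] claim_law_eq_distr[of j i k]
      emeasure_distr measurable_interarrival claim_measurable)
  finally show "emeasure (exponential_law (\<alpha> j)) A * emeasure (claim_law j) B =
    emeasure (distr (P i) (borel \<Otimes>\<^sub>M borel) (mark j k)) (A \<times> B)" by simp
qed

text \<open>Rectangles in interarrival time and claim size form an intersection-stable family, so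
  their independence passes to the generated sigma-algebras, and \<open>mark j k\<close> is
  measurable with respect to the one generated by \<open>G k\<close>.\<close>

lemma indep_marks: "prob_space.indep_vars (P i) (\<lambda>_. borel \<Otimes>\<^sub>M borel) (mark j) UNIV"
proof -
  interpret prob_space "P i" by (rule prob_space_P)
  define G where "G k = {{w\<in>space (P i). interarrival (T j) k w \<in> A \<and> Z j k w \<in> B} | A B. A \<in> sets borel \<and> B \<in> sets borel}" for k
  have ev: "{w\<in>space (P i). interarrival (T j) k w \<in> A \<and> Z j k w \<in> B} \<in> sets (P i)"
    if "A \<in> sets borel" "B \<in> sets borel" for A B k
    using that measurable_interarrival[of j k i, measurable] claim_measurable[of j k i, measurable] by measurable
  have GI: "{w\<in>space (P i). interarrival (T j) k w \<in> A \<and> Z j k w \<in> B} \<in> G k"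
    if "A \<in> sets borel" "B \<in> sets borel" for A B k
    unfolding G_def by (rule CollectI, rule exI[of _ A], rule exI[of _ B]) (use that in simp)
  have G: "indep_sets G UNIV"
  proof (rule indep_setsI)
    show "G k \<subseteq> sets (P i)" for k using ev by (auto simp: G_def)
    fix E K assume K: "K \<noteq> {}" "finite K" and E: "\<forall>k\<in>K. E k \<in> G k"
    have "\<forall>k\<in>K. \<exists>A B. E k = {w\<in>space (P i). interarrival (T j) k w \<in> A \<and> Z j k w \<in> B} \<and> A \<in> sets borel \<and> B \<in> sets borel"
      using E by (auto simp: G_def)
    then obtain A B where "\<forall>k\<in>K. E k = {w\<in>space (P i). interarrival (T j) k w \<in> A k \<and> Z j k w \<in> B k} \<and> A k \<in> sets borel \<and> B k \<in> sets borel"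
      by (elim bchoice[THEN exE])
    then have AB: "\<And>k. k \<in> K \<Longrightarrow> E k = {w\<in>space (P i). interarrival (T j) k w \<in> A k \<and> Z j k w \<in> B k}"
      "\<And>k. k \<in> K \<Longrightarrow> A k \<in> sets borel" "\<And>k. k \<in> K \<Longrightarrow> B k \<in> sets borel"
      by blast+
    have "(\<Inter>k\<in>K. E k) = {w\<in>space (P i). \<forall>k\<in>K. interarrival (T j) k w \<in> A k \<and> Z j k w \<in> B k}"
      using K(1) AB(1) by auto
    then have "prob (\<Inter>k\<in>K. E k) = (\<Prod>k\<in>K. \<P>(w in P i. interarrival (T j) k w \<in> A k) * \<P>(w in P i. Z j k w \<in> B k))"
      using prob_marks_rectangle[OF K(2) AB(2,3)] by simp
    also have "\<dots> = (\<Prod>k\<in>K. prob (E k))"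
    proof (rule prod.cong)
      fix k assume k: "k \<in> K"
      show "\<P>(w in P i. interarrival (T j) k w \<in> A k) * \<P>(w in P i. Z j k w \<in> B k) = prob (E k)"
        using prob_marks_rectangle[of "{k}" A B i j] AB k by simp
    qed simp
    finally show "prob (\<Inter>k\<in>K. E k) = (\<Prod>k\<in>K. prob (E k))" .
  qed
  have "Int_stable (G k)" for k
    unfolding Int_stable_def G_def
  proof clarify
    fix A B A' B' :: "real set" assume "A \<in> sets borel" "B \<in> sets borel" "A' \<in> sets borel" "B' \<in> sets borel"
    then show "\<exists>C D. {w\<in>space (P i). interarrival (T j) k w \<in> A \<and> Z j k w \<in> B} \<inter> {w\<in>space (P i). interarrival (T j) k w \<in> A' \<and> Z j k w \<in> B'} =
      {w\<in>space (P i). interarrival (T j) k w \<in> C \<and> Z j k w \<in> D} \<and> C \<in> sets borel \<and> D \<in> sets borel"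
      by (intro exI[of _ "A \<inter> A'"] exI[of _ "B \<inter> B'"]) auto
  qed
  from indep_sets_sigma[OF G this]
  have ind: "indep_sets (\<lambda>k. sigma_sets (space (P i)) (G k)) UNIV" .
  show ?thesis unfolding indep_vars_def2
  proof (intro conjI ballI measurable_mark, rule indep_sets_mono_sets[OF ind])
    fix k
    let ?N = "sigma (space (P i)) (G k)"
    have Gp: "G k \<subseteq> Pow (space (P i))" by (auto simp: G_def)
    have N: "interarrival (T j) k \<in> borel_measurable ?N" "Z j k \<in> borel_measurable ?N"
    proof -
      show "interarrival (T j) k \<in> borel_measurable ?N"
      proof (rule measurableI)
        fix A :: "real set" assume A: "A \<in> sets borel"
        have "interarrival (T j) k -` A \<inter> space (P i) = {w\<in>space (P i). interarrival (T j) k w \<in> A \<and> Z j k w \<in> UNIV}" by auto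
        moreover have "\<dots> \<in> G k" by (rule GI) (simp_all add: A)
        ultimately have "interarrival (T j) k -` A \<inter> space (P i) \<in> G k" by (simp only:)
        then show "interarrival (T j) k -` A \<inter> space ?N \<in> sets ?N" using Gp by (simp add: sigma_sets.Basic)
      qed simp
      show "Z j k \<in> borel_measurable ?N"
      proof (rule measurableI)
        fix A :: "real set" assume A: "A \<in> sets borel"
        have "Z j k -` A \<inter> space (P i) = {w\<in>space (P i). interarrival (T j) k w \<in> UNIV \<and> Z j k w \<in> A}" by auto
        moreover have "\<dots> \<in> G k" by (rule GI) (simp_all add: A)
        ultimately have "Z j k -` A \<inter> space (P i) \<in> G k" by (simp only:)
        then show "Z j k -` A \<inter> space ?N \<in> sets ?N" using Gp by (simp add: sigma_sets.Basic)
      qed simp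
    qed
    have "mark j k \<in> measurable ?N (borel \<Otimes>\<^sub>M borel)" unfolding mark_def[abs_def] by (intro measurable_Pair N)
    then show "{mark j k -` A \<inter> space (P i) |A. A \<in> sets (borel \<Otimes>\<^sub>M borel)} \<subseteq> sigma_sets (space (P i)) (G k)"
      using Gp measurable_sets[of "mark j k" ?N] by auto
  qed
qed

lemma distr_marks: "distr (P i) flow_space (\<lambda>w. marks w j) = flow_law (\<alpha> j) (claim_law j)"
proof -
  interpret prob_space "P i" by (rule prob_space_P)
  have "distr (P i) (PiM UNIV (\<lambda>_. borel \<Otimes>\<^sub>M borel)) (\<lambda>w. \<lambda>k\<in>UNIV. mark j k w) =
    PiM UNIV (\<lambda>k. distr (P i) (borel \<Otimes>\<^sub>M borel) (mark j k))"
    using indep_vars_iff_distr_eq_PiM[of UNIV "mark j" "\<lambda>_. borel \<Otimes>\<^sub>M borel"] indep_marks measurable_mark by auto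
  then show ?thesis by (simp add: flow_space_def flow_law_def distr_mark marks_def[abs_def] restrict_UNIV)
qed

section \<open>Joint law of the environment path and the flows\<close>

definition config :: "'w \<Rightarrow> (real \<Rightarrow> 's) \<times> ('s \<Rightarrow> nat \<Rightarrow> real \<times> real)" where
  "config w = (env_path w, marks w)"

text \<open>This law does not involve the initial state, which influences the environment path
  alone.\<close>

definition flows_law :: "('s \<Rightarrow> nat \<Rightarrow> real \<times> real) measure" where
  "flows_law = PiM UNIV (\<lambda>j. flow_law (\<alpha> j) (claim_law j))"

definition config_law :: "'s \<Rightarrow> ((real \<Rightarrow> 's) \<times> ('s \<Rightarrow> nat \<Rightarrow> real \<times> real)) measure" where
  "config_law i = env_law i \<Otimes>\<^sub>M flows_law"

lemma measurable_marks_all: "marks \<in> measurable (P i) (PiM UNIV (\<lambda>_. flow_space))"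
  by (rule measurable_PiM_single') (use measurable_marks in \<open>auto simp: space_flow_space\<close>)

lemma measurable_config: "config \<in> measurable (P i) config_space"
  unfolding config_def[abs_def] config_space_def
  by (intro measurable_Pair measurable_env_path measurable_marks_all)

lemma prob_space_flows_law: "prob_space flows_law"
  unfolding flows_law_def by (intro prob_space_PiM prob_space_flow_law)

lemma sets_flows_law: "sets flows_law = sets (PiM UNIV (\<lambda>_. flow_space))"
  unfolding flows_law_def by (intro sets_PiM_cong sets_flow_law refl)

text \<open>The sources are regrouped into disjoint blocks: \<open>None\<close> for the environment,
  and \<open>Some j\<close> for the arrivals and claim sizes of state \<open>j\<close>. Independent
  intersection-stable families stay independent when merged blockwise.\<close>

lemma prob_config_rectangle:
  assumes A: "A \<in> sets path_space" and K: "finite K" and B: "\<And>j. j \<in> K \<Longrightarrow> B j \<in> sets flow_space"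
  shows "\<P>(w in P i. env_path w \<in> A \<and> (\<forall>j\<in>K. marks w j \<in> B j)) =
    \<P>(w in P i. env_path w \<in> A) * (\<Prod>j\<in>K. \<P>(w in P i. marks w j \<in> B j))"
proof -
  interpret prob_space "P i" by (rule prob_space_P)
  define L where "L s = (case s of None \<Rightarrow> {Environment} | Some j \<Rightarrow> flow_sources j)" for s :: "'s option"
  have ind: "indep_sets (\<lambda>s. sigma_sets (space (P i)) (\<Union>t\<in>L s. source_events (P i) J T Z t)) UNIV"
  proof (rule indep_sets_collect_sigma)
    show "indep_sets (source_events (P i) J T Z) (\<Union>(range L))"
      by (rule indep_sets_mono_index[OF _ independence]) auto
    show "disjoint_family_on L UNIV"
      by (auto simp: disjoint_family_on_def L_def flow_sources_def split: option.splits)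
  qed (rule Int_stable_source_events)
  define S where "S = insert None (Some ` K)"
  define E where "E s = (case s of None \<Rightarrow> {w\<in>space (P i). env_path w \<in> A} | Some j \<Rightarrow> {w\<in>space (P i). marks w j \<in> B j})" for s
  have "prob (\<Inter>s\<in>S. E s) = (\<Prod>s\<in>S. prob (E s))"
  proof (rule indep_setsD[OF ind])
    show "\<forall>s\<in>S. E s \<in> sigma_sets (space (P i)) (\<Union>t\<in>L s. source_events (P i) J T Z t)"
    proof
      fix s assume "s \<in> S"
      then consider "s = None" | j where "j \<in> K" "s = Some j" by (auto simp: S_def)
      then show "E s \<in> sigma_sets (space (P i)) (\<Union>t\<in>L s. source_events (P i) J T Z t)"
        unfolding sets_source_space[symmetric]
      proof cases
        case 1
        then show "E s \<in> sets (source_space i (L s))"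
          using measurable_sets[OF measurable_env_path_source A, of "L s" i]
          by (simp add: E_def L_def vimage_def Int_def conj_commute)
      next
        case 2
        then show "E s \<in> sets (source_space i (L s))"
          using measurable_sets[OF measurable_marks_source[of j i] B[of j]]
          by (simp add: E_def L_def vimage_def Int_def conj_commute)
      qed
    qed
  qed (use K in \<open>auto simp: S_def\<close>)
  moreover have "(\<Inter>s\<in>S. E s) = {w\<in>space (P i). env_path w \<in> A \<and> (\<forall>j\<in>K. marks w j \<in> B j)}"
    by (auto simp: S_def E_def)
  moreover have "(\<Prod>s\<in>S. prob (E s)) = \<P>(w in P i. env_path w \<in> A) * (\<Prod>j\<in>K. \<P>(w in P i. marks w j \<in> B j))"
    unfolding S_def using K by (subst prod.insert) (auto simp: E_def prod.reindex inj_on_def)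
  ultimately show ?thesis by simp
qed

text \<open>For a fixed environment event \<open>C\<close> the unnormalised law of the flows agrees
  with a multiple of \<open>flows_law\<close> on cylinders, hence everywhere. This is the product
  formula on rectangles that characterises the product measure.\<close>

lemma distr_config: "distr (P i) config_space config = config_law i"
  unfolding config_law_def
proof (rule pair_measure_eqI[symmetric])
  interpret prob_space "P i" by (rule prob_space_P)
  interpret Fl: prob_space flows_law by (rule prob_space_flows_law)
  show "sigma_finite_measure (env_law i)" "sigma_finite_measure flows_law"
    by (rule prob_space_imp_sigma_finite, rule prob_space_env_law) (rule Fl.sigma_finite_measure_axioms)
  show "sets (env_law i \<Otimes>\<^sub>M flows_law) = sets (distr (P i) config_space config)"
    unfolding config_space_def by (simp add: sets_flows_law cong: sets_pair_measure_cong)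
  fix A B assume A: "A \<in> sets (env_law i)" and B: "B \<in> sets flows_law"
  let ?S = "PiM UNIV (\<lambda>_. flow_space) :: ('s \<Rightarrow> nat \<Rightarrow> real \<times> real) measure"
  define C where "C = {w\<in>space (P i). env_path w \<in> A}"
  have C: "C \<in> sets (P i)" using measurable_sets[OF measurable_env_path, of A i] A
    by (simp add: C_def vimage_def Int_def conj_commute)
  let ?M = "density (P i) (indicator C)"
  note dens = emeasure_distr_indicator[OF C measurable_marks_all[of i]]
  have eq: "distr ?M ?S marks = scale_measure (emeasure (P i) C) flows_law"
  proof (rule measure_eqI_PiM_infinite)
    fix K and D :: "'s \<Rightarrow> (nat \<Rightarrow> real \<times> real) set"
    assume K: "finite K" "K \<subseteq> UNIV" and D: "\<And>j. j \<in> K \<Longrightarrow> D j \<in> sets flow_space"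
    let ?E = "prod_emb UNIV (\<lambda>_. flow_space) K (PiE K D)"
    have E: "?E \<in> sets ?S" using K D by (intro sets_PiM_I) auto
    have mem: "y \<in> ?E \<longleftrightarrow> (\<forall>j\<in>K. y j \<in> D j)" for y
      by (auto simp: prod_emb_def PiE_iff space_flow_space)
    have "emeasure (distr ?M ?S marks) ?E = emeasure (P i) (C \<inter> (marks -` ?E \<inter> space (P i)))"
      by (rule dens[OF E])
    also have "C \<inter> (marks -` ?E \<inter> space (P i)) = {w\<in>space (P i). env_path w \<in> A \<and> (\<forall>j\<in>K. marks w j \<in> D j)}"
      using mem by (auto simp: C_def)
    also have "emeasure (P i) \<dots> = ennreal (measure (P i) C * (\<Prod>j\<in>K. \<P>(w in P i. marks w j \<in> D j)))"
      unfolding emeasure_eq_measure C_def using A K D by (subst prob_config_rectangle) auto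
    also have "\<dots> = emeasure (P i) C * (\<Prod>j\<in>K. emeasure (flow_law (\<alpha> j) (claim_law j)) (D j))"
    proof -
      have "ennreal (\<P>(w in P i. marks w j \<in> D j)) = emeasure (flow_law (\<alpha> j) (claim_law j)) (D j)" if "j \<in> K" for j
        unfolding distr_marks[of i j, symmetric] using D[OF that]
        by (subst emeasure_distr[OF measurable_marks]) (auto simp: emeasure_eq_measure vimage_def Int_def conj_commute)
      then show ?thesis by (simp add: ennreal_mult prod_nonneg emeasure_eq_measure prod_ennreal[symmetric])
    qed
    also have "(\<Prod>j\<in>K. emeasure (flow_law (\<alpha> j) (claim_law j)) (D j)) = emeasure flows_law ?E"
    proof -
      interpret PP: product_prob_space "\<lambda>j. flow_law (\<alpha> j) (claim_law j)" UNIV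
        by (intro product_prob_spaceI prob_space_flow_law)
      have "prod_emb UNIV (\<lambda>j. flow_law (\<alpha> j) (claim_law j)) K (PiE K D) = ?E"
        by (simp add: prod_emb_def space_flow_law space_flow_space)
      then show ?thesis unfolding flows_law_def
        using PP.emeasure_PiM_emb[of K D] K D by (simp add: sets_flow_law)
    qed
    finally show "emeasure (distr ?M ?S marks) ?E = emeasure (scale_measure (emeasure (P i) C) flows_law) ?E" by simp
  next
    show "finite_measure (distr ?M ?S marks)"
      by (rule finite_measure_distr_indicator[OF finite_measure_axioms C measurable_marks_all])
  qed (simp_all add: sets_flows_law)
  have B': "B \<in> sets ?S" using B by (simp add: sets_flows_law)
  have "emeasure (distr (P i) config_space config) (A \<times> B) = emeasure (P i) (config -` (A \<times> B) \<inter> space (P i))"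
    using A B' by (intro emeasure_distr measurable_config) (auto simp: config_space_def)
  also have "config -` (A \<times> B) \<inter> space (P i) = C \<inter> (marks -` B \<inter> space (P i))"
    by (auto simp: config_def C_def)
  also have "emeasure (P i) \<dots> = emeasure (distr ?M ?S marks) B"
    by (rule dens[OF B', symmetric])
  also have "\<dots> = emeasure (P i) C * emeasure flows_law B" unfolding eq by simp
  also have "emeasure (P i) C = emeasure (env_law i) A"
    unfolding env_law_def C_def using A
    by (subst emeasure_distr[OF measurable_env_path]) (auto simp: vimage_def Int_def conj_commute)
  finally show "emeasure (env_law i) A * emeasure flows_law B = emeasure (distr (P i) config_space config) (A \<times> B)" by simp
qed

end

text \<open>Change of variables for the unnormalised conditional law of \<open>g\<close> given
  \<open>C\<close>, which by \<open>eq\<close> is \<open>r\<close> times \<open>N'\<close>.\<close>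

lemma nn_integral_weighted_image:
  assumes C: "C \<in> sets M" and g: "g \<in> measurable M N" and N': "sets N' = sets N"
    and eq: "\<And>B. B \<in> sets N \<Longrightarrow> emeasure M {x\<in>C. g x \<in> B} = r * emeasure N' B"
    and f: "f \<in> borel_measurable N"
  shows "(\<integral>\<^sup>+x. indicator C x * f (g x) \<partial>M) = r * (\<integral>\<^sup>+y. f y \<partial>N')"
proof -
  have C': "x \<in> space M" if "x \<in> C" for x using sets.sets_into_space[OF C] that by auto
  have "distr (density M (indicator C)) N g = scale_measure r N'"
  proof (rule measure_eqI)
    fix B assume "B \<in> sets (distr (density M (indicator C)) N g)"
    then have B: "B \<in> sets N" by simp
    have "emeasure (distr (density M (indicator C)) N g) B = emeasure M (C \<inter> (g -` B \<inter> space M))"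
      by (rule emeasure_distr_indicator[OF C g B])
    also have "C \<inter> (g -` B \<inter> space M) = {x\<in>C. g x \<in> B}" using C' by auto
    finally show "emeasure (distr (density M (indicator C)) N g) B = emeasure (scale_measure r N') B"
      by (simp add: eq[OF B])
  qed (simp add: N')
  then have "(\<integral>\<^sup>+y. f y \<partial>distr (density M (indicator C)) N g) = (\<integral>\<^sup>+y. f y \<partial>scale_measure r N')" by simp
  moreover have "f \<in> borel_measurable N'" using f by (simp add: measurable_cong_sets[OF N' refl])
  ultimately show ?thesis
    using g f C by (simp add: nn_integral_distr nn_integral_density nn_integral_scale_measure)
qed

section \<open>Restart of the whole configuration at a fixed time\<close>

definition config_shift :: "real \<Rightarrow> (real \<Rightarrow> 's) \<times> ('s \<Rightarrow> nat \<Rightarrow> real \<times> real) \<Rightarrow> (real \<Rightarrow> 's) \<times> ('s \<Rightarrow> nat \<Rightarrow> real \<times> real)" where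
  "config_shift h w = (shifted_path h (fst w), \<lambda>j. flow_shift h (snd w j))"

lemma measurable_flows_shift:
  "(\<lambda>y j. flow_shift h (y j)) \<in> measurable (PiM UNIV (\<lambda>_. flow_space)) (PiM UNIV (\<lambda>_. flow_space))"
proof (rule measurable_PiM_single')
  show "(\<lambda>y. flow_shift h (y j)) \<in> measurable (PiM UNIV (\<lambda>_. flow_space)) flow_space" for j
    by (rule measurable_compose[OF measurable_component_singleton[of j UNIV "\<lambda>_. flow_space"] measurable_flow_shift]) simp
qed (auto simp: space_flow_space)

lemma measurable_config_shift:
  assumes "0 \<le> h" shows "config_shift h \<in> measurable config_space config_space"
  unfolding config_shift_def[abs_def] config_space_def
  by (intro measurable_Pair measurable_compose[OF measurable_fst measurable_shifted_path[OF assms]]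
    measurable_compose[OF measurable_snd measurable_flows_shift])

lemma sets_config_restart:
  fixes A :: "'s::finite \<Rightarrow> (nat \<Rightarrow> real \<times> real) set"
  assumes h: "0 \<le> h" and A: "\<And>j. A j \<in> sets flow_space" and B: "B \<in> sets config_space"
  shows "{w\<in>space config_space. fst w h = k \<and> (\<forall>j. snd w j \<in> A j) \<and> config_shift h w \<in> B} \<in> sets config_space"
proof -
  note c = sets_path_component[OF h, of k]
  have C: "{y. \<forall>j. y j \<in> A j} \<in> sets (PiM UNIV (\<lambda>_. flow_space))"
    using sets_PiM_I_finite[of UNIV A "\<lambda>_. flow_space"] A by (simp add: PiE_UNIV_domain Pi_def)
  have "({x\<in>space path_space. x h = k} \<times> {y. \<forall>j. y j \<in> A j}) \<inter> (config_shift h -` B \<inter> space config_space) \<in> sets config_space"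
  proof (rule sets.Int)
    show "{x\<in>space path_space. x h = k} \<times> {y. \<forall>j. y j \<in> A j} \<in> sets config_space"
      unfolding config_space_def by (rule pair_measureI[OF c C])
    show "config_shift h -` B \<inter> space config_space \<in> sets config_space"
      by (rule measurable_sets[OF measurable_config_shift[OF h] B])
  qed
  then show ?thesis
    by (rule back_subst[of "\<lambda>S. S \<in> sets config_space"])
      (auto simp: config_space_def space_pair_measure space_PiM space_flow_space)
qed

context markov_environment_risk_process
begin

lemma emeasure_env_restart:
  assumes h: "0 \<le> h" and B: "B \<in> sets path_space"
  shows "emeasure (env_law i) {x\<in>{x\<in>space path_space. x h = k}. shifted_path h x \<in> B} =
    ennreal (transition i k h) * emeasure (env_law k) B"
proof -
  interpret M: prob_space "P i" by (rule prob_space_P)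
  interpret E: prob_space "env_law k" by (rule prob_space_env_law)
  note c = sets_path_component[OF h, of k]
  have S: "{x\<in>{x\<in>space path_space. x h = k}. shifted_path h x \<in> B} \<in> sets path_space"
  proof -
    have "{x\<in>space path_space. x h = k} \<inter> (shifted_path h -` B \<inter> space path_space) \<in> sets path_space"
      using c measurable_sets[OF measurable_shifted_path[OF h] B] by auto
    then show ?thesis by (rule back_subst[of "\<lambda>S. S \<in> sets path_space"]) auto
  qed
  have "emeasure (env_law i) {x\<in>{x\<in>space path_space. x h = k}. shifted_path h x \<in> B} =
    emeasure (P i) (env_path -` {x\<in>{x\<in>space path_space. x h = k}. shifted_path h x \<in> B} \<inter> space (P i))"
    unfolding env_law_def by (rule emeasure_distr[OF measurable_env_path S])
  also have "env_path -` {x\<in>{x\<in>space path_space. x h = k}. shifted_path h x \<in> B} \<inter> space (P i) =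
    {w\<in>space (P i). (\<forall>s\<in>{h}. J s w = (\<lambda>_. k) s) \<and> shifted_path h (env_path w) \<in> B}"
    using measurable_space[OF measurable_env_path] h by (auto simp: env_path_apply)
  also have "emeasure (P i) \<dots> = ennreal (transition i k h * measure (env_law k) B)"
    unfolding M.emeasure_eq_measure by (subst J_restart) (use h B in \<open>auto simp: transition_def\<close>)
  finally show ?thesis
    by (simp add: ennreal_mult E.emeasure_eq_measure transition_def)
qed

text \<open>Here \<open>\<kappa> j\<close> is the probability of the event \<open>A j\<close> about
  the past of flow \<open>j\<close>. Each flow restarts independently of its past event, and
  independence between the flows multiplies the factors.\<close>

lemma emeasure_flows_restart:
  assumes A: "\<And>j. A j \<in> sets flow_space"
    and \<kappa>: "\<And>j B. B \<in> sets flow_space \<Longrightarrow>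
      emeasure (flow_law (\<alpha> j) (claim_law j)) {y\<in>A j. flow_shift h y \<in> B} = \<kappa> j * emeasure (flow_law (\<alpha> j) (claim_law j)) B"
    and B: "B \<in> sets (PiM UNIV (\<lambda>_. flow_space))"
  shows "emeasure flows_law {y\<in>{y. \<forall>j. y j \<in> A j}. (\<lambda>j. flow_shift h (y j)) \<in> B} = (\<Prod>j\<in>UNIV. \<kappa> j) * emeasure flows_law B"
proof -
  let ?S = "PiM UNIV (\<lambda>_. flow_space) :: ('s \<Rightarrow> nat \<Rightarrow> real \<times> real) measure"
  let ?C = "{y. \<forall>j. y j \<in> A j} :: ('s \<Rightarrow> nat \<Rightarrow> real \<times> real) set"
  let ?g = "\<lambda>y j. flow_shift h (y j)"
  interpret PP: product_prob_space "\<lambda>j. flow_law (\<alpha> j) (claim_law j)" UNIV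
    by (intro product_prob_spaceI prob_space_flow_law)
  interpret Fl: prob_space flows_law by (rule prob_space_flows_law)
  have spS: "space ?S = UNIV" by (simp add: space_PiM space_flow_space)
  have C: "?C \<in> sets ?S"
    using sets_PiM_I_finite[of UNIV A "\<lambda>_. flow_space"] A by (simp add: PiE_UNIV_domain Pi_def)
  have C': "?C \<in> sets flows_law" unfolding sets_flows_law by (rule C)
  have g: "?g \<in> measurable ?S ?S" by (rule measurable_flows_shift)
  have g': "?g \<in> measurable flows_law ?S" using g by (simp add: measurable_cong_sets[OF sets_flows_law refl])
  let ?M = "density flows_law (indicator ?C)"
  have spf: "space flows_law = UNIV" using sets_eq_imp_space_eq[OF sets_flows_law] spS by simp
  have dens: "emeasure (distr ?M ?S ?g) D = emeasure flows_law {y\<in>?C. ?g y \<in> D}" if D: "D \<in> sets ?S" for D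
  proof -
    have "emeasure (distr ?M ?S ?g) D = emeasure flows_law (?C \<inter> ?g -` D)"
      using emeasure_distr_indicator[OF C' g' D] by (simp add: spf)
    also have "?C \<inter> ?g -` D = {y\<in>?C. ?g y \<in> D}" by auto
    finally show ?thesis .
  qed
  have "distr ?M ?S ?g = scale_measure (\<Prod>j\<in>UNIV. \<kappa> j) flows_law"
  proof (rule measure_eqI_PiM_infinite)
    fix K and D :: "'s \<Rightarrow> (nat \<Rightarrow> real \<times> real) set"
    assume K: "finite K" "K \<subseteq> UNIV" and D: "\<And>j. j \<in> K \<Longrightarrow> D j \<in> sets flow_space"
    \<comment> \<open>Coordinates outside \<open>K\<close> are filled with the whole space, because
      the events \<open>A j\<close> constrain all flows and not only those in
      \<open>K\<close>.\<close>
    define D' where "D' j = (if j \<in> K then D j else UNIV)" for j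
      have D': "D' j \<in> sets flow_space" for j using D UNIV_flow_space by (simp add: D'_def)
    let ?E = "prod_emb UNIV (\<lambda>_. flow_space) K (PiE K D)"
    have E: "?E \<in> sets ?S" using K D by (intro sets_PiM_I) auto
    have mem: "?E = PiE UNIV D'"
      by (auto simp: prod_emb_def PiE_iff space_flow_space D'_def split: if_splits)
    have eqs: "{y\<in>?C. ?g y \<in> ?E} = PiE UNIV (\<lambda>j. {y\<in>A j. flow_shift h y \<in> D' j})"
      unfolding mem by (auto simp: PiE_iff)
    have m: "{y\<in>A j. flow_shift h y \<in> D' j} \<in> sets flow_space" for j
    proof -
      have "A j \<inter> (flow_shift h -` D' j \<inter> space flow_space) \<in> sets flow_space"
        using A[of j] measurable_sets[OF measurable_flow_shift D'] by auto
      then show ?thesis by (rule back_subst[of "\<lambda>S. S \<in> sets flow_space"]) (auto simp: space_flow_space)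
    qed
    have "emeasure (distr ?M ?S ?g) ?E = emeasure flows_law (PiE UNIV (\<lambda>j. {y\<in>A j. flow_shift h y \<in> D' j}))"
      using dens[OF E] eqs by simp
    also have "\<dots> = (\<Prod>j\<in>UNIV. emeasure (flow_law (\<alpha> j) (claim_law j)) {y\<in>A j. flow_shift h y \<in> D' j})"
      unfolding flows_law_def using m by (intro PP.emeasure_PiM) (auto simp: sets_flow_law)
    also have "\<dots> = (\<Prod>j\<in>UNIV. \<kappa> j * emeasure (flow_law (\<alpha> j) (claim_law j)) (D' j))"
      using \<kappa>[OF D'] by simp
    also have "\<dots> = (\<Prod>j\<in>UNIV. \<kappa> j) * (\<Prod>j\<in>UNIV. emeasure (flow_law (\<alpha> j) (claim_law j)) (D' j))"
      by (rule prod.distrib)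
    also have "(\<Prod>j\<in>UNIV. emeasure (flow_law (\<alpha> j) (claim_law j)) (D' j)) = emeasure flows_law ?E"
      unfolding mem flows_law_def using D' by (intro PP.emeasure_PiM[symmetric]) (auto simp: sets_flow_law)
    finally show "emeasure (distr ?M ?S ?g) ?E = emeasure (scale_measure (\<Prod>j\<in>UNIV. \<kappa> j) flows_law) ?E" by simp
  next
    show "finite_measure (distr ?M ?S ?g)"
      by (rule finite_measure_distr_indicator[OF Fl.finite_measure_axioms C' g'])
  qed (simp_all add: sets_flows_law)
  then have "emeasure (distr ?M ?S ?g) B = emeasure (scale_measure (\<Prod>j\<in>UNIV. \<kappa> j) flows_law) B" by simp
  then show ?thesis using dens[OF B] by simp
qed

lemma sets_config_law: "sets (config_law i) = sets config_space"
  unfolding config_law_def config_space_def by (intro sets_pair_measure_cong sets_env_law sets_flows_law)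

text \<open>Fubini over the environment path: for a fixed path the section is an event of the flows
  alone, to which \<open>emeasure_flows_restart\<close> applies with the shifted path as a
  parameter. The path integral is then restarted by
  \<open>nn_integral_weighted_image\<close>.\<close>

lemma emeasure_config_restart:
  assumes h: "0 \<le> h" and A: "\<And>j. A j \<in> sets flow_space"
    and \<kappa>: "\<And>j B. B \<in> sets flow_space \<Longrightarrow>
      emeasure (flow_law (\<alpha> j) (claim_law j)) {y\<in>A j. flow_shift h y \<in> B} = \<kappa> j * emeasure (flow_law (\<alpha> j) (claim_law j)) B"
    and B: "B \<in> sets config_space"
  shows "emeasure (config_law i) {w\<in>space config_space. fst w h = k \<and> (\<forall>j. snd w j \<in> A j) \<and> config_shift h w \<in> B} =
    ennreal (transition i k h) * (\<Prod>j\<in>UNIV. \<kappa> j) * emeasure (config_law k) B"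
proof -
  interpret Fl: prob_space flows_law by (rule prob_space_flows_law)
  let ?S = "PiM UNIV (\<lambda>_. flow_space) :: ('s \<Rightarrow> nat \<Rightarrow> real \<times> real) measure"
  have spS: "space ?S = UNIV" by (simp add: space_PiM space_flow_space)
  have spC: "space config_space = space (path_space :: (real \<Rightarrow> 's) measure) \<times> (UNIV :: ('s \<Rightarrow> nat \<Rightarrow> real \<times> real) set)"
    unfolding config_space_def by (simp add: space_pair_measure spS)
  note c = sets_path_component[OF h, of k]
  let ?W = "{w\<in>space config_space. fst w h = k \<and> (\<forall>j. snd w j \<in> A j) \<and> config_shift h w \<in> B}"
  have W: "?W \<in> sets (env_law i \<Otimes>\<^sub>M flows_law)"
    using sets_config_restart[OF h A B] sets_config_law[of i] unfolding config_law_def by simp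
  have Bk: "B \<in> sets (env_law k \<Otimes>\<^sub>M flows_law)" using B sets_config_law[of k] unfolding config_law_def by simp
  let ?f = "\<lambda>x. emeasure flows_law (Pair x -` B)"
  have f: "?f \<in> borel_measurable path_space"
    using Fl.measurable_emeasure_Pair[OF Bk] by (simp add: measurable_cong_sets[OF sets_env_law refl])
  have cut: "emeasure flows_law (Pair x -` ?W) =
    indicator {x\<in>space path_space. x h = k} x * ((\<Prod>j\<in>UNIV. \<kappa> j) * ?f (shifted_path h x))" for x
  proof (cases "x \<in> space path_space \<and> x h = k")
    case True
    have e1: "Pair x -` ?W = {y\<in>{y. \<forall>j. y j \<in> A j}. (\<lambda>j. flow_shift h (y j)) \<in> Pair (shifted_path h x) -` B}"
      using True by (auto simp: spC config_shift_def)
    have e2: "Pair (shifted_path h x) -` B \<in> sets ?S"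
      using sets_Pair1[of B path_space ?S] B by (simp add: config_space_def)
    have "emeasure flows_law (Pair x -` ?W) = (\<Prod>j\<in>UNIV. \<kappa> j) * ?f (shifted_path h x)"
      unfolding e1 by (rule emeasure_flows_restart[OF A \<kappa> e2])
    moreover have "indicator {x\<in>space path_space. x h = k} x = (1::ennreal)" using True by simp
    ultimately show ?thesis by (simp only: mult_1)
  next
    case False
    then have "Pair x -` ?W = {}" by (auto simp: spC)
    moreover have "indicator {x\<in>space path_space. x h = k} x = (0::ennreal)" using False by simp
    ultimately show ?thesis by (simp only: emeasure_empty mult_zero_left)
  qed
  have "emeasure (config_law i) ?W = (\<integral>\<^sup>+x. indicator {x\<in>space path_space. x h = k} x * ((\<Prod>j\<in>UNIV. \<kappa> j) * ?f (shifted_path h x)) \<partial>env_law i)"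
    unfolding config_law_def Fl.emeasure_pair_measure_alt[OF W] cut ..
  also have "\<dots> = ennreal (transition i k h) * (\<integral>\<^sup>+x. (\<Prod>j\<in>UNIV. \<kappa> j) * ?f x \<partial>env_law k)"
  proof (rule nn_integral_weighted_image)
    show "shifted_path h \<in> measurable (env_law i) path_space"
      using measurable_shifted_path[OF h] by (simp add: measurable_cong_sets[OF sets_env_law refl])
    show "(\<lambda>x. (\<Prod>j\<in>UNIV. \<kappa> j) * ?f x) \<in> borel_measurable path_space" using f by measurable
  qed (use c emeasure_env_restart[OF h] in auto)
  also have "(\<integral>\<^sup>+x. (\<Prod>j\<in>UNIV. \<kappa> j) * ?f x \<partial>env_law k) = (\<Prod>j\<in>UNIV. \<kappa> j) * emeasure (config_law k) B"
    unfolding config_law_def Fl.emeasure_pair_measure_alt[OF Bk]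
    using f by (intro nn_integral_cmult) (simp add: measurable_cong_sets[OF sets_env_law refl])
  finally show ?thesis by (simp add: mult.assoc)
qed

lemma arrival_sequence_T: "w \<in> space (P i) \<Longrightarrow> arrival_sequence (\<lambda>n. T j n w)"
  using arrivals[of i j] by (simp add: poisson_flow_def arrival_sequence_def)

lemma arrival_time_marks: "arrival_time (marks w j) = (\<lambda>n. T j n w)"
proof
  show "arrival_time (marks w j) n = T j n w" for n
    unfolding arrival_time_def marks_def mark_def by (induction n) (simp_all add: interarrival_def)
qed

text \<open>The law is realised by the given flow under \<open>P j\<close>, all of whose samples are
  arrival sequences.\<close>

lemma AE_passage_exists: "AE y in flow_law (\<alpha> j) (claim_law j). \<exists>n. passage (arrival_time y) h n"
  unfolding distr_marks[of j j, symmetric]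
proof (subst AE_distr_iff[OF measurable_marks])
  show "{y\<in>space flow_space. \<exists>n. passage (arrival_time y) h n} \<in> sets flow_space" by measurable
  show "AE w in P j. \<exists>n. passage (arrival_time (marks w j)) h n"
    by (rule AE_I2) (simp add: arrival_time_marks passage_exists[OF arrival_sequence_T])
qed

definition none_before :: "real \<Rightarrow> (nat \<Rightarrow> real \<times> real) set" where
  "none_before h = {y. passage (arrival_time y) h 0}"

definition one_before :: "real \<Rightarrow> real set \<Rightarrow> (nat \<Rightarrow> real \<times> real) set" where
  "one_before h C = {y. passage (arrival_time y) h 1 \<and> snd (y 0) \<in> C}"

lemma sets_none_before: "none_before h \<in> sets flow_space"
proof -
  have "{y\<in>space flow_space. passage (arrival_time y) h 0} \<in> sets flow_space" by measurable
  then show ?thesis by (simp add: none_before_def space_flow_space)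
qed

lemma sets_one_before:
  assumes [measurable]: "C \<in> sets borel" shows "one_before h C \<in> sets flow_space"
proof -
  have "{y\<in>space flow_space. passage (arrival_time y) h 1 \<and> snd (y 0) \<in> C} \<in> sets flow_space" by measurable
  then show ?thesis by (simp add: one_before_def space_flow_space)
qed

lemma emeasure_flow_shift_all:
  assumes "0 \<le> h" "B \<in> sets flow_space"
  shows "emeasure (flow_law (\<alpha> j) (claim_law j)) {y\<in>UNIV. flow_shift h y \<in> B} = 1 * emeasure (flow_law (\<alpha> j) (claim_law j)) B"
  using marked_flow.emeasure_flow_shift[OF marked_flow_claims assms(2,1) AE_passage_exists] by simp

lemma emeasure_flow_shift_none:
  assumes "0 \<le> h" "B \<in> sets flow_space"
  shows "emeasure (flow_law (\<alpha> j) (claim_law j)) {y\<in>none_before h. flow_shift h y \<in> B} =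
    ennreal (exp (- \<alpha> j * h)) * emeasure (flow_law (\<alpha> j) (claim_law j)) B"
proof -
  have "{y\<in>none_before h. flow_shift h y \<in> B} = marked_flow.passing h 0 B"
    unfolding marked_flow.passing_def[OF marked_flow_claims] none_before_def by (auto simp: flow_shift_passage)
  then show ?thesis using marked_flow.emeasure_passing_0[OF marked_flow_claims assms(2,1)] by simp
qed

lemma emeasure_flow_shift_one:
  assumes "0 \<le> h" "B \<in> sets flow_space" "C \<in> sets borel"
  shows "emeasure (flow_law (\<alpha> j) (claim_law j)) {y\<in>one_before h C. flow_shift h y \<in> B} =
    (ennreal (\<alpha> j * h * exp (- \<alpha> j * h)) * emeasure (claim_law j) C) * emeasure (flow_law (\<alpha> j) (claim_law j)) B"
proof -
  have "{y\<in>one_before h C. flow_shift h y \<in> B} = {y\<in>marked_flow.passing h 1 B. snd (y 0) \<in> C}"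
    unfolding marked_flow.passing_def[OF marked_flow_claims] one_before_def by (auto simp: flow_shift_passage)
  then show ?thesis using marked_flow.emeasure_passing_1[OF marked_flow_claims assms(2,1,3)] by simp
qed

end

section \<open>One-step estimates\<close>

lemma claim_amount_none: "(\<And>n. T (x t) n \<noteq> t) \<Longrightarrow> claim_amount x T Z t = 0"
  by (simp add: claim_amount_def)

lemma claim_amount_single:
  assumes "strict_mono (T (x t))" "T (x t) n = t"
  shows "claim_amount x T Z t = Z (x t) n"
proof -
  have "{m. T (x t) m = t} = {n}" using assms(2) strict_mono_eq[OF assms(1), of _ n] by auto
  then show ?thesis by (simp add: claim_amount_def)
qed

lemma passage_0_greater: "strict_mono T \<Longrightarrow> passage T h 0 \<Longrightarrow> h < T n"
  unfolding passage_def using strict_mono_less_eq[of T 0 n] by fastforce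

text \<open>Allows \<open>J\<close> to be replaced by \<open>env_path\<close>, which agrees with it
  at nonnegative times.\<close>

lemma capital_path_cong:
  assumes "\<And>t. 0 \<le> t \<Longrightarrow> x t = x' t" and y: "capital_path c x T Z u y"
  shows "capital_path c x' T Z u y"
  unfolding capital_path_def
proof (intro conjI allI impI)
  show "y 0 = u" using y by (simp add: capital_path_def)
  fix i s t
  assume a: "0 \<le> s \<and> s < t \<and> (\<forall>r\<in>{0..s}. 0 \<le> y r) \<and> (\<forall>r\<in>{s..<t}. x' r = i) \<and> (\<forall>r\<in>{s<..<t}. \<forall>n. T i n \<noteq> r)"
  then have "\<forall>r\<in>{s..<t}. x r = i" using assms(1) by simp
  with a show "\<forall>r\<in>{s..<t}. (y has_real_derivative c i (y r)) (at r within {s..<t})"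
    using conjunct1[OF conjunct2[OF y[unfolded capital_path_def]]] by blast
next
  fix t :: real assume "0 < t" "\<forall>r\<in>{0..<t}. 0 \<le> y r"
  then have "(y \<longlongrightarrow> y t + claim_amount x T Z t) (at_left t)" using y by (simp add: capital_path_def)
  moreover have "claim_amount x T Z t = claim_amount x' T Z t" using assms(1)[of t] \<open>0 < t\<close> by (simp add: claim_amount_def)
  ultimately show "(y \<longlongrightarrow> y t + claim_amount x' T Z t) (at_left t)" by simp
qed

context growth_flow
begin

text \<open>The condition \<open>end_free\<close> refers to the state at \<open>t\<close>, which may
  differ from \<open>i\<close> when the environment jumps there: a claim at \<open>t\<close> could
  only come from the flow of the new state.\<close>

lemma capital_path_segment:
  assumes y: "capital_path c x T Z u y" and s: "0 \<le> s" "s \<le> t" and pos: "\<forall>r\<in>{0..s}. 0 \<le> y r"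
    and x: "\<forall>r\<in>{s..<t}. x r = i" and T: "\<forall>r\<in>{s<..<t}. \<forall>n. T i n \<noteq> r" and end_free: "\<And>n. s < t \<Longrightarrow> T (x t) n \<noteq> t"
  shows "y t = U i (y s) (t - s)" "\<forall>r\<in>{0..t}. 0 \<le> y r"
proof -
  have ys: "0 \<le> y s" using pos s by simp
  have "y t = U i (y s) (t - s) \<and> (\<forall>r\<in>{0..t}. 0 \<le> y r)"
  proof (cases "s = t")
    case True
    then show ?thesis using pos ys by (simp add: U_0)
  next
    case False
    then have "s < t" using s by simp
    note st = capital_path_step[OF y s(1) this pos x T]
    have yt: "y t = U i (y s) (t - s)" using st(2) claim_amount_none[of T x t Z] end_free[OF \<open>s < t\<close>] by simp
    moreover have "0 \<le> y r" if "r \<in> {0..t}" for r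
      using st(3) that yt U_nonneg[OF ys, of "t - s" i] s by (cases "r = t") auto
    ultimately show ?thesis by blast
  qed
  then show "y t = U i (y s) (t - s)" "\<forall>r\<in>{0..t}. 0 \<le> y r" by blast+
qed

lemma capital_path_no_event:
  assumes y: "capital_path c x T Z u y" and u: "0 \<le> u" and h: "0 \<le> h"
    and x: "\<forall>s\<in>{0..h}. x s = i" and T: "strict_mono (T i)" "passage (T i) h 0"
  shows "y h = U i u h" "\<forall>r\<in>{0..h}. 0 \<le> y r"
proof -
  have y0: "y 0 = u" using y by (simp add: capital_path_def)
  have "T i n \<noteq> r" if "r \<le> h" for r n using passage_0_greater[OF T, of n] that by linarith
  moreover have "x h = i" using x h by simp
  ultimately show "y h = U i u h" "\<forall>r\<in>{0..h}. 0 \<le> y r"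
    using capital_path_segment[OF y, of 0 h i] x u h y0 by auto
qed

text \<open>The jump time \<open>r\<close> is treated as unknown. The lower bound forgets all
  growth, and the upper bound grants a full step of growth in each of the two states.\<close>

lemma capital_path_one_jump:
  assumes y: "capital_path c x T Z u y" and u: "0 \<le> u" and r: "0 < r" "r \<le> h"
    and x: "\<forall>s\<in>{0..<r}. x s = i" "\<forall>s\<in>{r..h}. x s = k"
    and T: "\<And>j. strict_mono (T j)" "\<And>j. passage (T j) h 0"
  shows "u \<le> y h" "y h \<le> U k (U i u h) h" "\<forall>r\<in>{0..h}. 0 \<le> y r"
proof -
  have y0: "y 0 = u" using y by (simp add: capital_path_def)
  have no: "T j n \<noteq> q" if "q \<le> h" for j n q using passage_0_greater[OF T, of j n] that by linarith
  have 1: "y r = U i u r" "\<forall>q\<in>{0..r}. 0 \<le> y q"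
    using capital_path_segment[OF y, of 0 r i] x(1) u r y0 no by auto
  have 2: "y h = U k (y r) (h - r)" "\<forall>q\<in>{0..h}. 0 \<le> y q"
    using capital_path_segment[OF y, of r h k] x(2) 1(2) r no by auto
  show "\<forall>r\<in>{0..h}. 0 \<le> y r" by (rule 2(2))
  have a: "u \<le> U i u r" "U i u r \<le> U i u h" using U_ge[of u r i] U_mono_time[of u r h i] u r by auto
  then show "u \<le> y h" unfolding 2(1) 1(1) using U_ge[of "U i u r" "h - r" k] u r by simp
  have "U k (U i u r) (h - r) \<le> U k (U i u h) (h - r)" using a u r by (intro U_mono_initial) auto
  also have "\<dots> \<le> U k (U i u h) h" using a u r by (intro U_mono_time) auto
  finally show "y h \<le> U k (U i u h) h" unfolding 2(1) 1(1) .
qed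

text \<open>Just before the claim the capital lies between \<open>u\<close> and
  \<open>U i u h\<close>. A claim of at most \<open>u\<close> is therefore survived and one above
  \<open>U i u h\<close> is not; growth after the claim is bounded below by none and above by a full
  step.\<close>

lemma capital_path_one_claim:
  assumes y: "capital_path c x T Z u y" and u: "0 \<le> u" and h: "0 \<le> h"
    and x: "\<forall>s\<in>{0..h}. x s = i" and T: "arrival_sequence (T i)" "passage (T i) h 1"
  shows "Z i 0 \<le> u \<Longrightarrow> (\<forall>r\<in>{0..h}. 0 \<le> y r) \<and> u - Z i 0 \<le> y h"
    and "\<forall>r\<in>{0..h}. 0 \<le> y r \<Longrightarrow> Z i 0 \<le> U i u h \<and> y h \<le> U i (U i u h - Z i 0) h"
proof -
  have y0: "y 0 = u" using y by (simp add: capital_path_def)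
  define r where "r = T i 0"
  have sm: "strict_mono (T i)" using T by (simp add: arrival_sequence_def)
  have r: "0 < r" "r \<le> h" using T by (auto simp: r_def arrival_sequence_def passage_def)
  have no0: "T i n \<noteq> q" if "q < r" for n q
    using strict_mono_less_eq[OF sm, of 0 n] that by (auto simp: r_def)
  have no1: "T i n \<noteq> q" if "r < q" "q \<le> h" for n q
  proof (cases "n = 0")
    case False
    have "h < T i 1" using T by (simp add: passage_def)
    also have "T i 1 \<le> T i n" using strict_mono_less_eq[OF sm, of 1 n] False by simp
    finally show ?thesis using that by simp
  qed (use that r_def in auto)
  have "claim_amount x T Z r = Z i 0"
    using claim_amount_single[of T x r 0 Z] x r sm by (simp add: r_def)
  moreover have "y r = U i u r - claim_amount x T Z r" "\<forall>q\<in>{0..<r}. 0 \<le> y q"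
    using capital_path_step[OF y, of 0 r i] x u r y0 no0 by auto
  ultimately have yr: "y r = U i u r - Z i 0" and nn: "\<forall>q\<in>{0..<r}. 0 \<le> y q" by simp_all
  have a: "u \<le> U i u r" "U i u r \<le> U i u h" using U_ge[of u r i] U_mono_time[of u r h i] u r by auto
  have seg: "y h = U i (y r) (h - r)" "\<forall>q\<in>{0..h}. 0 \<le> y q" if "0 \<le> y r"
  proof -
    have "\<forall>q\<in>{0..r}. 0 \<le> y q"
    proof
      fix q assume "q \<in> {0..r}"
      then show "0 \<le> y q" using nn that by (cases "q = r") auto
    qed
    then show "y h = U i (y r) (h - r)" "\<forall>q\<in>{0..h}. 0 \<le> y q"
      using capital_path_segment[OF y, of r h i] x r no1 by auto
  qed
  {
    assume z: "Z i 0 \<le> u"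
    then have "0 \<le> y r" using yr a by simp
    note s = seg[OF this]
    have "u - Z i 0 \<le> y r" using yr a by simp
    also have "y r \<le> y h" unfolding s(1) using U_ge[OF \<open>0 \<le> y r\<close>, of "h - r" i] r by simp
    finally show "(\<forall>r\<in>{0..h}. 0 \<le> y r) \<and> u - Z i 0 \<le> y h" using s(2) by blast
  next
    assume "\<forall>r\<in>{0..h}. 0 \<le> y r"
    then have yr0: "0 \<le> y r" using r by simp
    note s = seg[OF this]
    have b: "y r \<le> U i u h - Z i 0" using yr a by simp
    have "y h \<le> U i (U i u h - Z i 0) (h - r)" unfolding s(1) using b yr0 r by (intro U_mono_initial) auto
    also have "\<dots> \<le> U i (U i u h - Z i 0) h" using b yr0 r by (intro U_mono_time) auto
    finally show "Z i 0 \<le> U i u h \<and> y h \<le> U i (U i u h - Z i 0) h" using b yr0 by simp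
  }
qed

lemma config_survives_mono: "0 \<le> u \<Longrightarrow> u \<le> v \<Longrightarrow> config_survives U u w \<Longrightarrow> config_survives U v w"
  unfolding config_survives_def by (rule survives_mono)

definition survival_set :: "real \<Rightarrow> ((real \<Rightarrow> 's) \<times> ('s \<Rightarrow> nat \<Rightarrow> real \<times> real)) set" where
  "survival_set u = {w\<in>space config_space. config_survives U u w}"

lemma sets_survival_set: "survival_set u \<in> sets config_space"
  unfolding survival_set_def by (rule measurable_config_survives) auto

lemma survival_set_mono: "0 \<le> u \<Longrightarrow> u \<le> v \<Longrightarrow> survival_set u \<subseteq> survival_set v"
  unfolding survival_set_def using config_survives_mono by auto

end

context markov_environment_risk_process
begin

lemma env_capital:
  "0 \<le> u \<Longrightarrow> w \<in> space (P i) \<Longrightarrow> capital_path c (env_path w) (\<lambda>j n. T j n w) (\<lambda>j n. Z j n w) u (\<lambda>t. \<xi> u t w)"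
  using capital_path_cong[OF _ capital] by (simp add: env_path_apply)

lemma nonruin_iff_survival:
  assumes "0 \<le> u" "w \<in> space (P i)"
  shows "(\<forall>t\<ge>0. 0 \<le> \<xi> u t w) \<longleftrightarrow> config w \<in> survival_set u"
proof -
  have "(\<forall>t\<ge>0. 0 \<le> \<xi> u t w) \<longleftrightarrow> survives U (env_path w) (\<lambda>j n. T j n w) (\<lambda>j n. Z j n w) u"
    by (rule capital_path_nonneg_iff_survives[OF step_path_env_path[OF assms(2)] arrival_sequence_T[OF assms(2)]
       env_capital[OF assms] assms(1)])
  moreover have "config w \<in> space config_space" by (rule measurable_space[OF measurable_config assms(2)])
  ultimately show ?thesis
    by (simp add: survival_set_def config_survives_def config_def arrival_time_marks)
       (simp add: marks_def mark_def)
qed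

text \<open>Given no ruin up to \<open>h\<close>, the past matters only through the capital
  \<open>\<xi> u h w\<close>; the shifted configuration contains everything else. The restart
  indices \<open>N j\<close> vary with the sample and are absorbed by
  \<open>flow_shift\<close>.\<close>

lemma nonruin_iff_shift_survival:
  assumes u: "0 \<le> u" and w: "w \<in> space (P i)" and h: "0 \<le> h" and nn: "\<forall>r\<in>{0..h}. 0 \<le> \<xi> u r w"
  shows "(\<forall>t\<ge>0. 0 \<le> \<xi> u t w) \<longleftrightarrow> config_shift h (config w) \<in> survival_set (\<xi> u h w)"
proof -
  have "\<forall>j. \<exists>n. passage (\<lambda>n. T j n w) h n" using passage_exists[OF arrival_sequence_T[OF w]] by blast
  then obtain N where N: "\<And>j. passage (\<lambda>n. T j n w) h (N j)" by metis
  have fs: "flow_shift h (marks w j) = flow_restart h (N j) (marks w j)" for j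
    by (rule flow_shift_passage) (simp add: arrival_time_marks N)
  have "(\<forall>t\<ge>0. 0 \<le> \<xi> u t w) \<longleftrightarrow>
    survives U (shifted_path h (env_path w)) (\<lambda>j n. T j (N j + n) w - h) (\<lambda>j n. Z j (N j + n) w) (\<xi> u h w)"
    by (rule capital_path_nonneg_iff_shift_survives[where T="\<lambda>j n. T j n w" and Z="\<lambda>j n. Z j n w" and N=N,
      OF step_path_env_path[OF w] arrival_sequence_T[OF w] N h env_capital[OF u w] nn])
  moreover have "config_shift h (config w) \<in> space config_space"
    by (rule measurable_space[OF measurable_config_shift[OF h] measurable_space[OF measurable_config w]])
  moreover have "arrival_time (flow_restart h (N j) (marks w j)) = (\<lambda>n. T j (N j + n) w - h)" for j
    by (rule ext) (simp add: arrival_time_flow_restart arrival_time_marks)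
  ultimately show ?thesis
    by (simp add: survival_set_def config_survives_def config_def config_shift_def fs snd_flow_restart)
       (simp add: marks_def mark_def)
qed

text \<open>The infimum is nonnegative exactly when all values are, so non-ruin is the preimage of
  \<open>survival_set u\<close> under \<open>config\<close>. From here on \<open>\<xi>\<close>
  enters only through the law of the configuration and the path comparisons.\<close>

lemma nonruin_prob_eq:
  assumes u: "0 \<le> u"
  shows "nonruin_prob P \<xi> i u = measure (config_law i) (survival_set u)"
proof -
  have "0 \<le> (INF t\<in>{0..}. ereal (\<xi> u t w)) \<longleftrightarrow> (\<forall>t\<ge>0. 0 \<le> \<xi> u t w)" for w
    by (auto simp: le_INF_iff)
  then have "{w\<in>space (P i). 0 \<le> (INF t\<in>{0..}. ereal (\<xi> u t w))} = config -` survival_set u \<inter> space (P i)"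
    using nonruin_iff_survival[OF u, of _ i] by (simp only: vimage_def Int_def mem_Collect_eq) blast
  then show ?thesis unfolding nonruin_prob_def distr_config[symmetric]
    by (simp add: measure_distr[OF measurable_config sets_survival_set])
qed

section \<open>The non-ruin probability as a function of the capital\<close>

definition surv :: "'s \<Rightarrow> real \<Rightarrow> real" where
  "surv j v = measure (config_law j) (survival_set v)"

lemma prob_space_config_law: "prob_space (config_law i)"
  unfolding distr_config[symmetric] by (rule prob_space.prob_space_distr[OF prob_space_P measurable_config])

lemma surv_bounds: "0 \<le> surv j v" "surv j v \<le> 1"
  unfolding surv_def using prob_space.prob_le_1[OF prob_space_config_law] by auto

lemma surv_mono: "0 \<le> u \<Longrightarrow> u \<le> v \<Longrightarrow> surv j u \<le> surv j v"
  unfolding surv_def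
  by (intro finite_measure.finite_measure_mono survival_set_mono)
    (auto simp: sets_config_law sets_survival_set intro: prob_space.axioms prob_space_config_law)

text \<open>Set to 0 for negative capital the function is monotone on the whole line. This makes it
  Borel measurable and lets the claim integral run over all claim sizes.\<close>

definition surv0 :: "'s \<Rightarrow> real \<Rightarrow> real" where
  "surv0 j v = (if v < 0 then 0 else surv j v)"

lemma surv0_bounds: "0 \<le> surv0 j v" "surv0 j v \<le> 1"
  using surv_bounds[of j v] by (auto simp: surv0_def)

lemma mono_surv0: "mono (surv0 j)"
  by (rule monoI) (auto simp: surv0_def surv_mono surv_bounds)

lemma measurable_surv0[measurable]: "surv0 j \<in> borel_measurable borel"
  by (rule borel_measurable_mono[OF mono_surv0])

definition claim_surv :: "'s \<Rightarrow> real \<Rightarrow> real" where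
  "claim_surv j v = (LINT z|claim_law j. surv0 j (v - z))"

lemma integrable_claim_law:
  fixes f :: "real \<Rightarrow> real" and b :: real
  assumes [measurable]: "f \<in> borel_measurable borel" and "\<And>z. \<bar>f z\<bar> \<le> b"
  shows "integrable (claim_law j) f"
proof -
  interpret prob_space "claim_law j" by (rule prob_space_claim_law)
  have "f \<in> borel_measurable (claim_law j)" using assms(1) by (simp add: measurable_cong_sets[OF sets_claim_law refl])
  then show ?thesis using assms(2) by (intro integrable_const_bound[of _ b]) auto
qed

lemma integrable_surv0: "integrable (claim_law j) (\<lambda>z. surv0 j (v - z))"
  by (rule integrable_claim_law[of _ 1]) (use surv0_bounds in auto)

lemma claim_surv_bounds: "0 \<le> claim_surv j v" "claim_surv j v \<le> 1"
proof -
  interpret prob_space "claim_law j" by (rule prob_space_claim_law)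
  show "0 \<le> claim_surv j v" unfolding claim_surv_def by (intro integral_nonneg_AE) (simp add: surv0_bounds)
  have "claim_surv j v \<le> (LINT z|claim_law j. 1)"
    unfolding claim_surv_def by (intro integral_mono integrable_surv0) (auto simp: surv0_bounds)
  then show "claim_surv j v \<le> 1" by (simp add: prob_space)
qed

lemma mono_claim_surv: "mono (claim_surv j)"
  unfolding claim_surv_def
  by (intro monoI integral_mono integrable_surv0 monoD[OF mono_surv0]) auto

section \<open>Probabilities of the scenarios in a short step\<close>

definition restart_event ::
  "'s \<Rightarrow> real \<Rightarrow> 's \<Rightarrow> ('s \<Rightarrow> (nat \<Rightarrow> real \<times> real) set) \<Rightarrow> ((real \<Rightarrow> 's) \<times> ('s \<Rightarrow> nat \<Rightarrow> real \<times> real)) set \<Rightarrow> 'w set" where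
  "restart_event i h k A B = {w\<in>space (P i). J h w = k \<and> (\<forall>j. marks w j \<in> A j) \<and> config_shift h (config w) \<in> B}"

lemma restart_event:
  assumes h: "0 \<le> h" and A: "\<And>j. A j \<in> sets flow_space" and B: "B \<in> sets config_space"
  shows "restart_event i h k A B \<in> sets (P i)"
    and "(\<And>j D. D \<in> sets flow_space \<Longrightarrow>
        emeasure (flow_law (\<alpha> j) (claim_law j)) {y\<in>A j. flow_shift h y \<in> D} = ennreal (r j) * emeasure (flow_law (\<alpha> j) (claim_law j)) D) \<Longrightarrow>
      (\<And>j. 0 \<le> r j) \<Longrightarrow>
      measure (P i) (restart_event i h k A B) = transition i k h * (\<Prod>j\<in>UNIV. r j) * measure (config_law k) B"
proof -
  interpret M: prob_space "P i" by (rule prob_space_P)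
  interpret L: prob_space "config_law k" by (rule prob_space_config_law)
  let ?W = "{w\<in>space config_space. fst w h = k \<and> (\<forall>j. snd w j \<in> A j) \<and> config_shift h w \<in> B}"
  have eq: "restart_event i h k A B = config -` ?W \<inter> space (P i)"
    using measurable_space[OF measurable_config] h by (auto simp: restart_event_def config_def env_path_apply)
  have W: "?W \<in> sets config_space" by (rule sets_config_restart[OF h A B])
  show "restart_event i h k A B \<in> sets (P i)" unfolding eq by (rule measurable_sets[OF measurable_config W])
  assume r: "\<And>j D. D \<in> sets flow_space \<Longrightarrow>
        emeasure (flow_law (\<alpha> j) (claim_law j)) {y\<in>A j. flow_shift h y \<in> D} = ennreal (r j) * emeasure (flow_law (\<alpha> j) (claim_law j)) D"
    and r0: "\<And>j. 0 \<le> r j"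
  have "emeasure (P i) (restart_event i h k A B) = emeasure (config_law i) ?W"
    unfolding eq distr_config[symmetric] by (rule emeasure_distr[OF measurable_config W, symmetric])
  also have "\<dots> = ennreal (transition i k h) * (\<Prod>j\<in>UNIV. ennreal (r j)) * emeasure (config_law k) B"
    by (rule emeasure_config_restart[OF h A r B])
  also have "\<dots> = ennreal (transition i k h * (\<Prod>j\<in>UNIV. r j) * measure (config_law k) B)"
    using r0 by (simp add: prod_ennreal L.emeasure_eq_measure ennreal_mult prod_nonneg transition_def)
  finally show "measure (P i) (restart_event i h k A B) = transition i k h * (\<Prod>j\<in>UNIV. r j) * measure (config_law k) B"
    using r0 by (simp add: M.emeasure_eq_measure prod_nonneg transition_def)
qed

lemma prob_restart_all:
  assumes "0 \<le> h" "B \<in> sets config_space"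
  shows "measure (P i) (restart_event i h k (\<lambda>_. UNIV) B) = transition i k h * measure (config_law k) B"
  using restart_event(2)[where r="\<lambda>_. 1" and i=i and k=k, OF assms(1) UNIV_flow_space assms(2)] emeasure_flow_shift_all[OF assms(1)] by simp

lemma prob_restart_none:
  assumes "0 \<le> h" "B \<in> sets config_space"
  shows "measure (P i) (restart_event i h k (\<lambda>_. none_before h) B) =
    transition i k h * exp (- (\<Sum>j\<in>UNIV. \<alpha> j) * h) * measure (config_law k) B"
proof -
  have "(\<Prod>j\<in>UNIV. exp (- \<alpha> j * h)) = exp (- (\<Sum>j\<in>UNIV. \<alpha> j) * h)"
    by (simp add: exp_sum[symmetric] sum_distrib_right sum_negf)
  then show ?thesis
    using restart_event(2)[where r="\<lambda>j. exp (- \<alpha> j * h)" and i=i and k=k, OF assms(1) sets_none_before assms(2)]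
      emeasure_flow_shift_none[OF assms(1)] by simp
qed

lemma prob_restart_none_at:
  assumes "0 \<le> h" "B \<in> sets config_space"
  shows "measure (P i) (restart_event i h k (\<lambda>j. if j = l then none_before h else UNIV) B) =
    transition i k h * exp (- \<alpha> l * h) * measure (config_law k) B"
  using restart_event(2)[where A="\<lambda>j. if j = l then none_before h else UNIV" and
      r="\<lambda>j. if j = l then exp (- \<alpha> l * h) else 1" and i=i and k=k, OF assms(1) _ assms(2)]
    emeasure_flow_shift_none[OF assms(1)] emeasure_flow_shift_all[OF assms(1)] sets_none_before UNIV_flow_space
  by auto

lemma prob_restart_one_at:
  assumes "0 \<le> h" "B \<in> sets config_space" "C \<in> sets borel"
  shows "measure (P i) (restart_event i h k (\<lambda>j. if j = l then one_before h C else UNIV) B) =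
    transition i k h * (\<alpha> l * h * exp (- \<alpha> l * h) * measure (claim_law l) C) * measure (config_law k) B"
proof -
  interpret prob_space "claim_law l" by (rule prob_space_claim_law)
  have "0 \<le> \<alpha> l * h * exp (- \<alpha> l * h) * measure (claim_law l) C" using \<alpha>_pos[of l] assms(1) by simp
  moreover have "ennreal (\<alpha> l * h * exp (- \<alpha> l * h)) * emeasure (claim_law l) C =
    ennreal (\<alpha> l * h * exp (- \<alpha> l * h) * measure (claim_law l) C)"
    using \<alpha>_pos[of l] assms(1) by (simp add: emeasure_eq_measure ennreal_mult)
  ultimately show ?thesis
    using restart_event(2)[where A="\<lambda>j. if j = l then one_before h C else UNIV" and
      r="\<lambda>j. if j = l then \<alpha> l * h * exp (- \<alpha> l * h) * measure (claim_law l) C else 1" and i=i and k=k, OF assms(1) _ assms(2)]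
    emeasure_flow_shift_one[OF assms(1) _ assms(3)] emeasure_flow_shift_all[OF assms(1)] sets_one_before[OF assms(3)] UNIV_flow_space
    by auto
qed

text \<open>After a claim the required future depends on the claim size, so a joint set
  \<open>W\<close> replaces the separate past and future events of
  \<open>restart_event\<close>.\<close>

definition claim_event ::
  "'s \<Rightarrow> real \<Rightarrow> (real \<times> (real \<Rightarrow> 's) \<times> ('s \<Rightarrow> nat \<Rightarrow> real \<times> real)) set \<Rightarrow> 'w set" where
  "claim_event i h W = {w\<in>space (P i). J h w = i \<and> marks w i \<in> one_before h UNIV \<and> (Z i 0 w, config_shift h (config w)) \<in> W}"

text \<open>Restricted to the event that flow \<open>i\<close> has exactly one arrival up to
  \<open>h\<close> and the state at \<open>h\<close> is \<open>i\<close>, the pair of claim size and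
  shifted configuration has a multiple of the product law. On rectangles this is
  \<open>prob_restart_one_at\<close>, and rectangles determine the product measure.\<close>

lemma claim_event:
  assumes h: "0 \<le> h" and W: "W \<in> sets (borel \<Otimes>\<^sub>M config_space)"
  shows "claim_event i h W \<in> sets (P i)"
    and "emeasure (P i) (claim_event i h W) =
      ennreal (transition i i h * (\<alpha> i * h * exp (- \<alpha> i * h))) * (\<integral>\<^sup>+z. emeasure (config_law i) (Pair z -` W) \<partial>claim_law i)"
proof -
  interpret M: prob_space "P i" by (rule prob_space_P)
  interpret L: prob_space "config_law i" by (rule prob_space_config_law)
  interpret C: prob_space "claim_law i" by (rule prob_space_claim_law)
  let ?A = "\<lambda>D j. if j = i then one_before h D else UNIV"
  define r where "r = transition i i h * (\<alpha> i * h * exp (- \<alpha> i * h))"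
  have r0: "0 \<le> r" unfolding r_def transition_def using \<alpha>_pos[of i] h by simp
  define G where "G = restart_event i h i (?A UNIV) (space config_space)"
  have Asets: "?A D j \<in> sets flow_space" if "D \<in> sets borel" for D j
    using sets_one_before[OF that] UNIV_flow_space by simp
  have cs: "config_shift h (config w) \<in> space config_space" if "w \<in> space (P i)" for w
    by (rule measurable_space[OF measurable_config_shift[OF h] measurable_space[OF measurable_config that]])
  have G: "G \<in> sets (P i)" unfolding G_def by (rule restart_event(1)[OF h Asets sets.top]) simp
  have Geq: "G = {w\<in>space (P i). J h w = i \<and> marks w i \<in> one_before h UNIV}"
    unfolding G_def restart_event_def using cs by auto
  define g where "g w = (Z i 0 w, config_shift h (config w))" for w
  have g: "g \<in> measurable (P i) (borel \<Otimes>\<^sub>M config_space)"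
    unfolding g_def[abs_def]
    by (intro measurable_Pair claim_measurable measurable_compose[OF measurable_config measurable_config_shift[OF h]])
  have ce: "claim_event i h V = G \<inter> (g -` V \<inter> space (P i))" for V
    unfolding Geq claim_event_def g_def by auto
  show "claim_event i h W \<in> sets (P i)" unfolding ce using G measurable_sets[OF g W] by auto
  let ?M = "density (P i) (indicator G)"
  have dens: "emeasure (distr ?M (borel \<Otimes>\<^sub>M config_space) g) V = emeasure (P i) (claim_event i h V)"
    if V: "V \<in> sets (borel \<Otimes>\<^sub>M config_space)" for V
    unfolding ce by (rule emeasure_distr_indicator[OF G g V])
  have fin: "finite_measure (scale_measure (ennreal r) (claim_law i))"
    by (rule finite_measureI) (simp add: C.emeasure_eq_measure ennreal_mult_eq_top_iff)
  have eq: "scale_measure (ennreal r) (claim_law i) \<Otimes>\<^sub>M config_law i = distr ?M (borel \<Otimes>\<^sub>M config_space) g"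
  proof (rule pair_measure_eqI)
    show "sigma_finite_measure (scale_measure (ennreal r) (claim_law i))"
      using fin by (rule finite_measure.axioms(1))
    show "sigma_finite_measure (config_law i)" by (rule L.sigma_finite_measure_axioms)
    show "sets (scale_measure (ennreal r) (claim_law i) \<Otimes>\<^sub>M config_law i) = sets (distr ?M (borel \<Otimes>\<^sub>M config_space) g)"
      by (simp add: sets_config_law cong: sets_pair_measure_cong)
    fix D B assume "D \<in> sets (scale_measure (ennreal r) (claim_law i))" "B \<in> sets (config_law i)"
    then have D: "D \<in> sets borel" and B: "B \<in> sets config_space" by (simp_all add: sets_config_law)
    have "claim_event i h (D \<times> B) = restart_event i h i (?A D) B"
      unfolding claim_event_def restart_event_def one_before_def by (auto simp: marks_def mark_def)
    then have "emeasure (distr ?M (borel \<Otimes>\<^sub>M config_space) g) (D \<times> B) = ennreal (measure (P i) (restart_event i h i (?A D) B))"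
      using dens[of "D \<times> B"] D B by (simp add: M.emeasure_eq_measure)
    also have "\<dots> = ennreal (r * measure (claim_law i) D * measure (config_law i) B)"
      unfolding prob_restart_one_at[OF h B D] r_def by (simp add: mult_ac)
    also have "\<dots> = emeasure (scale_measure (ennreal r) (claim_law i)) D * emeasure (config_law i) B"
      using r0 by (simp add: C.emeasure_eq_measure L.emeasure_eq_measure ennreal_mult)
    finally show "emeasure (scale_measure (ennreal r) (claim_law i)) D * emeasure (config_law i) B =
      emeasure (distr ?M (borel \<Otimes>\<^sub>M config_space) g) (D \<times> B)" by simp
  qed
  have sW: "sets (scale_measure (ennreal r) (claim_law i) \<Otimes>\<^sub>M config_law i) = sets (borel \<Otimes>\<^sub>M config_space)"
    by (simp add: sets_config_law cong: sets_pair_measure_cong)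
  have sW': "sets (claim_law i \<Otimes>\<^sub>M config_law i) = sets (borel \<Otimes>\<^sub>M config_space)"
    by (simp add: sets_config_law cong: sets_pair_measure_cong)
  have "emeasure (P i) (claim_event i h W) = emeasure (scale_measure (ennreal r) (claim_law i) \<Otimes>\<^sub>M config_law i) W"
    unfolding eq by (rule dens[OF W, symmetric])
  also have "\<dots> = (\<integral>\<^sup>+z. emeasure (config_law i) (Pair z -` W) \<partial>scale_measure (ennreal r) (claim_law i))"
    by (rule L.emeasure_pair_measure_alt) (use W sW in simp)
  also have "\<dots> = ennreal r * (\<integral>\<^sup>+z. emeasure (config_law i) (Pair z -` W) \<partial>claim_law i)"
    by (intro nn_integral_scale_measure L.measurable_emeasure_Pair) (use W sW' in simp)
  finally show "emeasure (P i) (claim_event i h W) =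
      ennreal (transition i i h * (\<alpha> i * h * exp (- \<alpha> i * h))) * (\<integral>\<^sup>+z. emeasure (config_law i) (Pair z -` W) \<partial>claim_law i)"
    unfolding r_def .
qed

definition claim_set :: "real \<Rightarrow> (real \<Rightarrow> real) \<Rightarrow> (real \<times> (real \<Rightarrow> 's) \<times> ('s \<Rightarrow> nat \<Rightarrow> real \<times> real)) set" where
  "claim_set v f = {q\<in>space (borel \<Otimes>\<^sub>M config_space). fst q \<le> v \<and> config_survives U (f (fst q)) (snd q)}"

lemma prob_claim_set:
  assumes h: "0 \<le> h" and f[measurable]: "f \<in> borel_measurable borel"
    and g[measurable]: "g \<in> borel_measurable borel" and g_eq: "\<And>z. g z = (if z \<le> v then surv i (f z) else 0)"
  shows "claim_event i h (claim_set v f) \<in> sets (P i)"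
    and "measure (P i) (claim_event i h (claim_set v f)) =
      transition i i h * (\<alpha> i * h * exp (- \<alpha> i * h)) * (LINT z|claim_law i. g z)"
proof -
  interpret M: prob_space "P i" by (rule prob_space_P)
  interpret L: prob_space "config_law i" by (rule prob_space_config_law)
  have W: "claim_set v f \<in> sets (borel \<Otimes>\<^sub>M config_space)"
  proof -
    have "{q\<in>space (borel \<Otimes>\<^sub>M config_space). config_survives U (f (fst q)) (snd q)} \<in> sets (borel \<Otimes>\<^sub>M config_space)"
      by (rule measurable_config_survives) measurable
    moreover have "{q\<in>space (borel \<Otimes>\<^sub>M config_space). fst q \<le> v} \<in> sets (borel \<Otimes>\<^sub>M config_space)" by measurable
    ultimately have "{q\<in>space (borel \<Otimes>\<^sub>M config_space). fst q \<le> v} \<inter>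
      {q\<in>space (borel \<Otimes>\<^sub>M config_space). config_survives U (f (fst q)) (snd q)} \<in> sets (borel \<Otimes>\<^sub>M config_space)" by auto
    then show ?thesis
      by (rule back_subst[of "\<lambda>S. S \<in> sets (borel \<Otimes>\<^sub>M config_space)"]) (auto simp: claim_set_def)
  qed
  show "claim_event i h (claim_set v f) \<in> sets (P i)" by (rule claim_event(1)[OF h W])
  have g01: "0 \<le> g z" "g z \<le> 1" for z using surv_bounds[of i "f z"] by (auto simp: g_eq)
  have cut: "emeasure (config_law i) (Pair z -` claim_set v f) = ennreal (g z)" for z
  proof (cases "z \<le> v")
    case True
    then have "Pair z -` claim_set v f = survival_set (f z)"
      by (auto simp: claim_set_def survival_set_def space_pair_measure)
    then show ?thesis using True by (simp add: g_eq L.emeasure_eq_measure surv_def)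
  next
    case False
    then have "Pair z -` claim_set v f = {}" by (auto simp: claim_set_def)
    then show ?thesis using False by (simp add: g_eq)
  qed
  have "(\<integral>\<^sup>+z. ennreal (g z) \<partial>claim_law i) = ennreal (LINT z|claim_law i. g z)"
    by (intro nn_integral_eq_integral integrable_claim_law[of _ 1]) (use g01 in \<open>auto simp: abs_le_iff intro: order_trans\<close>)
  then have "emeasure (P i) (claim_event i h (claim_set v f)) =
    ennreal (transition i i h * (\<alpha> i * h * exp (- \<alpha> i * h)) * (LINT z|claim_law i. g z))"
    unfolding claim_event(2)[OF h W] cut using \<alpha>_pos[of i] h g01
    by (subst ennreal_mult) (auto simp: transition_def intro!: integral_nonneg_AE)
  moreover have "0 \<le> transition i i h * (\<alpha> i * h * exp (- \<alpha> i * h)) * (LINT z|claim_law i. g z)"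
    using \<alpha>_pos[of i] h g01 by (auto simp: transition_def intro!: mult_nonneg_nonneg integral_nonneg_AE)
  ultimately show "measure (P i) (claim_event i h (claim_set v f)) =
      transition i i h * (\<alpha> i * h * exp (- \<alpha> i * h)) * (LINT z|claim_law i. g z)"
    by (simp add: M.emeasure_eq_measure)
qed

section \<open>Effect of a short step on survival\<close>

definition typical :: "'s \<Rightarrow> real \<Rightarrow> 'w \<Rightarrow> bool" where
  "typical i h w \<longleftrightarrow> w \<in> space (P i) \<and> J 0 w = i \<and> single_jump (\<lambda>t. J t w) i h"

text \<open>With at most one jump, which would have to lead away from \<open>i\<close>, being in
  \<open>i\<close> at time \<open>h\<close> means that there was none.\<close>

lemma typical_constant:
  assumes "typical i h w" "J h w = i" "0 < h"
  shows "\<forall>s\<in>{0..h}. env_path w s = i"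
  using assms unfolding typical_def single_jump_def by (auto simp: env_path_apply)

lemma typical_jump:
  assumes "typical i h w" "J h w = k" "k \<noteq> i" "0 < h"
  obtains r where "0 < r" "r \<le> h" "\<forall>s\<in>{0..<r}. env_path w s = i" "\<forall>s\<in>{r..h}. env_path w s = k"
proof -
  have "\<not> (\<forall>s\<in>{0..h}. J s w = i)" using assms(2,3,4) by auto
  then obtain r l where r: "0 < r" "r \<le> h" "\<forall>s\<in>{0..<r}. J s w = i" "\<forall>s\<in>{r..h}. J s w = l"
    using assms(1) unfolding typical_def single_jump_def by blast
  have "l = k" using r assms(2) by auto
  with r show ?thesis using that[of r] by (auto simp: env_path_apply)
qed

lemma strict_mono_T: "w \<in> space (P i) \<Longrightarrow> strict_mono (\<lambda>n. T j n w)"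
  using arrival_sequence_T[of w i j] by (simp add: arrival_sequence_def)

lemma marks_none_before: "marks w j \<in> none_before h \<longleftrightarrow> passage (\<lambda>n. T j n w) h 0"
  by (simp add: none_before_def arrival_time_marks)

lemma marks_one_before: "marks w j \<in> one_before h C \<longleftrightarrow> passage (\<lambda>n. T j n w) h 1 \<and> Z j 0 w \<in> C"
  by (simp add: one_before_def arrival_time_marks) (simp add: marks_def mark_def)

lemma typical_space: "typical i h w \<Longrightarrow> w \<in> space (P i)" by (simp add: typical_def)

lemma config_shift_in_space: "w \<in> space (P i) \<Longrightarrow> 0 \<le> h \<Longrightarrow> config_shift h (config w) \<in> space config_space"
  by (rule measurable_space[OF measurable_config_shift measurable_space[OF measurable_config]])

context
  fixes i :: 's and h u :: real and w :: 'w
  assumes h: "0 < h" and u: "0 \<le> u" and w: "typical i h w"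
begin

text \<open>The one scenario in which the capital at time \<open>h\<close> is known exactly;
  accordingly an equivalence is obtained here and one-sided implications in the other
  scenarios.\<close>

lemma typical_no_event:
  assumes "J h w = i" "marks w i \<in> none_before h"
  shows "config w \<in> survival_set u \<longleftrightarrow> config_shift h (config w) \<in> survival_set (U i u h)"
proof -
  note ws = typical_space[OF w]
  have "\<xi> u h w = U i u h" "\<forall>r\<in>{0..h}. 0 \<le> \<xi> u r w"
    using capital_path_no_event[OF env_capital[OF u ws] u _ typical_constant[OF w assms(1) h]]
      strict_mono_T[OF ws] assms(2) h by (auto simp: marks_none_before)
  then show ?thesis
    using nonruin_iff_survival[OF u ws] nonruin_iff_shift_survival[OF u ws, of h] h by simp
qed

lemma typical_one_jump:
  assumes "J h w = k" "k \<noteq> i" "\<forall>j. marks w j \<in> none_before h"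
  shows "config_shift h (config w) \<in> survival_set u \<Longrightarrow> config w \<in> survival_set u"
    and "config w \<in> survival_set u \<Longrightarrow> config_shift h (config w) \<in> survival_set (U k (U i u h) h)"
proof -
  note ws = typical_space[OF w]
  obtain r where r: "0 < r" "r \<le> h" "\<forall>s\<in>{0..<r}. env_path w s = i" "\<forall>s\<in>{r..h}. env_path w s = k"
    using typical_jump[OF w assms(1,2) h] by blast
  have c: "u \<le> \<xi> u h w" "\<xi> u h w \<le> U k (U i u h) h" "\<forall>r\<in>{0..h}. 0 \<le> \<xi> u r w"
    using capital_path_one_jump[OF env_capital[OF u ws] u r] strict_mono_T[OF ws] assms(3)
    by (auto simp: marks_none_before)
  have "config w \<in> survival_set u \<longleftrightarrow> config_shift h (config w) \<in> survival_set (\<xi> u h w)"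
    using nonruin_iff_survival[OF u ws] nonruin_iff_shift_survival[OF u ws _ c(3)] h by simp
  then show "config_shift h (config w) \<in> survival_set u \<Longrightarrow> config w \<in> survival_set u"
    "config w \<in> survival_set u \<Longrightarrow> config_shift h (config w) \<in> survival_set (U k (U i u h) h)"
    using survival_set_mono[OF u c(1)] survival_set_mono[OF _ c(2)] c(1) u by auto
qed

lemma typical_one_claim:
  assumes "J h w = i" "marks w i \<in> one_before h UNIV"
  shows "Z i 0 w \<le> u \<Longrightarrow> config_shift h (config w) \<in> survival_set (u - Z i 0 w) \<Longrightarrow> config w \<in> survival_set u"
    and "config w \<in> survival_set u \<Longrightarrow> Z i 0 w \<le> U i u h \<and>
      config_shift h (config w) \<in> survival_set (U i (U i u h - Z i 0 w) h)"
proof -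
  note ws = typical_space[OF w]
  have pass: "passage (\<lambda>n. T i n w) h 1" using assms(2) by (simp add: marks_one_before)
  note c = capital_path_one_claim[OF env_capital[OF u ws] u _ typical_constant[OF w assms(1) h],
      OF less_imp_le[OF h] arrival_sequence_T[OF ws] pass]
  {
    assume z: "Z i 0 w \<le> u" and s: "config_shift h (config w) \<in> survival_set (u - Z i 0 w)"
    have a: "\<forall>r\<in>{0..h}. 0 \<le> \<xi> u r w" "u - Z i 0 w \<le> \<xi> u h w" using c(1)[OF z] by auto
    have "config_shift h (config w) \<in> survival_set (\<xi> u h w)"
      using survival_set_mono[OF _ a(2)] z s by auto
    then show "config w \<in> survival_set u"
      using nonruin_iff_survival[OF u ws] nonruin_iff_shift_survival[OF u ws _ a(1)] h by simp
  next
    assume s: "config w \<in> survival_set u"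
    then have nn: "\<forall>r\<in>{0..h}. 0 \<le> \<xi> u r w" using nonruin_iff_survival[OF u ws] by simp
    have a: "Z i 0 w \<le> U i u h" "\<xi> u h w \<le> U i (U i u h - Z i 0 w) h" using c(2)[OF nn] by auto
    have "config_shift h (config w) \<in> survival_set (\<xi> u h w)"
      using s nonruin_iff_survival[OF u ws] nonruin_iff_shift_survival[OF u ws _ nn] h by simp
    moreover have "0 \<le> \<xi> u h w" using nn h by simp
    ultimately show "Z i 0 w \<le> U i u h \<and> config_shift h (config w) \<in> survival_set (U i (U i u h - Z i 0 w) h)"
      using survival_set_mono[OF _ a(2)] a(1) by auto
  }
qed

end

text \<open>The null set of samples with a wrong initial state is added to the exceptional set of
  \<open>double_jump_bound\<close>.\<close>

lemma atypical_bound: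
  assumes h: "0 < h"
  obtains B where "B \<in> sets (P i)" "measure (P i) B \<le> (\<Sum>k\<in>UNIV. lam k) * lam i * h\<^sup>2"
    "\<And>w. w \<in> space (P i) \<Longrightarrow> w \<notin> B \<Longrightarrow> typical i h w"
proof -
  interpret M: prob_space "P i" by (rule prob_space_P)
  obtain B where B: "B \<in> sets (P i)" "measure (P i) B \<le> (\<Sum>k\<in>UNIV. lam k) * lam i * h\<^sup>2"
    "\<And>w. w \<in> space (P i) \<Longrightarrow> J 0 w = i \<Longrightarrow> w \<notin> B \<Longrightarrow> single_jump (\<lambda>t. J t w) i h"
    using double_jump_bound[OF h, of i] by blast
  define N where "N = space (P i) - {w\<in>space (P i). J 0 w = i}"
  have N: "N \<in> sets (P i)" unfolding N_def using J_event[of 0 i i] by auto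
  have "measure (P i) N = 0"
    unfolding N_def using M.prob_compl[OF J_event[of 0 i i]] M.prob_Collect_eq_1[OF J_event[of 0 i i]] J_initial[of i] by simp
  then have "measure (P i) (B \<union> N) \<le> (\<Sum>k\<in>UNIV. lam k) * lam i * h\<^sup>2"
    using measure_Un_le[OF B(1) N] B(2) by simp
  then show ?thesis using that[of "B \<union> N"] B N by (auto simp: typical_def N_def)
qed

lemma surv_eq_prob: "surv i u = measure (P i) {w\<in>space (P i). config w \<in> survival_set u}"
proof -
  have "{w\<in>space (P i). config w \<in> survival_set u} = config -` survival_set u \<inter> space (P i)" by blast
  then show ?thesis unfolding surv_def distr_config[symmetric] by (simp only: measure_distr[OF measurable_config sets_survival_set])
qed

lemma sets_survival_event: "{w\<in>space (P i). config w \<in> survival_set u} \<in> sets (P i)"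
proof -
  have "{w\<in>space (P i). config w \<in> survival_set u} = config -` survival_set u \<inter> space (P i)" by blast
  then show ?thesis by (simp only: measurable_sets[OF measurable_config sets_survival_set])
qed

text \<open>Disjoint scenarios that guarantee survival outside the atypical set \<open>B\<close>:
  silence of flow \<open>i\<close> without a change of state, a jump with all flows silent, and one
  claim of size at most \<open>u\<close>. While the state stays \<open>i\<close> only flow
  \<open>i\<close> matters; a jump at an unknown time is made harmless by silencing all
  flows.\<close>

lemma one_step_lower:
  assumes h: "0 < h" and u: "0 \<le> u"
  shows "transition i i h * exp (- \<alpha> i * h) * surv i (U i u h)
    + (\<Sum>k\<in>UNIV - {i}. transition i k h * exp (- (\<Sum>j\<in>UNIV. \<alpha> j) * h) * surv k u)
    + transition i i h * (\<alpha> i * h * exp (- \<alpha> i * h)) * claim_surv i u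
    - (\<Sum>k\<in>UNIV. lam k) * lam i * h\<^sup>2 \<le> surv i u"
proof -
  interpret M: prob_space "P i" by (rule prob_space_P)
  obtain B where B: "B \<in> sets (P i)" "measure (P i) B \<le> (\<Sum>k\<in>UNIV. lam k) * lam i * h\<^sup>2"
    "\<And>w. w \<in> space (P i) \<Longrightarrow> w \<notin> B \<Longrightarrow> typical i h w"
    using atypical_bound[OF h, of i] by blast
  have h0: "0 \<le> h" using h by simp
  define NR where "NR = {w\<in>space (P i). config w \<in> survival_set u}"
  define A0 where "A0 = (\<lambda>j. if j = i then none_before h else UNIV)"
  define E0 where "E0 = restart_event i h i A0 (survival_set (U i u h))"
  define E where "E k = restart_event i h k (\<lambda>_. none_before h) (survival_set u)" for k
  define E1 where "E1 = claim_event i h (claim_set u (\<lambda>z. u - z))"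
  have s0: "E0 \<in> sets (P i)" unfolding E0_def A0_def
    by (rule restart_event(1)[OF h0 _ sets_survival_set]) (auto simp: sets_none_before UNIV_flow_space)
  have m0: "measure (P i) E0 = transition i i h * exp (- \<alpha> i * h) * surv i (U i u h)"
    unfolding E0_def A0_def surv_def by (rule prob_restart_none_at[OF h0 sets_survival_set])
  have sE: "E k \<in> sets (P i)" for k unfolding E_def
    by (rule restart_event(1)[OF h0 sets_none_before sets_survival_set])
  have mE: "measure (P i) (E k) = transition i k h * exp (- (\<Sum>j\<in>UNIV. \<alpha> j) * h) * surv k u" for k
    unfolding E_def surv_def by (rule prob_restart_none[OF h0 sets_survival_set])
  have "surv0 i (u - z) = (if z \<le> u then surv i (u - z) else 0)" for z by (simp add: surv0_def)
  note pc = prob_claim_set[OF h0, of "\<lambda>z. u - z" "\<lambda>z. surv0 i (u - z)" u i, OF _ _ this]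
  have s1: "E1 \<in> sets (P i)" unfolding E1_def by (rule pc(1)) auto
  have m1: "measure (P i) E1 = transition i i h * (\<alpha> i * h * exp (- \<alpha> i * h)) * claim_surv i u"
    unfolding E1_def claim_surv_def by (rule pc(2)) auto
  let ?X = "\<Union>k\<in>UNIV - {i}. E k"
  have sX: "?X \<in> sets (P i)" using sE by (intro sets.finite_UN) auto
  have mX: "measure (P i) ?X = (\<Sum>k\<in>UNIV - {i}. measure (P i) (E k))"
    using sE by (intro M.finite_measure_finite_Union) (auto simp: disjoint_family_on_def E_def restart_event_def)
  have d1: "E0 \<inter> ?X = {}" by (auto simp: E0_def E_def restart_event_def)
  \<comment> \<open>\<open>E0\<close> and \<open>E1\<close> differ in the number of arrivals of flow
    \<open>i\<close>, and every \<open>E k\<close> differs from both in the state at time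
    \<open>h\<close>.\<close>
  have d2: "(E0 \<union> ?X) \<inter> E1 = {}"
  proof -
    have "\<not> (marks w i \<in> none_before h \<and> marks w i \<in> one_before h UNIV)" for w
      unfolding marks_none_before marks_one_before using passage_unique by fastforce
    moreover have "J h w = i \<and> marks w i \<in> one_before h UNIV" if "w \<in> E1" for w
      using that unfolding E1_def claim_event_def by blast
    moreover have "marks w i \<in> none_before h" if "w \<in> E0" for w
      using that unfolding E0_def A0_def restart_event_def by (auto dest: spec[of _ i])
    moreover have "J h w \<noteq> i" if "w \<in> ?X" for w
      using that unfolding E_def restart_event_def by blast
    ultimately show ?thesis by blast
  qed
  have "measure (P i) (E0 \<union> ?X \<union> E1) = measure (P i) E0 + (\<Sum>k\<in>UNIV - {i}. measure (P i) (E k)) + measure (P i) E1"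
    using M.finite_measure_Union[OF _ s1 d2] M.finite_measure_Union[OF s0 sX d1] s0 sX mX by simp
  moreover have "E0 \<union> ?X \<union> E1 \<subseteq> NR \<union> B"
  proof
    fix w assume w: "w \<in> E0 \<union> ?X \<union> E1"
    then have ws: "w \<in> space (P i)" using s0 sX s1 sets.sets_into_space by blast
    show "w \<in> NR \<union> B"
    proof (rule ccontr)
      assume n: "w \<notin> NR \<union> B"
      then have t: "typical i h w" using B(3) ws by blast
      have "config w \<in> survival_set u"
      proof -
        consider "w \<in> E0" | k where "k \<noteq> i" "w \<in> E k" | "w \<in> E1" using w by blast
        then show ?thesis
        proof cases
          case 1
          then have "J h w = i" "marks w i \<in> none_before h" "config_shift h (config w) \<in> survival_set (U i u h)"
            unfolding E0_def A0_def restart_event_def by (auto dest: spec[of _ i])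
          then show ?thesis using typical_no_event[OF h u t] by simp
        next
          case 2
          then show ?thesis using typical_one_jump(1)[OF h u t, of k] by (simp add: E_def restart_event_def)
        next
          case 3
          then have "J h w = i" "marks w i \<in> one_before h UNIV" "Z i 0 w \<le> u"
            "config_survives U (u - Z i 0 w) (config_shift h (config w))"
            unfolding E1_def claim_event_def claim_set_def by auto
          then show ?thesis using typical_one_claim(1)[OF h u t] config_shift_in_space[OF ws h0]
            by (simp add: survival_set_def)
        qed
      qed
      then show False using n ws by (simp add: NR_def)
    qed
  qed
  then have "measure (P i) (E0 \<union> ?X \<union> E1) \<le> measure (P i) (NR \<union> B)"
    using sets_survival_event B(1) by (intro M.finite_measure_mono) (auto simp: NR_def)
  moreover have "measure (P i) (NR \<union> B) \<le> surv i u + measure (P i) B"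
    unfolding surv_eq_prob NR_def by (rule measure_Un_le[OF sets_survival_event B(1)])
  ultimately show ?thesis using m0 mE m1 B(2) by simp
qed

lemma prob_marks:
  assumes "A \<in> sets flow_space"
  shows "{w\<in>space (P i). marks w j \<in> A} \<in> sets (P i)"
    "measure (P i) {w\<in>space (P i). marks w j \<in> A} = measure (flow_law (\<alpha> j) (claim_law j)) A"
proof -
  have "{w\<in>space (P i). marks w j \<in> A} = (\<lambda>w. marks w j) -` A \<inter> space (P i)" by blast
  then show "{w\<in>space (P i). marks w j \<in> A} \<in> sets (P i)"
    "measure (P i) {w\<in>space (P i). marks w j \<in> A} = measure (flow_law (\<alpha> j) (claim_law j)) A"
    unfolding distr_marks[of i j, symmetric]
    by (simp_all only: measurable_sets[OF measurable_marks assms] measure_distr[OF measurable_marks assms])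
qed

lemma prob_many_claims:
  assumes h: "0 \<le> h"
  shows "{w\<in>space (P i). marks w i \<notin> none_before h \<and> marks w i \<notin> one_before h UNIV} \<in> sets (P i)"
    "measure (P i) {w\<in>space (P i). marks w i \<notin> none_before h \<and> marks w i \<notin> one_before h UNIV} =
      1 - exp (- \<alpha> i * h) - \<alpha> i * h * exp (- \<alpha> i * h)"
proof -
  interpret M: prob_space "P i" by (rule prob_space_P)
  interpret S: prob_space "flow_law (\<alpha> i) (claim_law i)" by (rule prob_space_flow_law)
  interpret C: prob_space "claim_law i" by (rule prob_space_claim_law)
  let ?N = "{w\<in>space (P i). marks w i \<in> none_before h}" and ?O = "{w\<in>space (P i). marks w i \<in> one_before h UNIV}"
  have s: "?N \<in> sets (P i)" "?O \<in> sets (P i)"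
    by (rule prob_marks(1)[OF sets_none_before], rule prob_marks(1)[OF sets_one_before]) simp
  have eq: "{w\<in>space (P i). marks w i \<notin> none_before h \<and> marks w i \<notin> one_before h UNIV} = space (P i) - (?N \<union> ?O)"
    by blast
  show "{w\<in>space (P i). marks w i \<notin> none_before h \<and> marks w i \<notin> one_before h UNIV} \<in> sets (P i)"
    unfolding eq using s by (intro sets.compl_sets sets.Un)
  have U1: "emeasure (flow_law (\<alpha> i) (claim_law i)) UNIV = 1" using S.emeasure_space_1 by (simp add: space_flow_law)
  have C1: "emeasure (claim_law i) UNIV = 1" using C.emeasure_space_1 by (simp add: claim_law_def)
  have "measure (P i) ?N = exp (- \<alpha> i * h)"
    using emeasure_flow_shift_none[OF h UNIV_flow_space, of i] U1
    by (simp add: prob_marks(2)[OF sets_none_before] S.emeasure_eq_measure)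
  moreover have "measure (P i) ?O = \<alpha> i * h * exp (- \<alpha> i * h)"
    using emeasure_flow_shift_one[OF h UNIV_flow_space, of UNIV i] U1 C1 \<alpha>_pos[of i] h
    by (simp add: prob_marks(2)[OF sets_one_before] S.emeasure_eq_measure)
  moreover have "?N \<inter> ?O = {}"
    unfolding marks_none_before marks_one_before using passage_unique by fastforce
  ultimately show "measure (P i) {w\<in>space (P i). marks w i \<notin> none_before h \<and> marks w i \<notin> one_before h UNIV} =
      1 - exp (- \<alpha> i * h) - \<alpha> i * h * exp (- \<alpha> i * h)"
    unfolding eq using M.prob_compl[OF sets.Un[OF s]] M.finite_measure_Union[OF s] by simp
qed

text \<open>A covering instead of a disjoint union. Besides the scenarios of the lower estimate, now
  with the largest possible capital, it needs \<open>G k\<close>, a change to state \<open>k\<close>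
  together with an arrival in some flow, and \<open>N2\<close>, at least two arrivals in flow
  \<open>i\<close>; for \<open>k\<close> other than \<open>i\<close> both have probability of
  smaller order than \<open>h\<close>.\<close>

lemma one_step_upper:
  fixes i :: 's and h u :: real
  assumes h: "0 < h" and u: "0 \<le> u"
  defines "v \<equiv> U i u h"
  shows "surv i u \<le> transition i i h * exp (- \<alpha> i * h) * surv i v
    + (\<Sum>k\<in>UNIV - {i}. transition i k h * surv k (U k v h) + transition i k h * (1 - exp (- (\<Sum>j\<in>UNIV. \<alpha> j) * h)))
    + transition i i h * (\<alpha> i * h * exp (- \<alpha> i * h)) * (LINT z|claim_law i. (if z \<le> v then surv i (U i (v - z) h) else 0))
    + (\<Sum>k\<in>UNIV. lam k) * lam i * h\<^sup>2 + (1 - exp (- \<alpha> i * h) - \<alpha> i * h * exp (- \<alpha> i * h))"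
proof -
  interpret M: prob_space "P i" by (rule prob_space_P)
  obtain B where B: "B \<in> sets (P i)" "measure (P i) B \<le> (\<Sum>k\<in>UNIV. lam k) * lam i * h\<^sup>2"
    "\<And>w. w \<in> space (P i) \<Longrightarrow> w \<notin> B \<Longrightarrow> typical i h w"
    using atypical_bound[OF h, of i] by blast
  have h0: "0 \<le> h" using h by simp
  define NR where "NR = {w\<in>space (P i). config w \<in> survival_set u}"
  define A0 where "A0 = (\<lambda>j. if j = i then none_before h else UNIV)"
  define E0 where "E0 = restart_event i h i A0 (survival_set v)"
  define E where "E k = restart_event i h k (\<lambda>_. UNIV) (survival_set (U k v h))" for k
  define G where "G k = restart_event i h k (\<lambda>_. UNIV) (space config_space) - restart_event i h k (\<lambda>_. none_before h) (space config_space)" for k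
  \<comment> \<open>The truncation makes \<open>f\<close> a measurable function on the whole line.
    Membership in \<open>claim_set v f\<close> requires a claim of at most \<open>v\<close>, where
    the truncation changes nothing.\<close>
  define f where "f z = U i (max 0 (v - z)) h" for z
  define E1 where "E1 = claim_event i h (claim_set v f)"
  define N2 where "N2 = {w\<in>space (P i). marks w i \<notin> none_before h \<and> marks w i \<notin> one_before h UNIV}"
  have s0: "E0 \<in> sets (P i)" unfolding E0_def A0_def
    by (rule restart_event(1)[OF h0 _ sets_survival_set]) (auto simp: sets_none_before UNIV_flow_space)
  have m0: "measure (P i) E0 = transition i i h * exp (- \<alpha> i * h) * surv i v"
    unfolding E0_def A0_def surv_def by (rule prob_restart_none_at[OF h0 sets_survival_set])
  have sE: "E k \<in> sets (P i)" for k unfolding E_def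
    by (rule restart_event(1)[OF h0 UNIV_flow_space sets_survival_set])
  have mE: "measure (P i) (E k) = transition i k h * surv k (U k v h)" for k
    unfolding E_def surv_def by (rule prob_restart_all[OF h0 sets_survival_set])
  note r1 = restart_event(1)[OF h0 UNIV_flow_space sets.top] and r2 = restart_event(1)[OF h0 sets_none_before sets.top]
  have sG: "G k \<in> sets (P i)" for k unfolding G_def by (intro sets.Diff r1 r2)
  have mG: "measure (P i) (G k) = transition i k h * (1 - exp (- (\<Sum>j\<in>UNIV. \<alpha> j) * h))" for k
  proof -
    interpret L: prob_space "config_law k" by (rule prob_space_config_law)
    have one: "measure (config_law k) (space config_space) = 1"
      using L.prob_space sets_eq_imp_space_eq[OF sets_config_law[of k]] by simp
    have "measure (P i) (G k) = measure (P i) (restart_event i h k (\<lambda>_. UNIV) (space config_space)) -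
      measure (P i) (restart_event i h k (\<lambda>_. none_before h) (space config_space))"
      unfolding G_def by (rule M.finite_measure_Diff[OF r1 r2]) (auto simp: restart_event_def)
    then show ?thesis
      using prob_restart_all[OF h0 sets.top, of i k] prob_restart_none[OF h0 sets.top, of i k] one by (simp add: algebra_simps)
  qed
  have fm: "f \<in> borel_measurable borel" unfolding f_def[abs_def] by (rule measurable_U) (use h0 in auto)
  define g where "g z = (if z \<le> v then surv i (U i (v - z) h) else 0)" for z
  have geq: "g z = (if z \<le> v then surv i (f z) else 0)" for z by (simp add: g_def f_def)
  have gm: "g \<in> borel_measurable borel"
  proof -
    have "g z = (if z \<le> v then surv0 i (f z) else 0)" for z
      unfolding geq f_def surv0_def using U_nonneg[of "max 0 (v - z)" h i] h0 by auto
    then have "g = (\<lambda>z. if z \<le> v then surv0 i (f z) else 0)" by (rule ext)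
    then show ?thesis using fm by simp
  qed
  note pc = prob_claim_set[OF h0 fm gm geq]
  have s1: "E1 \<in> sets (P i)" unfolding E1_def by (rule pc(1))
  have m1: "measure (P i) E1 = transition i i h * (\<alpha> i * h * exp (- \<alpha> i * h)) * (LINT z|claim_law i. g z)"
    unfolding E1_def by (rule pc(2))
  note s2 = prob_many_claims(1)[OF h0, of i, folded N2_def] and m2 = prob_many_claims(2)[OF h0, of i, folded N2_def]
  let ?X = "\<Union>k\<in>UNIV - {i}. E k \<union> G k"
  have sX: "?X \<in> sets (P i)" using sE sG by (intro sets.finite_UN) auto
  have "NR \<subseteq> E0 \<union> ?X \<union> E1 \<union> B \<union> N2"
  proof
    fix w assume w: "w \<in> NR"
    then have ws: "w \<in> space (P i)" and sv: "config w \<in> survival_set u" by (auto simp: NR_def)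
    note cs = config_shift_in_space[OF ws h0]
    show "w \<in> E0 \<union> ?X \<union> E1 \<union> B \<union> N2"
    proof (cases "w \<in> B")
      case False
      then have t: "typical i h w" using B(3) ws by blast
      show ?thesis
      proof (cases "J h w = i")
        case True
        consider "marks w i \<in> none_before h" | "marks w i \<in> one_before h UNIV" | "w \<in> N2" using ws by (auto simp: N2_def)
        then show ?thesis
        proof cases
          case 1
          then have "w \<in> E0" using typical_no_event[OF h u t True 1] sv True ws
            by (auto simp: E0_def A0_def restart_event_def v_def)
          then show ?thesis by blast
        next
          case 2
          have "Z i 0 w \<le> v" "config_shift h (config w) \<in> survival_set (U i (v - Z i 0 w) h)"
            using typical_one_claim(2)[OF h u t True 2 sv] by (auto simp: v_def)
          then have "w \<in> E1" using ws True 2 cs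
            by (auto simp: E1_def claim_event_def claim_set_def f_def space_pair_measure survival_set_def)
          then show ?thesis by blast
        qed blast
      next
        case k: False
        show ?thesis
        proof (cases "\<forall>j. marks w j \<in> none_before h")
          case True
          have "config_shift h (config w) \<in> survival_set (U (J h w) v h)"
            using typical_one_jump(2)[OF h u t refl k True sv] by (simp add: v_def)
          then have "w \<in> E (J h w)" using ws by (auto simp: E_def restart_event_def)
          then show ?thesis using k by blast
        next
          case False
          then have "w \<in> G (J h w)" using ws cs by (simp add: G_def restart_event_def)
          then show ?thesis using k by blast
        qed
      qed
    qed blast
  qed
  then have "surv i u \<le> measure (P i) (E0 \<union> ?X \<union> E1 \<union> B \<union> N2)"
    unfolding surv_eq_prob NR_def[symmetric] using s0 sX s1 B(1) s2 by (intro M.finite_measure_mono) auto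
  also have "\<dots> \<le> measure (P i) E0 + measure (P i) ?X + measure (P i) E1 + measure (P i) B + measure (P i) N2"
  proof -
    have "measure (P i) (E0 \<union> ?X \<union> E1 \<union> B \<union> N2) \<le> measure (P i) (E0 \<union> ?X \<union> E1 \<union> B) + measure (P i) N2"
      using s0 sX s1 B(1) s2 by (intro measure_Un_le) auto
    also have "measure (P i) (E0 \<union> ?X \<union> E1 \<union> B) \<le> measure (P i) (E0 \<union> ?X \<union> E1) + measure (P i) B"
      using s0 sX s1 B(1) s2 by (intro measure_Un_le) auto
    also have "measure (P i) (E0 \<union> ?X \<union> E1) \<le> measure (P i) (E0 \<union> ?X) + measure (P i) E1"
      using s0 sX s1 B(1) s2 by (intro measure_Un_le) auto
    also have "measure (P i) (E0 \<union> ?X) \<le> measure (P i) E0 + measure (P i) ?X"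
      using s0 sX s1 B(1) s2 by (intro measure_Un_le) auto
    finally show ?thesis by simp
  qed
  also have "measure (P i) ?X \<le> (\<Sum>k\<in>UNIV - {i}. measure (P i) (E k \<union> G k))"
    using sE sG by (intro M.finite_measure_subadditive_finite) auto
  also have "\<dots> \<le> (\<Sum>k\<in>UNIV - {i}. measure (P i) (E k) + measure (P i) (G k))"
    using sE sG by (intro sum_mono measure_Un_le)
  finally show ?thesis using B(2) unfolding m0 m1 mE mG m2 g_def by simp
qed

end

section \<open>The integral equation\<close>

text \<open>The fixed error \<open>\<epsilon> h\<close> is paid in each of the \<open>n\<close>
  steps, but the increments of \<open>r\<close> only once in total.\<close>

lemma telescoping_bound:
  fixes D r :: "real \<Rightarrow> real"
  assumes step: "\<And>t h. 0 \<le> t \<Longrightarrow> 0 < h \<Longrightarrow> \<bar>D (t + h) - D t\<bar> \<le> h * (r (t + h) - r t) + \<epsilon> h"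
    and h: "0 < h"
  shows "\<bar>D (real n * h) - D 0\<bar> \<le> h * (r (real n * h) - r 0) + real n * \<epsilon> h"
proof (induction n)
  case (Suc n)
  have "real (Suc n) * h = real n * h + h" by (simp add: algebra_simps)
  moreover have "\<bar>D (real n * h + h) - D (real n * h)\<bar> \<le> h * (r (real n * h + h) - r (real n * h)) + \<epsilon> h"
    using h by (intro step) auto
  ultimately show ?case using Suc by (simp add: algebra_simps)
qed simp

text \<open>Up to small errors, both the discounted change of \<open>g\<close> over a step and the
  integral of the source over it are trapped between the values of \<open>r\<close> at the two ends
  of the step. Monotonicity of \<open>r\<close> thus stands in for continuity. The boundary term at
  infinity vanishes because \<open>g\<close> is bounded.\<close>

lemma discrete_renewal_equation:
  fixes g r E :: "real \<Rightarrow> real" and \<beta> b :: real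
  assumes \<beta>: "0 < \<beta>" and g: "\<And>t. 0 \<le> t \<Longrightarrow> 0 \<le> g t \<and> g t \<le> 1"
    and r: "\<And>t. 0 \<le> t \<Longrightarrow> 0 \<le> r t \<and> r t \<le> b" and r_mono: "\<And>s t. 0 \<le> s \<Longrightarrow> s \<le> t \<Longrightarrow> r s \<le> r t"
    and lower: "\<And>t h. 0 \<le> t \<Longrightarrow> 0 < h \<Longrightarrow> h * r t - E h \<le> g t - exp (- \<beta> * h) * g (t + h)"
    and upper: "\<And>t h. 0 \<le> t \<Longrightarrow> 0 < h \<Longrightarrow> g t - exp (- \<beta> * h) * g (t + h) \<le> h * r (t + h) + E h"
    and E: "((\<lambda>h. E h / h) \<longlongrightarrow> 0) (at_right 0)"
  shows "g 0 = (LBINT t:{0..}. exp (- t * \<beta>) * r t)"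
proof -
  \<comment> \<open>Continued constantly to negative times, \<open>r\<close> is monotone on the
    whole line and therefore measurable.\<close>
  define r' where "r' t = r (max 0 t)" for t
  have "mono r'" unfolding r'_def by (intro monoI r_mono) auto
  then have [measurable]: "r' \<in> borel_measurable borel" by (rule borel_measurable_mono)
  define f where "f t = indicator {0..} t * (exp (- t * \<beta>) * r' t)" for t :: real
  have [measurable]: "f \<in> borel_measurable borel" unfolding f_def[abs_def] by measurable
  have b0: "0 \<le> b" using r[of 0] by auto
  have r'b: "0 \<le> r' t" "r' t \<le> b" for t using r[of "max 0 t"] by (auto simp: r'_def)
  have int: "integrable lborel f"
  proof (rule Bochner_Integration.integrable_bound)
    interpret Ex: prob_space "density lborel (exponential_density \<beta>)" by (rule prob_space_exponential_density[OF \<beta>])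
    \<comment> \<open>The dominating function is \<open>b * exp (- \<beta> * t)\<close> on the
      half-line. Writing it as a multiple of the exponential density makes its integrability that of
      a constant under a probability measure.\<close>
    have "integrable (density lborel (exponential_density \<beta>)) (\<lambda>_. b / \<beta>)" by simp
    then show "integrable lborel (\<lambda>t. exponential_density \<beta> t * (b / \<beta>))"
      using \<beta> by (subst (asm) integrable_density) (auto simp: exponential_density_nonneg)
    show "AE t in lborel. norm (f t) \<le> norm (exponential_density \<beta> t * (b / \<beta>))"
      using \<beta> r'b b0 by (intro AE_I2) (auto simp: f_def exponential_density_def indicator_def abs_mult)
  qed simp
  define I where "I t = (LINT s|lborel. indicator {0<..t} s * f s)" for t :: real
  have intI: "integrable lborel (\<lambda>s. indicator A s * f s)" if "A \<in> sets borel" for A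
    using integrable_real_mult_indicator[OF _ int, of A] that by (simp add: mult.commute)
  have increment: "h * (exp (- (t + h) * \<beta>) * r t) \<le> I (t + h) - I t \<and> I (t + h) - I t \<le> h * (exp (- t * \<beta>) * r (t + h))"
    if t: "0 \<le> t" and h: "0 < h" for t h
  proof -
    have "I (t + h) - I t = (LINT s|lborel. indicator {0<..t+h} s * f s - indicator {0<..t} s * f s)"
      unfolding I_def by (rule Bochner_Integration.integral_diff[symmetric]) (auto intro!: intI)
    also have "\<dots> = (LINT s|lborel. indicator {t<..t+h} s * f s)"
      using t h by (intro Bochner_Integration.integral_cong) (auto simp: indicator_def)
    finally have inc: "I (t + h) - I t = (LINT s|lborel. indicator {t<..t+h} s * f s)" .
    have const: "(LINT s|lborel. indicator {t<..t+h} s * k) = h * k" "integrable lborel (\<lambda>s. indicator {t<..t+h} s * k)" for k :: real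
      using h by auto
    have "(LINT s|lborel. indicator {t<..t+h} s * (exp (- (t + h) * \<beta>) * r t)) \<le> (LINT s|lborel. indicator {t<..t+h} s * f s)"
    proof (rule integral_mono[OF const(2) intI])
      fix s
      have "exp (- (t + h) * \<beta>) * r t \<le> exp (- s * \<beta>) * r s" if "s \<in> {t<..t+h}"
      proof (intro mult_mono r_mono)
        have "s * \<beta> \<le> (t + h) * \<beta>" using that \<beta> by (intro mult_right_mono) auto
        then show "exp (- (t + h) * \<beta>) \<le> exp (- s * \<beta>)" by (simp add: algebra_simps)
      qed (use that t r[of t] in auto)
      then show "indicator {t<..t+h} s * (exp (- (t + h) * \<beta>) * r t) \<le> indicator {t<..t+h} s * f s"
        using t by (auto simp: indicator_def f_def r'_def)
    qed simp
    moreover have "(LINT s|lborel. indicator {t<..t+h} s * f s) \<le> (LINT s|lborel. indicator {t<..t+h} s * (exp (- t * \<beta>) * r (t + h)))"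
    proof (rule integral_mono[OF intI const(2)])
      fix s
      have "exp (- s * \<beta>) * r s \<le> exp (- t * \<beta>) * r (t + h)" if "s \<in> {t<..t+h}"
        using that t \<beta> r[of s] by (intro mult_mono r_mono) auto
      then show "indicator {t<..t+h} s * f s \<le> indicator {t<..t+h} s * (exp (- t * \<beta>) * r (t + h))"
        using t by (auto simp: indicator_def f_def r'_def)
    qed simp
    ultimately show ?thesis unfolding inc const(1) by blast
  qed
  define D where "D t = exp (- \<beta> * t) * g t + I t" for t
  \<comment> \<open>The term \<open>b * \<beta> * h\<^sup>2\<close> pays for the variation of the
    exponential weight within one step.\<close>
  have step: "\<bar>D (t + h) - D t\<bar> \<le> h * (r (t + h) - r t) + (\<bar>E h\<bar> + b * \<beta> * h\<^sup>2)" if t: "0 \<le> t" and h: "0 < h" for t h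
  proof -
    define e where "e = exp (- \<beta> * t)"
    have e: "0 < e" "e \<le> 1" using \<beta> t by (auto simp: e_def)
    have e2: "exp (- \<beta> * (t + h)) = e * exp (- \<beta> * h)" by (simp add: e_def exp_add[symmetric] algebra_simps)
    have e3: "exp (- (t + h) * \<beta>) = e * exp (- \<beta> * h)" "exp (- t * \<beta>) = e"
      by (simp_all add: e_def exp_add[symmetric] algebra_simps)
    define X where "X = g t - exp (- \<beta> * h) * g (t + h)"
    define Y where "Y = I (t + h) - I t"
    have DX: "D (t + h) - D t = Y - e * X" unfolding D_def e2 X_def Y_def by (simp add: e_def algebra_simps)
    have Y: "h * (e * exp (- \<beta> * h) * r t) \<le> Y" "Y \<le> h * (e * r (t + h))"
      using increment[OF t h] unfolding e3 Y_def by auto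
    have X: "h * r t - E h \<le> X" "X \<le> h * r (t + h) + E h"
      using lower[OF t h] upper[OF t h] unfolding X_def by auto
    have rr: "r t \<le> r (t + h)" "0 \<le> r t" "r t \<le> b" using r_mono[OF t, of "t + h"] r[OF t] h by auto
    have exph: "1 - \<beta> * h \<le> exp (- \<beta> * h)" using exp_ge_add_one_self[of "- \<beta> * h"] by simp
    have up: "Y - e * X \<le> e * (h * (r (t + h) - r t) + \<bar>E h\<bar>)"
    proof -
      have "e * (h * r t - E h) \<le> e * X" using X e by (intro mult_left_mono) auto
      moreover have "e * E h \<le> e * \<bar>E h\<bar>" using e by (intro mult_left_mono) auto
      ultimately show ?thesis using Y(2) by (simp add: algebra_simps)
    qed
    have lo: "- (e * (h * (r (t + h) - r t) + \<bar>E h\<bar> + b * \<beta> * h\<^sup>2)) \<le> Y - e * X"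
    proof -
      have "e * X \<le> e * (h * r (t + h) + E h)" using X e by (intro mult_left_mono) auto
      moreover have "e * E h \<le> e * \<bar>E h\<bar>" using e by (intro mult_left_mono) auto
      moreover have "h * e * r t - e * (b * \<beta> * h\<^sup>2) \<le> h * (e * exp (- \<beta> * h) * r t)"
      proof -
        have "h * e * r t * (1 - \<beta> * h) \<le> h * e * r t * exp (- \<beta> * h)"
          using exph e h rr by (intro mult_left_mono) auto
        moreover have "h * e * (\<beta> * h) * r t \<le> h * e * (\<beta> * h) * b"
          using e h rr \<beta> by (intro mult_left_mono) auto
        ultimately show ?thesis by (simp add: algebra_simps power2_eq_square)
      qed
      ultimately show ?thesis using Y(1) by (simp add: algebra_simps)
    qed
    define M where "M = h * (r (t + h) - r t) + \<bar>E h\<bar> + b * \<beta> * h\<^sup>2"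
    have M0: "0 \<le> h * (r (t + h) - r t) + \<bar>E h\<bar>" "0 \<le> b * \<beta> * h\<^sup>2" using h rr b0 \<beta> by auto
    have "e * (h * (r (t + h) - r t) + \<bar>E h\<bar>) \<le> M"
      using mult_right_mono[OF e(2) M0(1)] M0(2) by (simp add: M_def)
    moreover have "e * M \<le> M" using mult_right_mono[OF e(2), of M] M0 by (simp add: M_def)
    ultimately show ?thesis unfolding DX using up lo by (simp add: M_def abs_le_iff)
  qed
  have D0: "D t = D 0" if t: "0 < t" for t
  proof -
    \<comment> \<open>Steps of length \<open>t / real (Suc n)\<close> reach \<open>t\<close> exactly
      after \<open>Suc n\<close> steps, and their length tends to 0 with growing
      \<open>n\<close>.\<close>
    define q where "q n = t / real (Suc n)" for n
    have q0: "0 < q n" for n using t by (simp add: q_def)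
    have bound: "\<bar>D t - D 0\<bar> \<le> q n * b + t * (\<bar>E (q n) / q n\<bar> + b * \<beta> * q n)" for n
    proof -
      have nq: "real (Suc n) * q n = t" by (simp add: q_def)
      have "\<bar>D t - D 0\<bar> \<le> q n * (r t - r 0) + real (Suc n) * (\<bar>E (q n)\<bar> + b * \<beta> * (q n)\<^sup>2)"
        using telescoping_bound[where D=D and r=r and n="Suc n", OF step q0[of n]] unfolding nq .
      also have "q n * (r t - r 0) \<le> q n * b" using q0[of n] r[of t] r[of 0] t by (intro mult_left_mono) auto
      also have "real (Suc n) * (\<bar>E (q n)\<bar> + b * \<beta> * (q n)\<^sup>2) = (real (Suc n) * q n) * (\<bar>E (q n) / q n\<bar> + b * \<beta> * q n)"
        using q0[of n] by (simp add: field_simps power2_eq_square abs_divide)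
      finally show ?thesis unfolding nq by simp
    qed
    have qlim: "q \<longlonglongrightarrow> 0"
      using tendsto_mult[OF tendsto_const[of t] LIMSEQ_inverse_real_of_nat] by (simp add: q_def[abs_def] divide_inverse)
    have "filterlim q (at_right 0) sequentially"
      unfolding filterlim_at using qlim q0 by (auto intro!: always_eventually simp: less_imp_neq[symmetric])
    then have "(\<lambda>n. E (q n) / q n) \<longlonglongrightarrow> 0" by (rule filterlim_compose[OF E])
    then have "(\<lambda>n. q n * b + t * (\<bar>E (q n) / q n\<bar> + b * \<beta> * q n)) \<longlonglongrightarrow> 0 * b + t * (\<bar>0\<bar> + b * \<beta> * 0)"
      by (intro tendsto_intros qlim)
    then have "\<bar>D t - D 0\<bar> \<le> 0 * b + t * (\<bar>0\<bar> + b * \<beta> * 0)"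
      by (rule LIMSEQ_le_const) (use bound in auto)
    then show ?thesis by simp
  qed
  have I0: "I 0 = 0" by (simp add: I_def)
  have eq: "g 0 = exp (- \<beta> * real n) * g (real n) + I (real n)" for n :: nat
    using D0[of "real n"] I0 by (cases "n = 0") (auto simp: D_def)
  have "(\<lambda>n. exp (- \<beta> * real n) * g (real n)) \<longlonglongrightarrow> 0"
  proof (rule tendsto_sandwich[of "\<lambda>_. 0" _ _ "\<lambda>n. exp (- \<beta> * real n)"])
    have "(\<lambda>n. (exp (- \<beta>)) ^ n) \<longlonglongrightarrow> 0" using \<beta> by (intro LIMSEQ_power_zero) auto
    then show "(\<lambda>n. exp (- \<beta> * real n)) \<longlonglongrightarrow> 0" by (simp add: exp_of_nat_mult[symmetric] mult.commute)
  qed (use g in \<open>auto intro!: always_eventually mult_left_le\<close>)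
  moreover have "(\<lambda>n. I (real n)) \<longlonglongrightarrow> (LINT s|lborel. indicator {0<..} s * f s)"
    unfolding I_def
  proof (rule integral_dominated_convergence[where w="\<lambda>s. norm (f s)"])
    show "integrable lborel (\<lambda>s. norm (f s))" using int by simp
    show "AE s in lborel. (\<lambda>n. indicator {0<..real n} s * f s) \<longlonglongrightarrow> indicator {0<..} s * f s"
    proof (rule AE_I2)
      fix s :: real
      obtain N where N: "s \<le> real N" using real_arch_simple by blast
      have "\<forall>\<^sub>F n in sequentially. indicator {0<..real n} s * f s = indicator {0<..} s * f s"
        using eventually_ge_at_top[of N] by eventually_elim (use N in \<open>auto simp: indicator_def\<close>)
      then show "(\<lambda>n. indicator {0<..real n} s * f s) \<longlonglongrightarrow> indicator {0<..} s * f s"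
        by (rule tendsto_eventually)
    qed
  qed (auto simp: indicator_def)
  ultimately have "(\<lambda>n. exp (- \<beta> * real n) * g (real n) + I (real n)) \<longlonglongrightarrow> 0 + (LINT s|lborel. indicator {0<..} s * f s)"
    by (rule tendsto_add)
  then have "(\<lambda>n::nat. g 0) \<longlonglongrightarrow> (LINT s|lborel. indicator {0<..} s * f s)" unfolding eq[symmetric] by simp
  then have "g 0 = (LINT s|lborel. indicator {0<..} s * f s)" using LIMSEQ_unique tendsto_const by blast
  \<comment> \<open>Half-open intervals made the increments of \<open>I\<close> additive; restoring
    the end point 0 changes the integrand on a null set.\<close>
  also have "\<dots> = (LINT s|lborel. indicator {0..} s * (exp (- s * \<beta>) * r s))"
  proof (rule integral_cong_AE)
    have "AE s in lborel. s \<noteq> (0::real)" by (rule AE_lborel_singleton)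
    then show "AE s in lborel. indicator {0<..} s * f s = indicator {0..} s * (exp (- s * \<beta>) * r s)"
      by eventually_elim (auto simp: indicator_def f_def r'_def)
    have "(\<lambda>s. indicator {0..} s * (exp (- s * \<beta>) * r s)) = f"
      by (auto simp: fun_eq_iff f_def r'_def indicator_def)
    then show "(\<lambda>s. indicator {0..} s * (exp (- s * \<beta>) * r s)) \<in> borel_measurable lborel" by simp
  qed simp
  finally show ?thesis by (simp add: set_lebesgue_integral_def)
qed

lemma DERIV_zero_quotient:
  fixes f :: "real \<Rightarrow> real"
  assumes "(f has_real_derivative 0) (at 0)" "f 0 = 0"
  shows "((\<lambda>h. f h / h) \<longlongrightarrow> 0) (at_right 0)"
proof -
  have "((\<lambda>h. f h / h) \<longlongrightarrow> 0) (at 0)" using assms by (simp add: DERIV_def)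
  then show ?thesis by (rule tendsto_within_subset) simp
qed

lemma tendsto_h_at_right: "((\<lambda>h. h) \<longlongrightarrow> (0::real)) (at_right 0)"
  by (rule tendsto_ident_at)

context markov_environment_risk_process
begin

section \<open>First-order limits and error terms\<close>

lemma transition_bounds: "0 \<le> transition i k h" "transition i k h \<le> 1"
  unfolding transition_def using prob_space.prob_le_1[OF prob_space_P] by auto

lemma transition_stay_quotient: "((\<lambda>h. (transition i i h - (1 - lam i * h)) / h) \<longlongrightarrow> 0) (at_right 0)"
  using smalloD_tendsto[OF transition_stay_smallo] .

lemma transition_quotient: "i \<noteq> k \<Longrightarrow> ((\<lambda>h. (transition i k h - lam i * p i k * h) / h) \<longlongrightarrow> 0) (at_right 0)"
  using smalloD_tendsto[OF transition_smallo] .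

lemma positive_at_right: "(\<And>h. 0 < h \<Longrightarrow> f h = g h) \<Longrightarrow> \<forall>\<^sub>F h in at_right (0::real). f h = g h"
  by (auto simp: eventually_at_right_field intro!: exI[of _ 1])

lemma transition_rate: "i \<noteq> k \<Longrightarrow> ((\<lambda>h. transition i k h / h) \<longlongrightarrow> lam i * p i k) (at_right 0)"
proof -
  assume "i \<noteq> k"
  from tendsto_add[OF transition_quotient[OF this] tendsto_const[of "lam i * p i k"]]
  have "((\<lambda>h. (transition i k h - lam i * p i k * h) / h + lam i * p i k) \<longlongrightarrow> lam i * p i k) (at_right 0)" by simp
  then show ?thesis
    by (rule Lim_transform_eventually) (rule positive_at_right, simp add: field_simps)
qed

lemma transition_stay_tendsto: "((\<lambda>h. transition i i h) \<longlongrightarrow> 1) (at_right 0)"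
proof -
  have "((\<lambda>h. (transition i i h - (1 - lam i * h)) / h * h + (1 - lam i * h)) \<longlongrightarrow> 0 * 0 + (1 - lam i * 0)) (at_right 0)"
    by (intro tendsto_intros transition_stay_quotient tendsto_h_at_right)
  then have "((\<lambda>h. (transition i i h - (1 - lam i * h)) / h * h + (1 - lam i * h)) \<longlongrightarrow> 1) (at_right 0)" by simp
  then show ?thesis
    by (rule Lim_transform_eventually) (rule positive_at_right, simp)
qed

text \<open>The probability that the state at time \<open>h\<close> is not \<open>k\<close> or flow
  \<open>k\<close> is not silent, for the start in \<open>k\<close>, plus the bound on atypical
  paths.\<close>

definition lag :: "'s \<Rightarrow> real \<Rightarrow> real" where
  "lag k h = 1 - transition k k h * exp (- \<alpha> k * h) + (\<Sum>l\<in>UNIV. lam l) * lam k * h\<^sup>2"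

lemma stay_quiet_le: "0 \<le> h \<Longrightarrow> transition k k h * exp (- \<alpha> k * h) \<le> 1"
  using transition_bounds[of k k h] \<alpha>_pos[of k] by (intro mult_le_one) auto

lemma sum_lam_nonneg: "0 \<le> (\<Sum>l\<in>UNIV. lam l)"
  using lam_pos by (intro sum_nonneg) (auto intro: less_imp_le)

lemma lag_nonneg: "0 \<le> h \<Longrightarrow> 0 \<le> lag k h"
  unfolding lag_def using stay_quiet_le[of h k] sum_lam_nonneg lam_pos[of k] by simp

lemma lag_tendsto: "(lag k \<longlongrightarrow> 0) (at_right 0)"
proof -
  have "(lag k \<longlongrightarrow> 1 - 1 * exp (- \<alpha> k * 0) + (\<Sum>l\<in>UNIV. lam l) * lam k * 0\<^sup>2) (at_right 0)"
    unfolding lag_def[abs_def] by (intro tendsto_intros transition_stay_tendsto tendsto_h_at_right)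
  then show ?thesis by simp
qed

text \<open>In \<open>one_step_lower\<close> the nonnegative jump and claim terms are dropped; the
  weight that the remaining term lacks is at most the first part of \<open>lag k h\<close>, because
  \<open>surv\<close> is at most 1.\<close>

lemma surv_flow_le:
  assumes "0 < h" "0 \<le> y"
  shows "surv k (U k y h) \<le> surv k y + lag k h"
proof -
  have "0 \<le> (\<Sum>l\<in>UNIV - {k}. transition k l h * exp (- (\<Sum>j\<in>UNIV. \<alpha> j) * h) * surv l y)"
    using transition_bounds surv_bounds by (intro sum_nonneg mult_nonneg_nonneg) auto
  moreover have "0 \<le> transition k k h * (\<alpha> k * h * exp (- \<alpha> k * h)) * claim_surv k y"
    using transition_bounds claim_surv_bounds \<alpha>_pos[of k] assms by (intro mult_nonneg_nonneg) auto
  ultimately have "transition k k h * exp (- \<alpha> k * h) * surv k (U k y h) \<le> surv k y + (\<Sum>l\<in>UNIV. lam l) * lam k * h\<^sup>2"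
    using one_step_lower[OF assms, of k] by linarith
  moreover have "(1 - transition k k h * exp (- \<alpha> k * h)) * surv k (U k y h) \<le> (1 - transition k k h * exp (- \<alpha> k * h)) * 1"
    using stay_quiet_le[of h k] surv_bounds assms by (intro mult_left_mono) auto
  ultimately show ?thesis by (simp add: lag_def algebra_simps)
qed

definition source_rate :: "'s \<Rightarrow> real \<Rightarrow> real" where
  "source_rate i v = lam i * (\<Sum>k\<in>UNIV. p i k * surv k v) + \<alpha> i * claim_surv i v"

text \<open>The three parts belong to the first-order expansion of the transition probability, the
  removal of the extra growth step in state \<open>k\<close>, and an arrival in some flow.\<close>

definition jump_error :: "'s \<Rightarrow> 's \<Rightarrow> real \<Rightarrow> real" where
  "jump_error i k h = \<bar>transition i k h - lam i * p i k * h\<bar> + transition i k h * lag k h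
    + transition i k h * (1 - exp (- (\<Sum>j\<in>UNIV. \<alpha> j) * h))"

text \<open>One error for both estimates, collecting the corrections of all their terms. The capital
  does not occur in it, which is the uniformity that allows a bound along a whole
  trajectory.\<close>

definition step_error :: "'s \<Rightarrow> real \<Rightarrow> real" where
  "step_error i h = \<bar>transition i i h * exp (- \<alpha> i * h) - exp (- (\<alpha> i + lam i) * h)\<bar>
    + (\<Sum>k\<in>UNIV - {i}. jump_error i k h)
    + \<bar>transition i i h * (\<alpha> i * h * exp (- \<alpha> i * h)) - \<alpha> i * h\<bar> + \<alpha> i * h * lag i h
    + (\<Sum>k\<in>UNIV. lam k) * lam i * h\<^sup>2 + \<bar>1 - exp (- \<alpha> i * h) - \<alpha> i * h * exp (- \<alpha> i * h)\<bar>"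

lemma jump_error_quotient:
  assumes "i \<noteq> k" shows "((\<lambda>h. jump_error i k h / h) \<longlongrightarrow> 0) (at_right 0)"
proof -
  let ?A = "\<Sum>j\<in>UNIV. \<alpha> j"
  have "((\<lambda>h. \<bar>(transition i k h - lam i * p i k * h) / h\<bar> + transition i k h / h * lag k h + transition i k h / h * (1 - exp (- ?A * h))) \<longlongrightarrow>
    \<bar>0\<bar> + lam i * p i k * 0 + lam i * p i k * (1 - exp (- ?A * 0))) (at_right 0)"
    by (intro tendsto_intros transition_quotient transition_rate lag_tendsto tendsto_h_at_right assms)
  then have "((\<lambda>h. \<bar>(transition i k h - lam i * p i k * h) / h\<bar> + transition i k h / h * lag k h + transition i k h / h * (1 - exp (- ?A * h))) \<longlongrightarrow> 0) (at_right 0)"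
    by simp
  then show ?thesis
    by (rule Lim_transform_eventually)
      (rule positive_at_right, simp add: jump_error_def add_divide_distrib abs_divide)
qed

text \<open>After division by \<open>h\<close> the terms with transition probabilities converge by
  the first-order limits, and the purely exponential ones because they vanish at 0 together with
  their derivative.\<close>

lemma step_error_quotient: "((\<lambda>h. step_error i h / h) \<longlongrightarrow> 0) (at_right 0)"
proof -
  \<comment> \<open>Inserting \<open>1 - lam i * h\<close> for the transition probability separates
    the error of the environment from an explicit function of \<open>h\<close>.\<close>
  define q1 where "q1 h = (transition i i h - (1 - lam i * h)) / h * exp (- \<alpha> i * h) +
    ((1 - lam i * h) * exp (- \<alpha> i * h) - exp (- (\<alpha> i + lam i) * h)) / h" for h
  define q2 where "q2 h = \<alpha> i * (transition i i h * exp (- \<alpha> i * h) - 1)" for h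
  define q3 where "q3 h = (1 - exp (- \<alpha> i * h) - \<alpha> i * h * exp (- \<alpha> i * h)) / h" for h
  have "((\<lambda>h. ((1 - lam i * h) * exp (- \<alpha> i * h) - exp (- (\<alpha> i + lam i) * h)) / h) \<longlongrightarrow> 0) (at_right 0)"
    by (rule DERIV_zero_quotient) (auto intro!: derivative_eq_intros)
  then have "(q1 \<longlongrightarrow> 0 * exp (- \<alpha> i * 0) + 0) (at_right 0)"
    unfolding q1_def[abs_def] by (intro tendsto_intros transition_stay_quotient tendsto_h_at_right)
  then have q1: "(q1 \<longlongrightarrow> 0) (at_right 0)" by simp
  have "(q2 \<longlongrightarrow> \<alpha> i * (1 * exp (- \<alpha> i * 0) - 1)) (at_right 0)"
    unfolding q2_def[abs_def] by (intro tendsto_intros transition_stay_tendsto tendsto_h_at_right)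
  then have q2: "(q2 \<longlongrightarrow> 0) (at_right 0)" by simp
  have q3: "(q3 \<longlongrightarrow> 0) (at_right 0)"
    unfolding q3_def[abs_def] by (rule DERIV_zero_quotient) (auto intro!: derivative_eq_intros)
  have "((\<lambda>h. \<bar>q1 h\<bar> + (\<Sum>k\<in>UNIV - {i}. jump_error i k h / h) + \<bar>q2 h\<bar> + \<alpha> i * lag i h + (\<Sum>k\<in>UNIV. lam k) * lam i * h + \<bar>q3 h\<bar>) \<longlongrightarrow>
     \<bar>0\<bar> + (\<Sum>k\<in>UNIV - {i}. 0) + \<bar>0\<bar> + \<alpha> i * 0 + (\<Sum>k\<in>UNIV. lam k) * lam i * 0 + \<bar>0\<bar>) (at_right 0)"
    by (intro tendsto_intros q1 q2 q3 lag_tendsto tendsto_h_at_right jump_error_quotient) auto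
  then have "((\<lambda>h. \<bar>q1 h\<bar> + (\<Sum>k\<in>UNIV - {i}. jump_error i k h / h) + \<bar>q2 h\<bar> + \<alpha> i * lag i h + (\<Sum>k\<in>UNIV. lam k) * lam i * h + \<bar>q3 h\<bar>) \<longlongrightarrow> 0) (at_right 0)"
    by simp
  then show ?thesis
  proof (rule Lim_transform_eventually, intro positive_at_right)
    fix h :: real assume h: "0 < h"
    have 1: "\<bar>q1 h\<bar> = \<bar>transition i i h * exp (- \<alpha> i * h) - exp (- (\<alpha> i + lam i) * h)\<bar> / h"
    proof -
      have "q1 h = (transition i i h * exp (- \<alpha> i * h) - exp (- (\<alpha> i + lam i) * h)) / h"
        unfolding q1_def times_divide_eq_left add_divide_distrib[symmetric] by (simp add: algebra_simps)
      then show ?thesis using h by (simp add: abs_divide)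
    qed
    have 2: "\<bar>q2 h\<bar> = \<bar>transition i i h * (\<alpha> i * h * exp (- \<alpha> i * h)) - \<alpha> i * h\<bar> / h"
    proof -
      have "q2 h = (transition i i h * (\<alpha> i * h * exp (- \<alpha> i * h)) - \<alpha> i * h) / h"
        using h by (simp add: q2_def field_simps)
      then show ?thesis using h by (simp add: abs_divide)
    qed
    have 3: "\<bar>q3 h\<bar> = \<bar>1 - exp (- \<alpha> i * h) - \<alpha> i * h * exp (- \<alpha> i * h)\<bar> / h"
      using h by (simp add: q3_def abs_divide)
    show "\<bar>q1 h\<bar> + (\<Sum>k\<in>UNIV - {i}. jump_error i k h / h) + \<bar>q2 h\<bar> + \<alpha> i * lag i h + (\<Sum>k\<in>UNIV. lam k) * lam i * h + \<bar>q3 h\<bar> = step_error i h / h"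
      unfolding 1 2 3 step_error_def add_divide_distrib sum_divide_distrib using h by (simp add: power2_eq_square)
  qed
qed

lemma sum_jumps: "(\<Sum>k\<in>UNIV. p i k * surv k v) = (\<Sum>k\<in>UNIV - {i}. p i k * surv k v)"
  by (rule sum.mono_neutral_right) (auto simp: p_diag)

lemma abs_error_mult: "0 \<le> s \<Longrightarrow> s \<le> 1 \<Longrightarrow> a * s \<le> b * s + \<bar>a - b\<bar>" for a b s :: real
proof -
  assume s: "0 \<le> s" "s \<le> 1"
  have "(a - b) * s \<le> \<bar>a - b\<bar> * s" using s by (intro mult_right_mono) auto
  also have "\<dots> \<le> \<bar>a - b\<bar> * 1" using s by (intro mult_left_mono) auto
  finally show ?thesis by (simp add: algebra_simps)
qed

lemma jump_error_bounds:
  assumes h: "0 < h"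
  shows "transition i k h * (surv k v + lag k h) + transition i k h * (1 - exp (- (\<Sum>j\<in>UNIV. \<alpha> j) * h)) \<le>
      lam i * p i k * h * surv k v + jump_error i k h"
    and "lam i * p i k * h * surv k v - jump_error i k h \<le> transition i k h * exp (- (\<Sum>j\<in>UNIV. \<alpha> j) * h) * surv k v"
proof -
  let ?e = "exp (- (\<Sum>j\<in>UNIV. \<alpha> j) * h)" and ?t = "transition i k h"
  have "0 \<le> (\<Sum>j\<in>UNIV. \<alpha> j)" using \<alpha>_pos by (intro sum_nonneg) (auto intro: less_imp_le)
  then have e: "0 \<le> 1 - ?e" using h by simp
  note t = transition_bounds[of i k h] and s = surv_bounds[of k v]
  show "?t * (surv k v + lag k h) + ?t * (1 - ?e) \<le> lam i * p i k * h * surv k v + jump_error i k h"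
    using abs_error_mult[OF s, of ?t "lam i * p i k * h"] by (simp add: jump_error_def algebra_simps)
  have "lam i * p i k * h * surv k v \<le> ?t * surv k v + \<bar>?t - lam i * p i k * h\<bar>"
    using abs_error_mult[OF s, of "lam i * p i k * h" ?t] by (simp add: abs_minus_commute)
  moreover have "?t * (1 - ?e) * surv k v \<le> ?t * (1 - ?e) * 1" using t e s by (intro mult_left_mono) auto
  moreover have "0 \<le> ?t * lag k h" using t lag_nonneg[of h k] h by simp
  ultimately show "lam i * p i k * h * surv k v - jump_error i k h \<le> ?t * ?e * surv k v"
    by (simp add: jump_error_def algebra_simps)
qed

lemma step_lower:
  assumes h: "0 < h" and u: "0 \<le> u"
  shows "h * source_rate i u - step_error i h \<le> surv i u - exp (- (\<alpha> i + lam i) * h) * surv i (U i u h)"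
proof -
  have 1: "exp (- (\<alpha> i + lam i) * h) * surv i (U i u h) - \<bar>transition i i h * exp (- \<alpha> i * h) - exp (- (\<alpha> i + lam i) * h)\<bar>
    \<le> transition i i h * exp (- \<alpha> i * h) * surv i (U i u h)"
    using abs_error_mult[OF surv_bounds, of "exp (- (\<alpha> i + lam i) * h)" i "U i u h" "transition i i h * exp (- \<alpha> i * h)"]
    by (simp add: abs_minus_commute)
  have 2: "(\<Sum>k\<in>UNIV - {i}. lam i * p i k * h * surv k u) - (\<Sum>k\<in>UNIV - {i}. jump_error i k h) \<le>
    (\<Sum>k\<in>UNIV - {i}. transition i k h * exp (- (\<Sum>j\<in>UNIV. \<alpha> j) * h) * surv k u)"
    unfolding sum_subtractf[symmetric] by (intro sum_mono jump_error_bounds(2) h)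
  have 3: "\<alpha> i * h * claim_surv i u - \<bar>transition i i h * (\<alpha> i * h * exp (- \<alpha> i * h)) - \<alpha> i * h\<bar> \<le>
    transition i i h * (\<alpha> i * h * exp (- \<alpha> i * h)) * claim_surv i u"
    using abs_error_mult[OF claim_surv_bounds, of "\<alpha> i * h" i u "transition i i h * (\<alpha> i * h * exp (- \<alpha> i * h))"]
    by (simp add: abs_minus_commute)
  have R: "h * source_rate i u = (\<Sum>k\<in>UNIV - {i}. lam i * p i k * h * surv k u) + \<alpha> i * h * claim_surv i u"
    unfolding source_rate_def sum_jumps by (simp add: algebra_simps sum_distrib_left)
  have 4: "0 \<le> \<alpha> i * h * lag i h" using \<alpha>_pos[of i] lag_nonneg[of h i] h by simp
  show ?thesis using one_step_lower[OF h u, of i] 1 2 3 4 unfolding R step_error_def by linarith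
qed

text \<open>Beyond the replacement of weights as in \<open>step_lower\<close>, the arguments
  \<open>U k v h\<close> and \<open>U i (v - z) h\<close> are brought back to \<open>v\<close> and
  \<open>v - z\<close> by \<open>surv_flow_le\<close>, the latter under the claim integral.\<close>

lemma step_upper:
  assumes h: "0 < h" and u: "0 \<le> u"
  shows "surv i u - exp (- (\<alpha> i + lam i) * h) * surv i (U i u h) \<le> h * source_rate i (U i u h) + step_error i h"
proof -
  define v where "v = U i u h"
  have v: "0 \<le> v" unfolding v_def using U_nonneg[OF u] h by simp
  have 1: "transition i i h * exp (- \<alpha> i * h) * surv i v \<le>
    exp (- (\<alpha> i + lam i) * h) * surv i v + \<bar>transition i i h * exp (- \<alpha> i * h) - exp (- (\<alpha> i + lam i) * h)\<bar>"
    by (rule abs_error_mult[OF surv_bounds])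
  have 2: "(\<Sum>k\<in>UNIV - {i}. transition i k h * surv k (U k v h) + transition i k h * (1 - exp (- (\<Sum>j\<in>UNIV. \<alpha> j) * h))) \<le>
    (\<Sum>k\<in>UNIV - {i}. lam i * p i k * h * surv k v) + (\<Sum>k\<in>UNIV - {i}. jump_error i k h)"
    unfolding sum.distrib[of "\<lambda>k. lam i * p i k * h * surv k v", symmetric]
  proof (rule sum_mono)
    fix k
    have "transition i k h * surv k (U k v h) \<le> transition i k h * (surv k v + lag k h)"
      using surv_flow_le[OF h v] transition_bounds by (intro mult_left_mono) auto
    then show "transition i k h * surv k (U k v h) + transition i k h * (1 - exp (- (\<Sum>j\<in>UNIV. \<alpha> j) * h)) \<le>
      lam i * p i k * h * surv k v + jump_error i k h"
      using jump_error_bounds(1)[OF h, of i k v] by linarith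
  qed
  let ?g = "\<lambda>z. if z \<le> v then surv i (U i (v - z) h) else 0"
  have lag0: "0 \<le> lag i h" using lag_nonneg[of h i] h by simp
  have int: "(LINT z|claim_law i. ?g z) \<le> claim_surv i v + lag i h"
  proof -
    interpret C: prob_space "claim_law i" by (rule prob_space_claim_law)
    have "(LINT z|claim_law i. ?g z) \<le> (LINT z|claim_law i. surv0 i (v - z) + lag i h)"
    proof (rule integral_mono')
      show "integrable (claim_law i) (\<lambda>z. surv0 i (v - z) + lag i h)" using integrable_surv0[of i v] by simp
      fix z
      show "?g z \<le> surv0 i (v - z) + lag i h" using surv_flow_le[OF h, of "v - z" i] lag0 by (simp add: surv0_def)
      show "0 \<le> surv0 i (v - z) + lag i h" using surv0_bounds[of i "v - z"] lag0 by simp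
    qed
    also have "\<dots> = claim_surv i v + lag i h"
      unfolding claim_surv_def using integrable_surv0[of i v] by (simp add: C.prob_space)
    finally show ?thesis .
  qed
  let ?c = "transition i i h * (\<alpha> i * h * exp (- \<alpha> i * h))"
  have c: "0 \<le> ?c" "?c \<le> \<alpha> i * h"
  proof -
    show "0 \<le> ?c" using transition_bounds \<alpha>_pos[of i] h by (intro mult_nonneg_nonneg) auto
    have "?c = \<alpha> i * h * (transition i i h * exp (- \<alpha> i * h))" by simp
    also have "\<dots> \<le> \<alpha> i * h * 1" using stay_quiet_le[of h i] \<alpha>_pos[of i] h by (intro mult_left_mono) auto
    finally show "?c \<le> \<alpha> i * h" by simp
  qed
  have 3: "?c * (LINT z|claim_law i. ?g z) \<le> \<alpha> i * h * claim_surv i v + \<bar>?c - \<alpha> i * h\<bar> + \<alpha> i * h * lag i h"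
  proof -
    have "?c * (LINT z|claim_law i. ?g z) \<le> ?c * (claim_surv i v + lag i h)" using int c by (intro mult_left_mono)
    also have "\<dots> = ?c * claim_surv i v + ?c * lag i h" by (simp add: algebra_simps)
    also have "?c * claim_surv i v \<le> \<alpha> i * h * claim_surv i v + \<bar>?c - \<alpha> i * h\<bar>" by (rule abs_error_mult[OF claim_surv_bounds])
    also have "?c * lag i h \<le> \<alpha> i * h * lag i h" using c lag0 by (intro mult_right_mono)
    finally show ?thesis by simp
  qed
  have R: "h * source_rate i v = (\<Sum>k\<in>UNIV - {i}. lam i * p i k * h * surv k v) + \<alpha> i * h * claim_surv i v"
    unfolding source_rate_def sum_jumps by (simp add: algebra_simps sum_distrib_left)
  show ?thesis using one_step_upper[OF h u, of i, folded v_def] 1 2 3 unfolding v_def[symmetric] R step_error_def by linarith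
qed

lemma source_rate_bounds: "0 \<le> source_rate i v" "source_rate i v \<le> lam i + \<alpha> i"
proof -
  have s: "0 \<le> (\<Sum>k\<in>UNIV. p i k * surv k v)" using p_nonneg surv_bounds by (intro sum_nonneg mult_nonneg_nonneg) auto
  have "(\<Sum>k\<in>UNIV. p i k * surv k v) \<le> (\<Sum>k\<in>UNIV. p i k * 1)" using p_nonneg surv_bounds by (intro sum_mono mult_left_mono) auto
  then have s1: "(\<Sum>k\<in>UNIV. p i k * surv k v) \<le> 1" using p_sum by simp
  show "0 \<le> source_rate i v" unfolding source_rate_def
    using s lam_pos[of i] \<alpha>_pos[of i] claim_surv_bounds[of i v] by (intro add_nonneg_nonneg mult_nonneg_nonneg) auto
  have "lam i * (\<Sum>k\<in>UNIV. p i k * surv k v) \<le> lam i * 1" using s1 lam_pos[of i] by (intro mult_left_mono) auto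
  moreover have "\<alpha> i * claim_surv i v \<le> \<alpha> i * 1" using claim_surv_bounds[of i v] \<alpha>_pos[of i] by (intro mult_left_mono) auto
  ultimately show "source_rate i v \<le> lam i + \<alpha> i" unfolding source_rate_def by simp
qed

lemma source_rate_mono: "0 \<le> u \<Longrightarrow> u \<le> v \<Longrightarrow> source_rate i u \<le> source_rate i v"
  unfolding source_rate_def using lam_pos[of i] \<alpha>_pos[of i] p_nonneg surv_mono monoD[OF mono_claim_surv]
  by (intro add_mono mult_left_mono sum_mono) auto

text \<open>The renewal lemma along the trajectory \<open>U i u\<close>. By \<open>U_flow\<close>
  each point of it is the start of a short step, so the step estimates at arbitrary capital become
  those required at arbitrary time.\<close>

lemma surv_integral_equation:
  assumes u: "0 \<le> u"
  shows "surv i u = (LBINT t:{0..}. exp (- t * (\<alpha> i + lam i)) * source_rate i (U i u t))"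
proof -
  have "surv i (U i u 0) = (LBINT t:{0..}. exp (- t * (\<alpha> i + lam i)) * source_rate i (U i u t))"
  proof (rule discrete_renewal_equation[where b="lam i + \<alpha> i" and E="step_error i" and g="\<lambda>t. surv i (U i u t)" and r="\<lambda>t. source_rate i (U i u t)"])
    show "0 < \<alpha> i + lam i" using \<alpha>_pos[of i] lam_pos[of i] by simp
    show "source_rate i (U i u s) \<le> source_rate i (U i u t)" if "0 \<le> s" "s \<le> t" for s t
      using that u by (intro source_rate_mono U_nonneg U_mono_time) auto
    fix t h :: real assume t: "0 \<le> t" and h: "0 < h"
    have f: "U i u (t + h) = U i (U i u t) h" using U_flow[OF u t, of h i] h by simp
    show "h * source_rate i (U i u t) - step_error i h \<le> surv i (U i u t) - exp (- (\<alpha> i + lam i) * h) * surv i (U i u (t + h))"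
      unfolding f by (rule step_lower[OF h U_nonneg[OF u t]])
    show "surv i (U i u t) - exp (- (\<alpha> i + lam i) * h) * surv i (U i u (t + h)) \<le> h * source_rate i (U i u (t + h)) + step_error i h"
      unfolding f by (rule step_upper[OF h U_nonneg[OF u t]])
  qed (auto simp: surv_bounds source_rate_bounds step_error_quotient)
  then show ?thesis using U_0[OF u] by simp
qed

text \<open>\<open>F i 0 = 0\<close> excludes negative claims and also an atom at 0, so the closed
  left end of the Stieltjes integral is harmless.\<close>

lemma AE_claim_positive: "AE z in claim_law i. 0 < z"
proof -
  interpret C: prob_space "claim_law i" by (rule prob_space_claim_law)
  have "measure (claim_law i) {..0} = 0"
    using fun_cong[OF claim_distribution[of i i 0], of 0] F_nonpos[of 0 i] claim_law_eq_distr[of i i 0] by (simp add: cdf_def)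
  then have "{..0} \<in> null_sets (claim_law i)" by (auto simp: null_sets_def C.emeasure_eq_measure)
  from AE_not_in[OF this] show ?thesis by (simp add: not_le)
qed

text \<open>Claims above \<open>v\<close> are removed by \<open>surv0\<close> and nonpositive claims
  are null, so the integral over the line is the one over \<open>{0..v}\<close>. There the remaining
  capital is nonnegative, and \<open>surv\<close> agrees with \<open>nonruin_prob\<close>.\<close>

lemma claim_surv_eq_set_integral:
  "claim_surv i v = (LINT z:{0..v}|interval_measure (F i). nonruin_prob P \<xi> i (v - z))"
proof -
  have "claim_surv i v = (LINT z|claim_law i. indicator {0..v} z * nonruin_prob P \<xi> i (v - z))"
    unfolding claim_surv_def
  proof (rule integral_cong_AE)
    show "AE z in claim_law i. surv0 i (v - z) = indicator {0..v} z * nonruin_prob P \<xi> i (v - z)"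
      using AE_claim_positive by eventually_elim (auto simp: surv0_def indicator_def nonruin_prob_eq surv_def)
    have "(\<lambda>z. indicator {0..v} z * nonruin_prob P \<xi> i (v - z)) = (\<lambda>z. indicator {0..v} z * surv0 i (v - z))"
      by (auto simp: fun_eq_iff surv0_def indicator_def nonruin_prob_eq surv_def)
    then show "(\<lambda>z. indicator {0..v} z * nonruin_prob P \<xi> i (v - z)) \<in> borel_measurable (claim_law i)"
      by (simp add: measurable_cong_sets[OF sets_claim_law refl])
  qed (simp add: measurable_cong_sets[OF sets_claim_law refl])
  then show ?thesis by (simp add: set_lebesgue_integral_def claim_law_def)
qed

theorem nonruin_integral_equation:
  assumes u: "0 \<le> u"
  shows "nonruin_prob P \<xi> i u =
    (LBINT t:{0..}. exp (- t * (\<alpha> i + lam i)) *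
      (lam i * (\<Sum>j\<in>UNIV. p i j * nonruin_prob P \<xi> j (U i u t)) +
       \<alpha> i * (LINT z:{0..U i u t}|interval_measure (F i). nonruin_prob P \<xi> i (U i u t - z))))"
proof -
  have "nonruin_prob P \<xi> i u = surv i u" using nonruin_prob_eq[OF u] by (simp add: surv_def)
  also have "\<dots> = (LBINT t:{0..}. exp (- t * (\<alpha> i + lam i)) * source_rate i (U i u t))"
    by (rule surv_integral_equation[OF u])
  also have "\<dots> = (LBINT t:{0..}. exp (- t * (\<alpha> i + lam i)) *
      (lam i * (\<Sum>j\<in>UNIV. p i j * nonruin_prob P \<xi> j (U i u t)) +
       \<alpha> i * (LINT z:{0..U i u t}|interval_measure (F i). nonruin_prob P \<xi> i (U i u t - z))))"
    using U_nonneg[OF u] nonruin_prob_eq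
    by (intro set_lebesgue_integral_cong) (auto simp: source_rate_def claim_surv_eq_set_integral surv_def)
  finally show ?thesis .
qed

end

theorem theorem7p4:
  fixes P :: "'s::finite \<Rightarrow> 'w measure"
    and J :: "real \<Rightarrow> 'w \<Rightarrow> 's"
    and lam \<alpha> \<mu> :: "'s \<Rightarrow> real"
    and p :: "'s \<Rightarrow> 's \<Rightarrow> real"
    and F :: "'s \<Rightarrow> real \<Rightarrow> real"
    and c :: "'s \<Rightarrow> real \<Rightarrow> real"
    and U :: "'s \<Rightarrow> real \<Rightarrow> real \<Rightarrow> real"
    and T Z :: "'s \<Rightarrow> nat \<Rightarrow> 'w \<Rightarrow> real"
    and \<xi> :: "real \<Rightarrow> real \<Rightarrow> 'w \<Rightarrow> real"
    and i :: 's
    and u :: real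
  assumes "markov_environment_risk_process P J lam p \<alpha> F \<mu> c U T Z \<xi>"
    and "0 \<le> u"
  shows "nonruin_prob P \<xi> i u =
    (LBINT t:{0..}. exp (- t * (\<alpha> i + lam i)) *
      (lam i * (\<Sum>j\<in>UNIV. p i j * nonruin_prob P \<xi> j (U i u t)) +
       \<alpha> i * (LINT z:{0..U i u t}|interval_measure (F i).
                nonruin_prob P \<xi> i (U i u t - z))))"
  by (rule markov_environment_risk_process.nonruin_integral_equation[OF assms])

end
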